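(* Let $\Gamma$ be a discrete group having only finitely many finite subgroups up to conjugacy, let $\mathbb{K}$ be a field of characteristic $0$, and let $\mathcal{F}$ be a family of finite subgroups of $\Gamma$. If $\Gamma$ is virtually torsion-free, then $$\dim_{\mathbb{Q}}K_0(\mathbb{K}[\Gamma])\otimes\mathbb{Q}\ \geq\ \dim_{\mathbb{Q}}(\mathrm{im}\,j_{\mathcal{F}})\otimes\mathbb{Q},$$ where $j_{\mathcal{F}}:\overline{G}_{\mathcal{F}}(\mathbb{K}[\Gamma])\to G_{\mathcal{F}}(\mathbb{K}[\Gamma])$ is the natural inclusion.
   Context: A group is virtually torsion-free if it contains a torsion-free subgroup of finite index. A family $\mathcal{F}$ of finite subgroups of $\Gamma$ is a non-empty collection of finite subgroups closed under conjugation and under taking subgroups. $K_0(\mathbb{K}[\Gamma])$ is the Grothendieck group of finitely generated projective $\mathbb{K}[\Gamma]$-modules. For a finite group $H$, $G(\mathbb{K}[H])$ is the Grothendieck ring of finitely generated $\mathbb{K}[H]$-modules (relations from short exact sequences; product $\otimes_{\mathbb{K}}$ with diagonal action). $G_{\mathcal{F}}(\mathbb{K}[\Gamma])=\varprojlim_{H\in\mathcal{F}} G(\mathbb{K}[H])$ is the subring of those $(x_H)\in\prod_{H\in\mathcal{F}}G(\mathbb{K}[H])$ such that (1) $\mathrm{res}^K_H(x_K)=x_H$ whenever $H\subseteq K$ are in $\mathcal{F}$, and (2) $C_\gamma^*(x_K)=x_H$ whenever $K=\gamma H\gamma^{-1}$, where $C_\gamma^*:G(\mathbb{K}[\gamma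 H\gamma^{-1}])\to G(\mathbb{K}[H])$ is induced by the homomorphism $H\to\gamma H\gamma^{-1}$, $h\mapsto \gamma h\gamma^{-1}$. $G^f(\mathbb{K}[\Gamma])$ is the Grothendieck ring of $\mathbb{K}[\Gamma]$-modules that are finite dimensional over $\mathbb{K}$ (relations from short exact sequences), and $\overline{G}_{\mathcal{F}}(\mathbb{K}[\Gamma])$ is the image of the product of restriction maps $G^f(\mathbb{K}[\Gamma])\to\prod_{H\in\mathcal{F}}G(\mathbb{K}[H])$. This image lies in $G_{\mathcal{F}}(\mathbb{K}[\Gamma])$, which gives the inclusion $j_{\mathcal{F}}$. *)

theory Defs
  imports
    "HOL-Algebra.Product_Groups"
    "HOL-Algebra.Free_Abelian_Groups"
    "HOL-Algebra.Generated_Groups"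
    "Jordan_Normal_Form.VS_Connect"
begin

unbundle cardinal_syntax


section \<open>Groups\<close>

definition conj_subgroup :: "('g, 'a) monoid_scheme \<Rightarrow> 'g \<Rightarrow> 'g set \<Rightarrow> 'g set" where
  "conj_subgroup \<Gamma> \<gamma> H = (\<lambda>h. \<gamma> \<otimes>\<^bsub>\<Gamma>\<^esub> h \<otimes>\<^bsub>\<Gamma>\<^esub> inv\<^bsub>\<Gamma>\<^esub> \<gamma>) ` H"

definition finite_subgroups :: "('g, 'a) monoid_scheme \<Rightarrow> 'g set set" where
  "finite_subgroups \<Gamma> = {H. subgroup H \<Gamma> \<and> finite H}"

definition finitely_many_finite_subgroups_up_to_conj :: "('g, 'a) monoid_scheme \<Rightarrow> bool" where
  "finitely_many_finite_subgroups_up_to_conj \<Gamma> \<longleftrightarrow>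
     finite ((\<lambda>H. {conj_subgroup \<Gamma> \<gamma> H | \<gamma>. \<gamma> \<in> carrier \<Gamma>}) ` finite_subgroups \<Gamma>)"

definition torsion_free :: "('g, 'a) monoid_scheme \<Rightarrow> bool" where
  "torsion_free \<Gamma> \<longleftrightarrow> (\<forall>x\<in>carrier \<Gamma>. \<forall>n>0. x [^]\<^bsub>\<Gamma>\<^esub> (n::nat) = \<one>\<^bsub>\<Gamma>\<^esub> \<longrightarrow> x = \<one>\<^bsub>\<Gamma>\<^esub>)"

definition virtually_torsion_free :: "('g, 'a) monoid_scheme \<Rightarrow> bool" where
  "virtually_torsion_free \<Gamma> \<longleftrightarrow>
     (\<exists>N. subgroup N \<Gamma> \<and> finite (rcosets\<^bsub>\<Gamma>\<^esub> N) \<and> torsion_free (\<Gamma>\<lparr>carrier := N\<rparr>))"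

definition family_of_finite_subgroups :: "('g, 'a) monoid_scheme \<Rightarrow> 'g set set \<Rightarrow> bool" where
  "family_of_finite_subgroups \<Gamma> \<F> \<longleftrightarrow>
     \<F> \<noteq> {} \<and> \<F> \<subseteq> finite_subgroups \<Gamma> \<and>
     (\<forall>H\<in>\<F>. \<forall>\<gamma>\<in>carrier \<Gamma>. conj_subgroup \<Gamma> \<gamma> H \<in> \<F>) \<and>
     (\<forall>H\<in>\<F>. \<forall>L. subgroup L \<Gamma> \<and> L \<subseteq> H \<longrightarrow> L \<in> \<F>)"


section \<open>Group rings\<close>

text \<open>The field is a type of class \<^class>\<open>field\<close>; the first argument only selects that type. For a
  subgroup \<open>H\<close> of \<open>\<Gamma>\<close> the group ring of \<open>\<Gamma>\<lparr>carrier := H\<rparr>\<close> is the subring of the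
  group ring of \<open>\<Gamma>\<close> of elements supported on \<open>H\<close>.\<close>

definition group_ring :: "'k::field itself \<Rightarrow> ('g, 'a) monoid_scheme \<Rightarrow> ('g \<Rightarrow>\<^sub>0 'k) ring" where
  "group_ring k \<Gamma> =
     \<lparr>carrier = {f. Poly_Mapping.keys f \<subseteq> carrier \<Gamma>},
      monoid.mult = (\<lambda>f g. \<Sum>x\<in>Poly_Mapping.keys f. \<Sum>y\<in>Poly_Mapping.keys g.
        Poly_Mapping.single (x \<otimes>\<^bsub>\<Gamma>\<^esub> y) (Poly_Mapping.lookup f x * Poly_Mapping.lookup g y)),
      one = Poly_Mapping.single \<one>\<^bsub>\<Gamma>\<^esub> 1,
      zero = 0,
      add = (+)\<rparr>"

text \<open>The ring homomorphism induced by a group homomorphism.\<close>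

definition group_ring_map :: "('g \<Rightarrow> 'h) \<Rightarrow> ('g \<Rightarrow>\<^sub>0 'k::field) \<Rightarrow> ('h \<Rightarrow>\<^sub>0 'k)" where
  "group_ring_map \<phi> f =
     (\<Sum>x\<in>Poly_Mapping.keys f. Poly_Mapping.single (\<phi> x) (Poly_Mapping.lookup f x))"


section \<open>Left modules over a (noncommutative) ring\<close>

text \<open>As the locale \<^locale>\<open>module\<close>, but without commutativity of the ring. As usual for
  \<^typ>\<open>('r, 'm) module\<close>, the fields \<open>mult\<close> and \<open>one\<close> of the record are unused.\<close>

locale left_module = R?: ring R + M?: abelian_group M
  for R :: "('r, 'a) ring_scheme" (structure) and M :: "('r, 'm, 'b) module_scheme" (structure) +
  assumes smult_closed:
      "\<lbrakk>a \<in> carrier R; x \<in> carrier M\<rbrakk> \<Longrightarrow> a \<odot>\<^bsub>M\<^esub> x \<in> carrier M"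
    and smult_l_distr:
      "\<lbrakk>a \<in> carrier R; b \<in> carrier R; x \<in> carrier M\<rbrakk> \<Longrightarrow>
         (a \<oplus>\<^bsub>R\<^esub> b) \<odot>\<^bsub>M\<^esub> x = (a \<odot>\<^bsub>M\<^esub> x) \<oplus>\<^bsub>M\<^esub> (b \<odot>\<^bsub>M\<^esub> x)"
    and smult_r_distr:
      "\<lbrakk>a \<in> carrier R; x \<in> carrier M; y \<in> carrier M\<rbrakk> \<Longrightarrow>
         a \<odot>\<^bsub>M\<^esub> (x \<oplus>\<^bsub>M\<^esub> y) = (a \<odot>\<^bsub>M\<^esub> x) \<oplus>\<^bsub>M\<^esub> (a \<odot>\<^bsub>M\<^esub> y)"
    and smult_assoc1:
      "\<lbrakk>a \<in> carrier R; b \<in> carrier R; x \<in> carrier M\<rbrakk> \<Longrightarrow>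
         (a \<otimes>\<^bsub>R\<^esub> b) \<odot>\<^bsub>M\<^esub> x = a \<odot>\<^bsub>M\<^esub> (b \<odot>\<^bsub>M\<^esub> x)"
    and smult_one: "x \<in> carrier M \<Longrightarrow> \<one>\<^bsub>R\<^esub> \<odot>\<^bsub>M\<^esub> x = x"

text \<open>A finitely generated module over a ring with elements of type \<^typ>\<open>'r\<close> is a quotient of a
  finite free module, so it injects as a set into \<^typ>\<open>nat \<Rightarrow> 'r\<close> and is isomorphic to a
  module whose underlying set consists of elements of that type. These modules therefore represent
  all isomorphism classes of finitely generated modules, and hence also of those modules over a group
  algebra that are finite dimensional over the field.\<close>

type_synonym 'r fmod = "('r, nat \<Rightarrow> 'r) module"

definition fin_generated :: "('r, 'a) ring_scheme \<Rightarrow> ('r, 'm, 'b) module_scheme \<Rightarrow> bool" where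
  "fin_generated R M \<longleftrightarrow>
     (\<exists>A. finite A \<and> A \<subseteq> carrier M \<and>
        carrier M = {\<Oplus>\<^bsub>M\<^esub>x\<in>A. c x \<odot>\<^bsub>M\<^esub> x | c. c \<in> A \<rightarrow> carrier R})"

text \<open>The lifting property, tested on modules with elements in \<^typ>\<open>nat \<Rightarrow> 'r\<close>. For finitely
  generated \<open>P\<close> this restriction is harmless: the finite free modules are among the test modules, so
  \<open>P\<close> is a direct summand of one of them and lifts against all surjections.\<close>

definition projective :: "('r, 'a) ring_scheme \<Rightarrow> 'r fmod \<Rightarrow> bool" where
  "projective R P \<longleftrightarrow>
     (\<forall>(M :: 'r fmod) (N :: 'r fmod). \<forall>p\<in>LinearCombinations.module_hom R M N. \<forall>f\<in>LinearCombinations.module_hom R P N.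
        left_module R M \<and> left_module R N \<and> p ` carrier M = carrier N \<longrightarrow>
        (\<exists>g\<in>LinearCombinations.module_hom R P M. \<forall>x\<in>carrier P. p (g x) = f x))"

definition restrict_scalars :: "('r \<Rightarrow> 's) \<Rightarrow> ('s, 'm) module \<Rightarrow> ('r, 'm) module" where
  "restrict_scalars \<phi> M =
     \<lparr>carrier = carrier M, monoid.mult = monoid.mult M, one = one M,
      zero = zero M, add = add M, smult = (\<lambda>r x. \<phi> r \<odot>\<^bsub>M\<^esub> x)\<rparr>"

definition short_exact ::
  "('r, 'a) ring_scheme \<Rightarrow> ('r, 'm) module \<Rightarrow> ('r, 'm) module \<Rightarrow> ('r, 'm) module \<Rightarrow> bool" where
  "short_exact R M' M M'' \<longleftrightarrow>
     (\<exists>i\<in>LinearCombinations.module_hom R M' M. \<exists>p\<in>LinearCombinations.module_hom R M M''.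
        inj_on i (carrier M') \<and>
        i ` carrier M' = {x \<in> carrier M. p x = \<zero>\<^bsub>M''\<^esub>} \<and>
        p ` carrier M = carrier M'')"


section \<open>Grothendieck groups\<close>

text \<open>The Grothendieck group of a class \<open>S\<close> of left \<open>R\<close>-modules: the free abelian group on
  \<open>S\<close> modulo \<open>[M] = [M'] + [M'']\<close> for all short exact sequences in \<open>S\<close>; isomorphic modules
  get identified because \<open>S\<close> contains the zero module in all uses. Groups are
  written multiplicatively as records. For finitely generated projective modules all short exact
  sequences split, so the relations are those of direct sums. Of the Grothendieck rings only the additive groups are
  formalized.\<close>

definition groth_relators ::
  "('r, 'a) ring_scheme \<Rightarrow> ('r, 'm) module set \<Rightarrow> (('r, 'm) module \<Rightarrow>\<^sub>0 int) set" where
  "groth_relators R S =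
     {frag_of M - (frag_of M' + frag_of M'') | M' M M''.
        M' \<in> S \<and> M \<in> S \<and> M'' \<in> S \<and> short_exact R M' M M''}"

definition groth_subgroup ::
  "('r, 'a) ring_scheme \<Rightarrow> ('r, 'm) module set \<Rightarrow> (('r, 'm) module \<Rightarrow>\<^sub>0 int) set" where
  "groth_subgroup R S = generate (free_Abelian_group S) (groth_relators R S)"

definition groth_group ::
  "('r, 'a) ring_scheme \<Rightarrow> ('r, 'm) module set \<Rightarrow> (('r, 'm) module \<Rightarrow>\<^sub>0 int) set monoid" where
  "groth_group R S = free_Abelian_group S Mod groth_subgroup R S"

text \<open>The map into \<^term>\<open>groth_group R S\<close> induced by an exact functor \<open>T\<close>. A class is a
  coset \<open>X\<close>; the coset of the image of any of its elements is obtained by saturating the image of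
  \<open>X\<close> under the target subgroup.\<close>

definition groth_map ::
  "('r, 'a) ring_scheme \<Rightarrow> ('r, 'm) module set \<Rightarrow> ('n \<Rightarrow> ('r, 'm) module) \<Rightarrow>
   ('n \<Rightarrow>\<^sub>0 int) set \<Rightarrow> (('r, 'm) module \<Rightarrow>\<^sub>0 int) set" where
  "groth_map R S T X =
     groth_subgroup R S <#>\<^bsub>free_Abelian_group S\<^esub> (frag_extend (\<lambda>M. frag_of (T M)) ` X)"

definition fg_modules :: "('r, 'a) ring_scheme \<Rightarrow> 'r fmod set" where
  "fg_modules R = {M. left_module R M \<and> fin_generated R M}"

definition fg_projectives :: "('r, 'a) ring_scheme \<Rightarrow> 'r fmod set" where
  "fg_projectives R = {P. left_module R P \<and> fin_generated R P \<and> projective R P}"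

definition findim_modules ::
  "'k::field itself \<Rightarrow> ('g, 'a) monoid_scheme \<Rightarrow> ('g \<Rightarrow>\<^sub>0 'k) fmod set" where
  "findim_modules k \<Gamma> =
     {M. left_module (group_ring k \<Gamma>) M \<and>
         vectorspace.fin_dim (class_ring :: 'k ring)
           (restrict_scalars (Poly_Mapping.single \<one>\<^bsub>\<Gamma>\<^esub>) M)}"

definition K0_group :: "('r, 'a) ring_scheme \<Rightarrow> ('r fmod \<Rightarrow>\<^sub>0 int) set monoid" where
  "K0_group R = groth_group R (fg_projectives R)"

definition G_group :: "('r, 'a) ring_scheme \<Rightarrow> ('r fmod \<Rightarrow>\<^sub>0 int) set monoid" where
  "G_group R = groth_group R (fg_modules R)"

definition Gf_group ::
  "'k::field itself \<Rightarrow> ('g, 'a) monoid_scheme \<Rightarrow> (('g \<Rightarrow>\<^sub>0 'k) fmod \<Rightarrow>\<^sub>0 int) set monoid" where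
  "Gf_group k \<Gamma> = groth_group (group_ring k \<Gamma>) (findim_modules k \<Gamma>)"

text \<open>The map to the Grothendieck group over the group ring of \<open>H\<close> given by pulling modules back
  along a group homomorphism \<open>\<phi>\<close> defined on \<open>H\<close>. It serves as a map both from
  \<^const>\<open>G_group\<close> and from \<^const>\<open>Gf_group\<close>.\<close>

definition pullback ::
  "'k::field itself \<Rightarrow> ('g, 'a) monoid_scheme \<Rightarrow> ('g \<Rightarrow> 'g) \<Rightarrow>
   (('g \<Rightarrow>\<^sub>0 'k) fmod \<Rightarrow>\<^sub>0 int) set \<Rightarrow> (('g \<Rightarrow>\<^sub>0 'k) fmod \<Rightarrow>\<^sub>0 int) set" where
  "pullback k H \<phi> =
     groth_map (group_ring k H) (fg_modules (group_ring k H))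
       (restrict_scalars (group_ring_map \<phi>))"

definition res_map ::
  "'k::field itself \<Rightarrow> ('g, 'a) monoid_scheme \<Rightarrow> 'g set \<Rightarrow>
   (('g \<Rightarrow>\<^sub>0 'k) fmod \<Rightarrow>\<^sub>0 int) set \<Rightarrow> (('g \<Rightarrow>\<^sub>0 'k) fmod \<Rightarrow>\<^sub>0 int) set" where
  "res_map k \<Gamma> H = pullback k (\<Gamma>\<lparr>carrier := H\<rparr>) (\<lambda>h. h)"

definition conj_map ::
  "'k::field itself \<Rightarrow> ('g, 'a) monoid_scheme \<Rightarrow> 'g \<Rightarrow> 'g set \<Rightarrow>
   (('g \<Rightarrow>\<^sub>0 'k) fmod \<Rightarrow>\<^sub>0 int) set \<Rightarrow> (('g \<Rightarrow>\<^sub>0 'k) fmod \<Rightarrow>\<^sub>0 int) set" where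
  "conj_map k \<Gamma> \<gamma> H =
     pullback k (\<Gamma>\<lparr>carrier := H\<rparr>) (\<lambda>h. \<gamma> \<otimes>\<^bsub>\<Gamma>\<^esub> h \<otimes>\<^bsub>\<Gamma>\<^esub> inv\<^bsub>\<Gamma>\<^esub> \<gamma>)"

definition G_prod ::
  "'k::field itself \<Rightarrow> ('g, 'a) monoid_scheme \<Rightarrow> 'g set set \<Rightarrow>
   ('g set \<Rightarrow> (('g \<Rightarrow>\<^sub>0 'k) fmod \<Rightarrow>\<^sub>0 int) set) monoid" where
  "G_prod k \<Gamma> \<F> = product_group \<F> (\<lambda>H. G_group (group_ring k (\<Gamma>\<lparr>carrier := H\<rparr>)))"

definition G_lim ::
  "'k::field itself \<Rightarrow> ('g, 'a) monoid_scheme \<Rightarrow> 'g set set \<Rightarrow>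
   ('g set \<Rightarrow> (('g \<Rightarrow>\<^sub>0 'k) fmod \<Rightarrow>\<^sub>0 int) set) monoid" where
  "G_lim k \<Gamma> \<F> = (G_prod k \<Gamma> \<F>)\<lparr>carrier :=
     {x \<in> carrier (G_prod k \<Gamma> \<F>).
        (\<forall>H\<in>\<F>. \<forall>K\<in>\<F>. H \<subseteq> K \<longrightarrow> res_map k \<Gamma> H (x K) = x H) \<and>
        (\<forall>H\<in>\<F>. \<forall>K\<in>\<F>. \<forall>\<gamma>\<in>carrier \<Gamma>.
           K = conj_subgroup \<Gamma> \<gamma> H \<longrightarrow> conj_map k \<Gamma> \<gamma> H (x K) = x H)}\<rparr>"

definition G_bar ::
  "'k::field itself \<Rightarrow> ('g, 'a) monoid_scheme \<Rightarrow> 'g set set \<Rightarrow>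
   ('g set \<Rightarrow> (('g \<Rightarrow>\<^sub>0 'k) fmod \<Rightarrow>\<^sub>0 int) set) monoid" where
  "G_bar k \<Gamma> \<F> = (G_prod k \<Gamma> \<F>)\<lparr>carrier :=
     (\<lambda>X. \<lambda>H\<in>\<F>. res_map k \<Gamma> H X) ` carrier (Gf_group k \<Gamma>)\<rparr>"

definition j_map ::
  "'k::field itself \<Rightarrow> ('g, 'a) monoid_scheme \<Rightarrow> 'g set set \<Rightarrow>
   ('g set \<Rightarrow> (('g \<Rightarrow>\<^sub>0 'k) fmod \<Rightarrow>\<^sub>0 int) set) \<Rightarrow>
   ('g set \<Rightarrow> (('g \<Rightarrow>\<^sub>0 'k) fmod \<Rightarrow>\<^sub>0 int) set)" where
  "j_map k \<Gamma> \<F> = (\<lambda>x\<in>carrier (G_bar k \<Gamma> \<F>). x)"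

definition im_j ::
  "'k::field itself \<Rightarrow> ('g, 'a) monoid_scheme \<Rightarrow> 'g set set \<Rightarrow>
   ('g set \<Rightarrow> (('g \<Rightarrow>\<^sub>0 'k) fmod \<Rightarrow>\<^sub>0 int) set) monoid" where
  "im_j k \<Gamma> \<F> = (G_lim k \<Gamma> \<F>)\<lparr>carrier := j_map k \<Gamma> \<F> ` carrier (G_bar k \<Gamma> \<F>)\<rparr>"


section \<open>Tensoring an abelian group with the rationals\<close>

text \<open>The tensor product over the integers of a (multiplicatively written) abelian group \<open>A\<close> with
  the rationals, as the free abelian group on the pairs \<open>(a, q)\<close> modulo biadditivity, with
  the rational scalars acting on the second factor.\<close>

definition tensor_subgroup :: "('a, 'b) monoid_scheme \<Rightarrow> ('a \<times> rat \<Rightarrow>\<^sub>0 int) set" where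
  "tensor_subgroup A = generate (free_Abelian_group (carrier A \<times> UNIV))
     ({frag_of (a \<otimes>\<^bsub>A\<^esub> b, q) - (frag_of (a, q) + frag_of (b, q)) | a b q.
         a \<in> carrier A \<and> b \<in> carrier A} \<union>
      {frag_of (a, q + r) - (frag_of (a, q) + frag_of (a, r)) | a q r. a \<in> carrier A})"

definition tensor_rat :: "('a, 'b) monoid_scheme \<Rightarrow> (rat, ('a \<times> rat \<Rightarrow>\<^sub>0 int) set) module" where
  "tensor_rat A =
     (let Fr = free_Abelian_group (carrier A \<times> (UNIV :: rat set)); N = tensor_subgroup A in
      \<lparr>carrier = carrier (Fr Mod N), monoid.mult = undefined, one = undefined,
       zero = \<one>\<^bsub>Fr Mod N\<^esub>, add = monoid.mult (Fr Mod N),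
       smult = (\<lambda>s X. N <#>\<^bsub>Fr\<^esub> (frag_extend (\<lambda>(a, q). frag_of (a, s * q)) ` X))\<rparr>)"

text \<open>The dimension of a rational vector space as a cardinal (the cardinal of a basis), finite or
  infinite.\<close>

definition rat_dim :: "(rat, 'v) module \<Rightarrow> 'v rel" where
  "rat_dim V = |SOME B. vectorspace.basis (class_ring :: rat ring) V B|"

end

theory Submission
  imports Defs
begin

text \<open>A finite dimensional \<open>K[\<Gamma>]\<close>-module \<open>M\<close> pairs with a finitely generated projective \<open>P\<close>
  by \<open>dim Hom(P, M)\<close>. For \<open>P = K[\<Gamma>]e\<close> with an idempotent \<open>e\<close> of \<open>K[H]\<close>, \<open>H\<close> finite, the
  value is \<open>dim eM\<close> and depends only on the restriction of \<open>M\<close> to \<open>H\<close>. Since \<open>K[H]\<close> is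
  semisimple, finitely many idempotents detect all of \<open>G(K[H])\<close>, and for modules restricted from
  \<open>\<Gamma>\<close> it suffices to take one \<open>H\<close> from each of the finitely many conjugacy classes. Thus the
  finitely many classes \<open>[K[\<Gamma>]e]\<close> separate the points of \<open>im j\<close>, and since the pairing is
  linear in \<open>K\<^sub>0\<close>, a finite spanning set of \<open>K\<^sub>0 \<otimes> \<rat>\<close> cannot be smaller than
  \<open>dim (im j \<otimes> \<rat>)\<close>.\<close>

section \<open>Linear algebra\<close>

text \<open>Two obstacles shape the argument. The field need not split the finite groups H, so
  multiplicities of simple modules are not directly visible as dimensions. What survives is that
  every simple S has an idempotent e with eS nonzero and eT = 0 for all simple T not isomorphic to
  S. The matrix of the numbers dim eT is then diagonal with nonzero entries, possibly larger than 1,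
  and this still detects integer combinations of simple classes. On the other side, K_0 is not
  assumed to have finite rank and its structure is not accessible. It is only probed by functions
  defined on it: for a fixed M, the number dim Hom(P, M) is additive in P, because a short exact
  sequence that ends in a projective module splits. Passing to one subgroup per conjugacy class is
  possible because a \<Gamma>-module M carries an action of the conjugating element u: it maps eM
  isomorphically onto (u e u^-1)M.\<close>

abbreviation "mhom \<equiv> LinearCombinations.module_hom"

text \<open>Gaussian elimination by induction on the coordinates: a vector with nonzero coordinate
  \<open>j\<close> serves as pivot, and subtracting multiples of it removes that coordinate from the
  others. One vector and one coordinate are lost, so the inequality persists.\<close>

lemma linear_dependency:
  fixes f :: "'s \<Rightarrow> 'j \<Rightarrow> 'k::field"
  assumes "finite J" "finite S" "card J < card S"
  shows "\<exists>c. (\<exists>s\<in>S. c s \<noteq> 0) \<and> (\<forall>j\<in>J. (\<Sum>s\<in>S. c s * f s j) = 0)"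
  using assms
proof (induction J arbitrary: f S rule: finite_induct)
  case empty
  then obtain s where "s \<in> S" by fastforce
  then show ?case by (intro exI[of _ "\<lambda>_. 1"]) auto
next
  case (insert j J)
  show ?case
  proof (cases "\<forall>s\<in>S. f s j = 0")
    case True
    have "card J < card S" using insert by simp
    then obtain c where "(\<exists>s\<in>S. c s \<noteq> 0)" "(\<forall>j\<in>J. (\<Sum>s\<in>S. c s * f s j) = 0)"
      using insert.IH[of S f] insert.prems by blast
    then show ?thesis using True by (intro exI[of _ c]) auto
  next
    case False
    then obtain t where t: "t \<in> S" "f t j \<noteq> 0" by blast
    define S' where "S' = S - {t}"
    have S': "finite S'" "card J < card S'" "t \<notin> S'" "S = insert t S'"
      using insert t by (auto simp: S'_def)
    obtain c where c: "\<exists>s\<in>S'. c s \<noteq> 0"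
      "\<forall>i\<in>J. (\<Sum>s\<in>S'. c s * (f s i - f s j / f t j * f t i)) = 0"
      using insert.IH[of S' "\<lambda>s i. f s i - f s j / f t j * f t i"] S' by blast
    \<comment> \<open>The coefficient of the pivot is forced by coordinate \<open>j\<close>; in
      every other coordinate it accounts exactly for the multiples of the pivot that were
      subtracted.\<close>
    define c' where "c' s = (if s = t then - (\<Sum>s\<in>S'. c s * f s j) / f t j else c s)" for s
    have eq: "(\<Sum>s\<in>S. c' s * f s i) = (\<Sum>s\<in>S'. c s * f s i) + c' t * f t i" for i
    proof -
      have "(\<Sum>s\<in>S'. c' s * f s i) = (\<Sum>s\<in>S'. c s * f s i)"
        using S' by (intro sum.cong) (auto simp: c'_def)
      then show ?thesis using S' by (simp add: add.commute)
    qed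
    have 1: "(\<Sum>s\<in>S. c' s * f s j) = 0" unfolding eq using t by (simp add: c'_def)
    have 2: "(\<Sum>s\<in>S. c' s * f s i) = 0" if "i \<in> J" for i
    proof -
      have "0 = (\<Sum>s\<in>S'. c s * (f s i - f s j / f t j * f t i))" using c that by simp
      also have "\<dots> = (\<Sum>s\<in>S'. c s * f s i) - (\<Sum>s\<in>S'. c s * f s j) / f t j * f t i"
        by (simp add: sum_subtractf sum_distrib_left sum_distrib_right sum_divide_distrib algebra_simps)
      finally show ?thesis unfolding eq by (simp add: c'_def)
    qed
    have "\<exists>s\<in>S. c' s \<noteq> 0" using c(1) S' by (auto simp: c'_def)
    with 1 2 show ?thesis by (intro exI[of _ c']) auto
  qed
qed

section \<open>Linear functionals, finite dimension and projections\<close>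

definition linear_functional :: "('k::field, 'v, 'b) module_scheme \<Rightarrow> ('v \<Rightarrow> 'k) \<Rightarrow> bool" where
  "linear_functional V h \<longleftrightarrow>
     (\<forall>x\<in>carrier V. \<forall>y\<in>carrier V. h (x \<oplus>\<^bsub>V\<^esub> y) = h x + h y) \<and>
     (\<forall>c. \<forall>x\<in>carrier V. h (c \<odot>\<^bsub>V\<^esub> x) = c * h x)"

locale field_space = vectorspace "class_ring :: 'k::field ring" V
  for V :: "('k::field, 'v, 'b) module_scheme" (structure)
begin

lemma functional_zero:
  assumes "linear_functional V h"
  shows "h \<zero> = 0"
proof -
  have "h (\<zero> \<oplus> \<zero>) = h \<zero> + h \<zero>"
    using assms M.zero_closed unfolding linear_functional_def by blast
  then have "h \<zero> = h \<zero> + h \<zero>" using M.r_zero[OF M.zero_closed] by (simp only:)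
  then show ?thesis by (simp only: add_cancel_right_right)
qed

lemma functional_lincomb:
  assumes "linear_functional V h" "finite A" "A \<subseteq> carrier V"
  shows "h (lincomb a A) = (\<Sum>v\<in>A. a v * h v)"
  using assms(2,3)
proof (induction A rule: finite_induct)
  case empty
  then show ?case using functional_zero[OF assms(1)] by (simp add: lincomb_def)
next
  case (insert v A)
  have "lincomb a (insert v A) = (a v \<odot> v) \<oplus> lincomb a A"
    using insert by (intro lincomb_insert2) auto
  moreover have "a v \<odot> v \<in> carrier V" "lincomb a A \<in> carrier V"
    using insert by (auto simp: class_ring_simps)
  ultimately show ?case
    using assms(1) insert by (auto simp: linear_functional_def)
qed

text \<open>The functionals embed V into a space with \<open>card J\<close> coordinates, so a
  relation between value vectors is a relation in V itself. An infinite S is excluded by a finite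
  subset that is already too large.\<close>

lemma li_card_le:
  assumes "finite J" "\<And>j. j \<in> J \<Longrightarrow> linear_functional V (h j)"
    "\<And>v. v \<in> carrier V \<Longrightarrow> \<forall>j\<in>J. h j v = 0 \<Longrightarrow> v = \<zero>"
    "lin_indpt S" "S \<subseteq> carrier V"
  shows "finite S \<and> card S \<le> card J"
proof -
  have fin: "card S' \<le> card J" if fS: "finite S'" "S' \<subseteq> S" for S'
  proof (rule ccontr)
    assume "\<not> ?thesis"
    then have "card J < card S'" by simp
    then obtain c where c: "\<exists>s\<in>S'. c s \<noteq> 0" "\<forall>j\<in>J. (\<Sum>s\<in>S'. c s * h j s) = 0"
      using linear_dependency[OF assms(1) fS(1), of "\<lambda>s j. h j s"] by auto
    have cl: "lincomb c S' \<in> carrier V" using that assms(5) by (auto simp: class_ring_simps)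
    have "lincomb c S' = \<zero>"
      using c(2) functional_lincomb[OF assms(2) that(1)] that assms(5)
      by (intro assms(3)[OF cl]) auto
    then have "lin_dep S"
      using c(1) that lin_dep_crit[of S' S c] by (auto simp: class_ring_simps)
    with assms(4) show False by simp
  qed
  have "finite S"
  proof (rule ccontr)
    assume "infinite S"
    then obtain S' where "S' \<subseteq> S" "finite S'" "card S' = Suc (card J)"
      by (meson infinite_arbitrarily_large)
    with fin[of S'] show False by simp
  qed
  with fin show ?thesis by simp
qed

text \<open>Independent sets have at most \<open>card J\<close> elements, so a maximal one exists,
  and a maximal independent set spans.\<close>

lemma fin_dim_if_separated:
  assumes "finite J" "\<And>j. j \<in> J \<Longrightarrow> linear_functional V (h j)"
    "\<And>v. v \<in> carrier V \<Longrightarrow> \<forall>j\<in>J. h j v = 0 \<Longrightarrow> v = \<zero>"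
  shows fin_dim
proof -
  have "\<exists>A. finite A \<and> maximal A (\<lambda>S. S \<subseteq> carrier V \<and> lin_indpt S)"
    using li_card_le[OF assms] lin_dep_def
    by (intro maximal_exists[of _ "card J" "{}"]) auto
  then obtain A where "finite A" "maximal A (\<lambda>S. S \<subseteq> carrier V \<and> lin_indpt S)" by blast
  then show ?thesis
    using max_li_is_gen unfolding fin_dim_def maximal_def by blast
qed

lemma basis_coordinates:
  assumes "finite A" "basis A"
  shows "\<exists>\<kappa>. (\<forall>b\<in>A. linear_functional V (\<lambda>v. \<kappa> v b)) \<and>
    (\<forall>v\<in>carrier V. lincomb (\<kappa> v) A = v) \<and> (\<forall>a. \<forall>b\<in>A. \<kappa> (lincomb a A) b = a b)"
proof -
  have A: "A \<subseteq> carrier V" using assms by (simp add: basis_def)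
  have car: "carrier (class_ring :: 'k ring) = UNIV" by (simp add: class_ring_simps)
  have ex1: "\<forall>v. v\<in> carrier V \<longrightarrow>(\<exists>! a.  a\<in>A \<rightarrow>\<^sub>E UNIV \<and> lincomb a A = v)"
    using basis_criterion[OF assms(1) A] assms(2) car by simp
  \<comment> \<open>Coefficients are unique only as extensional functions, undefined off
    \<open>A\<close>. Linearity of the coordinates is deduced from this uniqueness.\<close>
  define \<kappa> where "\<kappa> v = (THE a. a\<in>A \<rightarrow>\<^sub>E UNIV \<and> lincomb a A = v)" for v
  have k: "\<kappa> v \<in> A \<rightarrow>\<^sub>E UNIV" "lincomb (\<kappa> v) A = v" if "v \<in> carrier V" for v
    using theI'[of "\<lambda>a. a\<in>A \<rightarrow>\<^sub>E UNIV \<and> lincomb a A = v"] ex1 that by (auto simp: \<kappa>_def)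
  have cl: "lincomb a A \<in> carrier V" for a using A by (auto simp: car)
  have uniq: "\<kappa> (lincomb a A) b = a b" if "b \<in> A" for a b
  proof -
    have "lincomb (restrict a A) A = lincomb a A"
      using A by (intro lincomb_cong) (auto simp: car)
    then have "restrict a A = \<kappa> (lincomb a A)"
      using ex1 cl[of a] k[OF cl[of a]] by (metis restrict_PiE_iff UNIV_I)
    then show ?thesis using that by (metis restrict_apply')
  qed
  have "linear_functional V (\<lambda>v. \<kappa> v b)" if b: "b \<in> A" for b
    unfolding linear_functional_def
  proof (intro conjI ballI allI)
    fix x y assume xy: "x \<in> carrier V" "y \<in> carrier V"
    have "lincomb (\<lambda>v. \<kappa> x v + \<kappa> y v) A = lincomb (\<kappa> x) A \<oplus> lincomb (\<kappa> y) A"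
      using lincomb_sum[OF assms(1) A, of "\<kappa> x" "\<kappa> y"] by (simp add: class_ring_simps)
    also have "\<dots> = x \<oplus> y" using k xy by simp
    finally show "\<kappa> (x \<oplus> y) b = \<kappa> x b + \<kappa> y b" using uniq[OF b] by metis
  next
    fix c x assume x: "x \<in> carrier V"
    have "lincomb (\<lambda>v. c * \<kappa> x v) A = c \<odot> lincomb (\<kappa> x) A"
      using lincomb_smult[OF A, of "\<kappa> x" c] by (simp add: class_ring_simps)
    also have "\<dots> = c \<odot> x" using k x by simp
    finally show "\<kappa> (c \<odot> x) b = c * \<kappa> x b" using uniq[OF b] by metis
  qed
  with k uniq show ?thesis by (intro exI[of _ \<kappa>]) auto
qed

text \<open>The coordinates with respect to a finite basis. The basis vectors themselves serve as
  indices, hence the type of \<open>J\<close>.\<close>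

lemma separating_functionals:
  assumes fin_dim
  shows "\<exists>(J :: 'v set) h. finite J \<and> (\<forall>j\<in>J. linear_functional V (h j)) \<and>
     (\<forall>v\<in>carrier V. (\<forall>j\<in>J. h j v = 0) \<longrightarrow> v = \<zero>)"
proof -
  obtain A where A: "finite A" "basis A" using finite_basis_exists[OF assms] by blast
  then have AV: "A \<subseteq> carrier V" by (simp add: basis_def)
  obtain \<kappa> where k: "\<forall>b\<in>A. linear_functional V (\<lambda>v. \<kappa> v b)"
    "\<forall>v\<in>carrier V. lincomb (\<kappa> v) A = v" using basis_coordinates[OF A] by blast
  have "v = \<zero>" if "v \<in> carrier V" "\<forall>b\<in>A. \<kappa> v b = 0" for v
  proof -
    have "lincomb (\<kappa> v) A = lincomb (\<lambda>_. 0) A"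
      using that AV by (intro lincomb_cong) (auto simp: class_ring_simps)
    also have "\<dots> = \<zero>" using AV by (intro lincomb_zero) (auto simp: class_ring_simps)
    finally show ?thesis using k that by simp
  qed
  with k A show ?thesis by (intro exI[of _ A] exI[of _ "\<lambda>b v. \<kappa> v b"]) auto
qed

lemma subspace_space:
  assumes "N \<subseteq> carrier V" "\<zero> \<in> N" "\<And>x y. x \<in> N \<Longrightarrow> y \<in> N \<Longrightarrow> x \<oplus> y \<in> N"
    "\<And>c x. x \<in> N \<Longrightarrow> c \<odot> x \<in> N"
  shows "subspace class_ring N V" "field_space (V\<lparr>carrier := N\<rparr>)"
proof -
  show "subspace class_ring N V"
    using assms by unfold_locales auto
  then show "field_space (V\<lparr>carrier := N\<rparr>)"
    using subspace_is_vs by (auto simp: field_space_def)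
qed

text \<open>Separating functionals on V, pulled back along \<open>i\<close>, separate the points of
  U and so bound its dimension.\<close>

lemma fin_dim_inj:
  assumes "fin_dim" "field_space U" "i \<in> mhom class_ring U V" "inj_on i (carrier U)"
  shows "vectorspace.fin_dim class_ring U"
proof -
  interpret U: field_space U by fact
  interpret i: linear_map class_ring U V i
    using assms(3) by unfold_locales
  obtain J :: "'v set" and h where h: "finite J" "\<forall>j\<in>J. linear_functional V (h j)"
     "\<forall>v\<in>carrier V. (\<forall>j\<in>J. h j v = 0) \<longrightarrow> v = \<zero>"
    using separating_functionals[OF assms(1)] by blast
  show ?thesis
  proof (rule U.fin_dim_if_separated[OF h(1), of "\<lambda>j u. h j (i u)"])
    show "linear_functional U (\<lambda>u. h j (i u))" if "j \<in> J" for j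
      using h(2) that by (auto simp: linear_functional_def class_ring_simps)
    show "u = \<zero>\<^bsub>U\<^esub>" if "u \<in> carrier U" "\<forall>j\<in>J. h j (i u) = 0" for u
      using h(3) that assms(4) i.f0_is_0 by (metis inj_onD i.f_im U.M.zero_closed)
  qed
qed

text \<open>A basis \<open>B\<close> of N is completed to a basis \<open>A\<close> of V, and the
  projection forgets the coordinates outside \<open>B\<close>. This is the linear map that is
  averaged in Maschke's theorem.\<close>

lemma projection_exists:
  assumes "fin_dim" "subspace class_ring N V"
  shows "\<exists>p\<in>mhom class_ring V V. p ` carrier V \<subseteq> N \<and> (\<forall>x\<in>N. p x = x)"
proof -
  have NV: "N \<subseteq> carrier V" using assms(2) by (simp add: subspace_def submodule_def)
  interpret N: field_space "V\<lparr>carrier := N\<rparr>"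
    using subspace_is_vs[OF assms(2)] by (simp add: field_space_def)
  have "vectorspace.fin_dim class_ring (V\<lparr>carrier := N\<rparr>)"
    using assms NV N.field_space_axioms
    by (intro fin_dim_inj[of "V\<lparr>carrier := N\<rparr>" "\<lambda>x. x"]) (auto simp: LinearCombinations.module_hom_def)
  then obtain B where B: "finite B" "N.basis B" using N.finite_basis_exists by blast
  have sm: "submodule class_ring N V" using assms(2) by simp
  have BN: "B \<subseteq> N" using B by (simp add: N.basis_def)
  have liB: "lin_indpt B" using B span_li_not_depend(2)[OF BN sm] by (simp add: N.basis_def)
  have "\<exists>A. finite A \<and> maximal A (\<lambda>S. S \<subseteq> carrier V \<and> lin_indpt S \<and> B \<subseteq> S)"
    using li_le_dim[OF assms(1)] liB BN NV
    by (intro maximal_exists[of _ dim B]) auto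
  then obtain A where A: "finite A" "maximal A (\<lambda>S. S \<subseteq> carrier V \<and> lin_indpt S \<and> B \<subseteq> S)"
    by blast
  have BA: "B \<subseteq> A" using A by (simp add: maximal_def)
  have "maximal A (\<lambda>S. S \<subseteq> carrier V \<and> lin_indpt S)"
    using A(2) BA unfolding maximal_def by blast
  then have bA: "basis A" by (rule max_li_is_basis)
  then have AV: "A \<subseteq> carrier V" by (simp add: basis_def)
  obtain \<kappa> where k: "\<forall>b\<in>A. linear_functional V (\<lambda>v. \<kappa> v b)"
    "\<forall>v\<in>carrier V. lincomb (\<kappa> v) A = v" "\<forall>a. \<forall>b\<in>A. \<kappa> (lincomb a A) b = a b"
    using basis_coordinates[OF A(1) bA] by blast
  have BV: "B \<subseteq> carrier V" using BN NV by simp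
  define p where "p v = lincomb (\<kappa> v) B" for v
  have "p \<in> mhom class_ring V V"
    unfolding LinearCombinations.module_hom_def
  proof (intro CollectI conjI allI impI)
    show "p \<in> carrier V \<rightarrow> carrier V" using BV by (auto simp: p_def class_ring_simps)
  next
    fix x y assume xy: "x \<in> carrier V \<and> y \<in> carrier V"
    have "p (x \<oplus> y) = lincomb (\<lambda>v. \<kappa> x v \<oplus>\<^bsub>class_ring\<^esub> \<kappa> y v) B"
      unfolding p_def using k(1) BA BV xy
      by (intro lincomb_cong) (auto simp: linear_functional_def class_ring_simps subset_iff)
    also have "\<dots> = p x \<oplus> p y" unfolding p_def
      using B BV by (intro lincomb_sum) (auto simp: class_ring_simps)
    finally show "p (x \<oplus> y) = p x \<oplus> p y" .
  next
    fix c x assume x: "c \<in> carrier (class_ring :: 'k ring) \<and> x \<in> carrier V"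
    have "p (c \<odot> x) = lincomb (\<lambda>v. c \<otimes>\<^bsub>class_ring\<^esub> \<kappa> x v) B"
      unfolding p_def using k(1) BA BV x
      by (intro lincomb_cong) (auto simp: linear_functional_def class_ring_simps subset_iff)
    also have "\<dots> = c \<odot> p x" unfolding p_def
      using B BV by (intro lincomb_smult) (auto simp: class_ring_simps)
    finally show "p (c \<odot> x) = c \<odot> p x" .
  qed
  moreover have "p v \<in> N" if "v \<in> carrier V" for v
    unfolding p_def lincomb_not_depend[OF B(1) BN sm, of "\<kappa> v", unfolded class_ring_simps, simplified]
    using N.lincomb_closed[of B "\<kappa> v"] BN by (auto simp: class_ring_simps)
  moreover have "p x = x" if x: "x \<in> N" for x
  proof -
    have "x \<in> N.span B" using B x by (simp add: N.basis_def)
    then have "x \<in> span B" using span_li_not_depend(1)[OF BN sm] by simp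
    then obtain a where a: "lincomb a B = x"
      using finite_in_span[OF B(1) BV] by blast
    \<comment> \<open>The coordinates of \<open>x\<close> over \<open>A\<close> are those over
      \<open>B\<close>, extended by zero.\<close>
    define a' where "a' v = (if v \<in> B then a v else 0)" for v
    have sp: "A = (A - B) \<union> B" using BA by auto
    have z: "lincomb a' (A - B) = \<zero>"
      using AV by (intro lincomb_zero) (auto simp: a'_def class_ring_simps)
    have "lincomb a' A = lincomb a' (A - B) \<oplus> lincomb a' B"
      by (subst sp, rule lincomb_union) (use A B AV BV in \<open>auto simp: class_ring_simps\<close>)
    also have "lincomb a' B = x"
      unfolding a[symmetric] using BV by (intro lincomb_cong) (auto simp: a'_def class_ring_simps)
    finally have "lincomb a' A = x" using z x NV by auto
    then have "\<forall>b\<in>A. \<kappa> x b = a' b" using k(3) by blast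
    then have "p x = lincomb a B" unfolding p_def
      using BA BV by (intro lincomb_cong) (auto simp: a'_def class_ring_simps)
    with a show ?thesis by simp
  qed
  ultimately show ?thesis by (intro bexI[of _ p]) auto
qed

lemma dim_zeroD:
  assumes fin_dim "dim = 0"
  shows "carrier V = {\<zero>}"
proof -
  obtain B where "finite B" "basis B" using finite_basis_exists[OF assms(1)] by blast
  then show ?thesis using dim_basis[of B] assms(2) span_empty by (auto simp: basis_def)
qed

end

text \<open>Rank-nullity for \<open>p\<close>, whose kernel is the image of \<open>i\<close> and
  therefore a copy of U.\<close>

lemma dim_short_exact:
  assumes "field_space U" "field_space V" "field_space W"
    "i \<in> mhom class_ring U V" "p \<in> mhom class_ring V W"
    "inj_on i (carrier U)" "i ` carrier U = {x \<in> carrier V. p x = \<zero>\<^bsub>W\<^esub>}"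
    "p ` carrier V = carrier W" "vectorspace.fin_dim class_ring V"
  shows "vectorspace.dim class_ring V =
      vectorspace.dim class_ring U + vectorspace.dim class_ring W"
    "vectorspace.fin_dim class_ring U" "vectorspace.fin_dim class_ring W"
proof -
  interpret U: field_space U by fact
  interpret V: field_space V by fact
  interpret W: field_space W by fact
  interpret p: linear_map class_ring V W p using assms(5) by unfold_locales
  have ker: "p.ker = i ` carrier U" using assms(7) by (simp add: p.ker_def)
  have im: "p.im = carrier W" using assms(8) by (simp add: p.im_def)
  interpret K: field_space "V\<lparr>carrier := i ` carrier U\<rparr>"
    using V.subspace_is_vs[OF p.kerT_is_subspace] by (simp add: ker field_space_def)
  interpret i: linear_map class_ring U "V\<lparr>carrier := i ` carrier U\<rparr>" i
    using assms(4) by unfold_locales (auto simp: LinearCombinations.module_hom_def)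
  show U: "U.fin_dim" using V.fin_dim_inj assms by blast
  show "W.fin_dim" using p.surj_fin_dim assms by blast
  have "U.dim = K.dim" using U assms(6) by (intro i.dim_eq) auto
  then show "V.dim = U.dim + W.dim"
    using p.rank_nullity[OF assms(9)] by (simp add: ker im)
qed

section \<open>Quotients of free abelian groups\<close>

text \<open>The additive extension of \<open>f\<close> to the free abelian group. The target is a
  ring, so that integer values on modules and rational values on pairs (a, q) are treated
  alike.\<close>

definition frag_eval :: "('a \<Rightarrow> 'b::comm_ring_1) \<Rightarrow> ('a \<Rightarrow>\<^sub>0 int) \<Rightarrow> 'b" where
  "frag_eval f x = (\<Sum>m\<in>Poly_Mapping.keys x. of_int (Poly_Mapping.lookup x m) * f m)"

lemma frag_eval_superset:
  "finite A \<Longrightarrow> Poly_Mapping.keys x \<subseteq> A \<Longrightarrow>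
    frag_eval f x = (\<Sum>m\<in>A. of_int (Poly_Mapping.lookup x m) * f m)"
  unfolding frag_eval_def by (intro sum.mono_neutral_left) (auto simp: in_keys_iff)

lemma frag_eval_add: "frag_eval f (x + y) = frag_eval f x + frag_eval f y"
proof -
  let ?A = "Poly_Mapping.keys x \<union> Poly_Mapping.keys y"
  show ?thesis
    using keys_add[of x y]
    by (simp add: frag_eval_superset[of ?A] lookup_add algebra_simps sum.distrib)
qed

lemma frag_eval_0 [simp]: "frag_eval f 0 = 0"
  by (simp add: frag_eval_def)

lemma frag_eval_of [simp]: "frag_eval f (frag_of m) = f m"
  by (simp add: frag_eval_def keys_frag_of)

lemma frag_eval_minus: "frag_eval f (- x) = - frag_eval f x"
  using frag_eval_add[of f x "- x"] by (simp add: eq_neg_iff_add_eq_0 add.commute)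

lemma frag_eval_diff: "frag_eval f (x - y) = frag_eval f x - frag_eval f y"
  using frag_eval_add[of f x "- y"] by (simp add: frag_eval_minus)

text \<open>Cosets without mention of the ambient group: passing from \<Gamma> to a subgroup
  enlarges the free abelian group and the relations but keeps the representatives.\<close>

definition frag_coset :: "('a \<Rightarrow>\<^sub>0 int) set \<Rightarrow> ('a \<Rightarrow>\<^sub>0 int) \<Rightarrow> ('a \<Rightarrow>\<^sub>0 int) set" where
  "frag_coset N x = (\<lambda>n. n + x) ` N"

text \<open>Meaningful only if \<open>F\<close> is constant on \<open>X\<close>.\<close>

definition coset_eval :: "(('a \<Rightarrow>\<^sub>0 int) \<Rightarrow> 'b) \<Rightarrow> ('a \<Rightarrow>\<^sub>0 int) set \<Rightarrow> 'b" where
  "coset_eval F X = F (SOME x. x \<in> X)"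

text \<open>Grothendieck groups and tensor products with the rationals are both free abelian groups
  modulo relators, and both are instances of this setting.\<close>

locale frag_quotient =
  fixes S :: "'a set" and Rel :: "('a \<Rightarrow>\<^sub>0 int) set"
  assumes Rel_carrier: "Rel \<subseteq> carrier (free_Abelian_group S)"
begin

abbreviation "N \<equiv> generate (free_Abelian_group S) Rel"
abbreviation "Q \<equiv> free_Abelian_group S Mod N"

sublocale Fr: comm_group "free_Abelian_group S"
  by (rule abelian_free_Abelian_group)

lemma N_subgroup: "subgroup N (free_Abelian_group S)"
  using Rel_carrier by (rule Fr.generate_is_subgroup)

lemma N_keys: "x \<in> N \<Longrightarrow> Poly_Mapping.keys x \<subseteq> S"
  using subsetD[OF subgroup.subset[OF N_subgroup]] by simp

lemma N_zero: "0 \<in> N"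
  using subgroup.one_closed[OF N_subgroup] by simp

lemma N_add: "x \<in> N \<Longrightarrow> y \<in> N \<Longrightarrow> x + y \<in> N"
  using subgroup.m_closed[OF N_subgroup, of x y] by simp

lemma N_minus: "x \<in> N \<Longrightarrow> - x \<in> N"
  using subgroup.m_inv_closed[OF N_subgroup, of x] N_keys by simp

lemma N_diff: "x \<in> N \<Longrightarrow> y \<in> N \<Longrightarrow> x - y \<in> N"
  using N_add[of x "- y"] N_minus by simp

lemma N_Rel: "x \<in> Rel \<Longrightarrow> x \<in> N"
  by (rule generate.incl)

lemma N_induct [consumes 1, case_names zero Rel minus add]:
  assumes "x \<in> N" "P 0" "\<And>r. r \<in> Rel \<Longrightarrow> P r" "\<And>x. P x \<Longrightarrow> P (- x)"
    "\<And>x y. P x \<Longrightarrow> P y \<Longrightarrow> P (x + y)"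
  shows "P x"
  using assms(1)
proof (induction rule: generate.induct)
  case (inv h)
  then have "inv\<^bsub>free_Abelian_group S\<^esub> h = - h" using Rel_carrier by auto
  with inv assms show ?case by auto
qed (use assms in auto)

lemma frag_eval_N:
  assumes "x \<in> N" "\<And>r. r \<in> Rel \<Longrightarrow> frag_eval f r = 0"
  shows "frag_eval f x = 0"
  using assms(1) by (induction rule: N_induct) (auto simp: assms frag_eval_minus frag_eval_add)

lemma coset_eq_iff: "frag_coset N x = frag_coset N y \<longleftrightarrow> x - y \<in> N"
proof
  assume "frag_coset N x = frag_coset N y"
  moreover have "x \<in> frag_coset N x" using N_zero by (force simp: frag_coset_def)
  ultimately obtain n where "n \<in> N" "x = n + y" by (auto simp: frag_coset_def)
  then show "x - y \<in> N" by simp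
next
  assume xy: "x - y \<in> N"
  have "n + x \<in> frag_coset N y" if "n \<in> N" for n
    unfolding frag_coset_def using N_add[OF that xy] by (intro image_eqI[of _ _ "n + (x - y)"]) auto
  moreover have "n + y \<in> frag_coset N x" if "n \<in> N" for n
    unfolding frag_coset_def using N_diff[OF that xy] by (intro image_eqI[of _ _ "n - (x - y)"]) auto
  ultimately show "frag_coset N x = frag_coset N y" by (auto simp: frag_coset_def)
qed

lemma r_coset_eq: "N #>\<^bsub>free_Abelian_group S\<^esub> x = frag_coset N x"
  by (auto simp: r_coset_def frag_coset_def)

lemma carrier_Q: "carrier Q = frag_coset N ` {x. Poly_Mapping.keys x \<subseteq> S}"
  by (auto simp: carrier_FactGroup r_coset_eq)

lemma mult_Q:
  assumes "Poly_Mapping.keys x \<subseteq> S" "Poly_Mapping.keys y \<subseteq> S"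
  shows "frag_coset N x \<otimes>\<^bsub>Q\<^esub> frag_coset N y = frag_coset N (x + y)"
proof -
  interpret normal N "free_Abelian_group S"
    using Fr.subgroup_imp_normal[OF N_subgroup] .
  show ?thesis using rcos_sum[of x y] assms by (simp add: r_coset_eq)
qed

lemma Q_comm_group: "comm_group Q"
  by (rule Fr.abelian_FactGroup[OF N_subgroup])

lemma coset_eval_eq:
  assumes "\<And>r. r \<in> Rel \<Longrightarrow> frag_eval f r = 0"
  shows "coset_eval (frag_eval f) (frag_coset N x) = frag_eval f x"
proof -
  have "x \<in> frag_coset N x" using N_zero by (force simp: frag_coset_def)
  then have "(SOME y. y \<in> frag_coset N x) \<in> frag_coset N x" by (rule someI)
  then obtain n where "n \<in> N" "(SOME y. y \<in> frag_coset N x) = n + x"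
    by (auto simp: frag_coset_def)
  then show ?thesis using frag_eval_N[of n f] assms by (simp add: coset_eval_def frag_eval_add)
qed

text \<open>\<open>groth_map\<close> and the scalar multiplication of \<open>tensor_rat\<close> are
  defined by saturating the image of a coset. For an additive \<open>T\<close> that respects the
  relations this is the coset of \<open>T x\<close>, so both can be computed on
  representatives.\<close>

lemma set_mult_coset_image:
  assumes "T ` M \<subseteq> N" "0 \<in> M" "T 0 = 0" "\<And>x y. T (x + y) = T x + T y"
  shows "N <#>\<^bsub>free_Abelian_group S\<^esub> (T ` frag_coset M x) = frag_coset N (T x)"
proof -
  have "N <#>\<^bsub>free_Abelian_group S\<^esub> (T ` frag_coset M x) = (\<Union>n\<in>N. \<Union>m\<in>M. {n + T (m + x)})"
    by (simp add: set_mult_def frag_coset_def)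
  also have "\<dots> = frag_coset N (T x)"
  proof (intro equalityI subsetI)
    fix y assume "y \<in> (\<Union>n\<in>N. \<Union>m\<in>M. {n + T (m + x)})"
    then obtain n m where nm: "n \<in> N" "m \<in> M" "y = (n + T m) + T x" using assms(4) by (auto simp: add.assoc)
    then have "n + T m \<in> N" using assms(1) by (intro N_add) auto
    then show "y \<in> frag_coset N (T x)" using nm by (auto simp: frag_coset_def)
  next
    fix y assume "y \<in> frag_coset N (T x)"
    then obtain n where "n \<in> N" "y = n + T (0 + x)" by (auto simp: frag_coset_def)
    then show "y \<in> (\<Union>n\<in>N. \<Union>m\<in>M. {n + T (m + x)})" using assms(2) by blast
  qed
  finally show ?thesis .
qed

end

section \<open>Tensoring with the rationals\<close>

text \<open>The generating set inside \<open>tensor_subgroup\<close>, named so that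
  \<open>frag_quotient\<close> can be instantiated with it.\<close>

definition tensor_relators :: "('a, 'b) monoid_scheme \<Rightarrow> ('a \<times> rat \<Rightarrow>\<^sub>0 int) set" where
  "tensor_relators A =
     {frag_of (a \<otimes>\<^bsub>A\<^esub> b, q) - (frag_of (a, q) + frag_of (b, q)) | a b q.
         a \<in> carrier A \<and> b \<in> carrier A} \<union>
      {frag_of (a, q + r) - (frag_of (a, q) + frag_of (a, r)) | a q r. a \<in> carrier A}"

definition int_hom :: "('a, 'b) monoid_scheme \<Rightarrow> ('a \<Rightarrow> int) \<Rightarrow> bool" where
  "int_hom A h \<longleftrightarrow> (\<forall>x\<in>carrier A. \<forall>y\<in>carrier A. h (x \<otimes>\<^bsub>A\<^esub> y) = h x + h y)"

lemma keys_relator: "a \<in> S \<Longrightarrow> b \<in> S \<Longrightarrow> c \<in> S \<Longrightarrow>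
  Poly_Mapping.keys (frag_of a - (frag_of b + frag_of c)) \<subseteq> S"
  using keys_diff[of "frag_of a" "frag_of b + frag_of c"] keys_add[of "frag_of b" "frag_of c"]
  by (auto simp: keys_frag_of)

locale rational_tensor = comm_group A for A :: "('a, 'b) monoid_scheme" (structure)
begin

sublocale frag_quotient "carrier A \<times> UNIV" "tensor_relators A"
proof
  show "tensor_relators A \<subseteq> carrier (free_Abelian_group (carrier A \<times> UNIV))"
    unfolding tensor_relators_def
    using keys_relator[of _ "carrier A \<times> (UNIV :: rat set)"]
    by (auto simp del: One_nat_def)
qed

lemma N_eq: "tensor_subgroup A = N"
  by (simp add: tensor_subgroup_def tensor_relators_def)

definition "scale s = frag_extend (\<lambda>(a, q). frag_of (a :: 'a, s * q :: rat))"

lemma scale_simps: "scale s (frag_of (a, q)) = frag_of (a, s * q)"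
  "scale s (x + y) = scale s x + scale s y" "scale s 0 = 0" "scale s (- x) = - scale s x"
  "scale s (x - y) = scale s x - scale s y"
  by (simp_all add: scale_def frag_extend_add frag_extend_minus frag_extend_diff)

lemma scale_keys:
  assumes "Poly_Mapping.keys x \<subseteq> carrier A \<times> UNIV"
  shows "Poly_Mapping.keys (scale s x) \<subseteq> carrier A \<times> UNIV"
  using keys_frag_extend[of "\<lambda>(a, q). frag_of (a :: 'a, s * q :: rat)" x] assms
  by (fastforce simp: scale_def keys_frag_of)

lemma scale_N: "x \<in> N \<Longrightarrow> scale s x \<in> N"
proof (induction rule: N_induct)
  case (Rel r)
  then have "scale s r \<in> tensor_relators A"
    unfolding tensor_relators_def by (auto simp: scale_simps distrib_left) blast+
  then show ?case by (rule N_Rel)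
qed (auto simp: scale_simps N_zero N_add N_minus)

abbreviation "V \<equiv> tensor_rat A"

lemma V_simps: "carrier V = frag_coset N ` {x. Poly_Mapping.keys x \<subseteq> carrier A \<times> UNIV}"
  "\<zero>\<^bsub>V\<^esub> = frag_coset N 0"
  by (simp_all add: tensor_rat_def Let_def N_eq carrier_Q frag_coset_def)

lemma V_add:
  assumes "Poly_Mapping.keys x \<subseteq> carrier A \<times> UNIV" "Poly_Mapping.keys y \<subseteq> carrier A \<times> UNIV"
  shows "frag_coset N x \<oplus>\<^bsub>V\<^esub> frag_coset N y = frag_coset N (x + y)"
  using mult_Q[OF assms] by (simp add: tensor_rat_def Let_def N_eq)

lemma V_smult: "s \<odot>\<^bsub>V\<^esub> frag_coset N x = frag_coset N (scale s x)"
  using set_mult_coset_image[of "scale s" N x] scale_N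
  by (auto simp: tensor_rat_def Let_def N_eq N_zero scale_simps scale_def[symmetric])

lemma scale_scale: "scale s (scale t x) = scale (s * t) x"
proof -
  have "Poly_Mapping.keys x \<subseteq> UNIV" by simp
  then show ?thesis
    by (induction x rule: frag_induction) (auto simp: scale_simps mult.assoc)
qed

lemma scale_one: "scale 1 x = x"
proof -
  have "Poly_Mapping.keys x \<subseteq> UNIV" by simp
  then show ?thesis by (induction x rule: frag_induction) (auto simp: scale_simps)
qed

text \<open>The one scalar law that holds only modulo the relators, namely by additivity in the
  rational factor; the others hold already on representatives.\<close>

lemma scale_add_left:
  assumes "Poly_Mapping.keys x \<subseteq> carrier A \<times> UNIV"
  shows "scale (s + t) x - (scale s x + scale t x) \<in> N"
  using assms
proof (induction x rule: frag_induction)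
  case (one x)
  then obtain a q where x: "x = (a, q)" "a \<in> carrier A" by auto
  then have "frag_of (a, s * q + t * q) - (frag_of (a, s * q) + frag_of (a, t * q)) \<in> tensor_relators A"
    unfolding tensor_relators_def by blast
  from N_Rel[OF this] show ?case by (simp add: x scale_simps distrib_right)
next
  case (diff a b)
  from N_diff[OF this] show ?case by (simp add: scale_simps algebra_simps)
qed (simp add: scale_simps N_zero)

lemma V_space: "field_space V"
proof -
  have k: "Poly_Mapping.keys (x + y) \<subseteq> carrier A \<times> UNIV"
    if "Poly_Mapping.keys x \<subseteq> carrier A \<times> UNIV" "Poly_Mapping.keys y \<subseteq> carrier A \<times> UNIV"
    for x y :: "'a \<times> rat \<Rightarrow>\<^sub>0 int"
    using keys_add[of x y] that by blast
  show ?thesis unfolding field_space_def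
  proof (rule vs_criteria)
    show "\<forall>v w. v \<in> carrier V \<and> w \<in> carrier V \<longrightarrow> v \<oplus>\<^bsub>V\<^esub> w \<in> carrier V"
      using k by (auto simp: V_simps V_add)
    show "\<forall>c v. c \<in> carrier class_ring \<and> v \<in> carrier V \<longrightarrow> c \<odot>\<^bsub>V\<^esub> v \<in> carrier V"
      using scale_keys by (auto simp: V_simps V_smult)
    show "field (class_ring :: rat ring)" by (rule class_field)
    show "\<forall>v\<in>carrier V. \<exists>neg_v\<in>carrier V. v \<oplus>\<^bsub>V\<^esub> neg_v = \<zero>\<^bsub>V\<^esub>"
    proof
      fix v assume "v \<in> carrier V"
      then obtain x where "v = frag_coset N x" "Poly_Mapping.keys x \<subseteq> carrier A \<times> UNIV"
        by (auto simp: V_simps)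
      then show "\<exists>neg_v\<in>carrier V. v \<oplus>\<^bsub>V\<^esub> neg_v = \<zero>\<^bsub>V\<^esub>"
        by (intro bexI[of _ "frag_coset N (- x)"]) (auto simp: V_simps V_add)
    qed
    show "\<forall>a b v. a \<in> carrier class_ring \<and> b \<in> carrier class_ring \<and> v \<in> carrier V \<longrightarrow>
       (a \<oplus>\<^bsub>class_ring\<^esub> b) \<odot>\<^bsub>V\<^esub> v = a \<odot>\<^bsub>V\<^esub> v \<oplus>\<^bsub>V\<^esub> b \<odot>\<^bsub>V\<^esub> v"
    proof (intro allI impI)
      fix a b :: rat and v assume "a \<in> carrier class_ring \<and> b \<in> carrier class_ring \<and> v \<in> carrier V"
      then obtain x where "v = frag_coset N x" "Poly_Mapping.keys x \<subseteq> carrier A \<times> UNIV"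
        by (auto simp: V_simps)
      then show "(a \<oplus>\<^bsub>class_ring\<^esub> b) \<odot>\<^bsub>V\<^esub> v = a \<odot>\<^bsub>V\<^esub> v \<oplus>\<^bsub>V\<^esub> b \<odot>\<^bsub>V\<^esub> v"
        using scale_add_left[of x a b]
        by (simp add: V_simps V_add V_smult scale_keys coset_eq_iff class_ring_simps)
    qed
  qed (auto simp: V_simps V_add V_smult scale_keys scale_simps scale_scale scale_one k
        class_ring_simps ac_simps)
qed

text \<open>A function on the integers that is additive modulo N is determined modulo N by its value
  at 1, going up and down from 0.\<close>

lemma multiple_coset:
  assumes "\<And>i j :: int. F (i + j) - (F i + F j) \<in> N"
  shows "F m - frag_cmul m (F 1) \<in> N"
proof (induction m rule: int_induct[of _ 0])
  case base
  from N_minus[OF assms[of 0 0]] show ?case by simp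
next
  case (step1 i)
  from N_add[OF assms[of i 1] step1(2)] show ?case
    by (simp add: frag_cmul_distrib algebra_simps)
next
  case (step2 i)
  from N_diff[OF step2(2) assms[of "i - 1" 1]] show ?case
    by (simp add: frag_cmul_diff_distrib algebra_simps)
qed

text \<open>Both generators are congruent to m times the generator (a, p): the first by additivity
  in the rational factor, the second by additivity in the group factor. Integers can thus be moved
  from one factor to the other.\<close>

lemma pow_fraction:
  assumes "a \<in> carrier A"
  shows "frag_of (a, of_int m * p) - frag_of (a [^] m, p) \<in> N"
proof -
  have "frag_of (a, of_int m * p) - frag_cmul m (frag_of (a, of_int 1 * p)) \<in> N"
  proof (rule multiple_coset)
    fix i j :: int
    have "frag_of (a, of_int i * p + of_int j * p) - (frag_of (a, of_int i * p) + frag_of (a, of_int j * p))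
      \<in> tensor_relators A"
      unfolding tensor_relators_def using assms by blast
    then show "frag_of (a, of_int (i + j) * p) - (frag_of (a, of_int i * p) + frag_of (a, of_int j * p)) \<in> N"
      using N_Rel by (simp add: distrib_right)
  qed
  moreover have "frag_of (a [^] m, p) - frag_cmul m (frag_of (a [^] (1::int), p)) \<in> N"
  proof (rule multiple_coset)
    fix i j :: int
    have "frag_of (a [^] i \<otimes> a [^] j, p) - (frag_of (a [^] i, p) + frag_of (a [^] j, p))
      \<in> tensor_relators A"
      unfolding tensor_relators_def using assms by blast
    then show "frag_of (a [^] (i + j), p) - (frag_of (a [^] i, p) + frag_of (a [^] j, p)) \<in> N"
      using N_Rel assms by (simp add: int_pow_mult)
  qed
  ultimately show ?thesis using assms N_diff by (fastforce simp: int_pow_1)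
qed

text \<open>Finitely many fractions have a common denominator and their integer numerators move into
  the group factor, so every element of the tensor product is a single a \<otimes> q. Separation of
  points then has to be checked on such elements only.\<close>

lemma pure_tensor:
  assumes "Poly_Mapping.keys x \<subseteq> carrier A \<times> UNIV"
  shows "\<exists>a\<in>carrier A. \<exists>q. x - frag_of (a, q) \<in> N"
  using assms
proof (induction x rule: frag_induction)
  case zero
  \<comment> \<open>Zero is represented by the pair (\<one>, 0): this relator is the negative of
    that generator.\<close>
  have "frag_of (\<one> \<otimes> \<one>, 0) - (frag_of (\<one>, 0) + frag_of (\<one>, 0)) \<in> tensor_relators A"
    unfolding tensor_relators_def by blast
  from N_Rel[OF this] show ?case by auto
next
  case (one x)
  then show ?case using N_zero by (metis SigmaE diff_self)
next
  case (diff x y)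
  then obtain a q b r where
    *: "a \<in> carrier A" "x - frag_of (a, q) \<in> N" "b \<in> carrier A" "y - frag_of (b, r) \<in> N"
    by blast
  obtain m n where q: "q = of_int m / of_int n" "n > 0"
    by (metis Fract_of_int_quotient Rat_cases_nonzero Rat_cases)
  obtain k l where r: "r = of_int k / of_int l" "l > 0"
    by (metis Fract_of_int_quotient Rat_cases_nonzero Rat_cases)
  \<comment> \<open>The common denominator: \<open>q\<close> and \<open>r\<close> are integer
    multiples of \<open>p\<close>.\<close>
  define p :: rat where "p = 1 / (of_int n * of_int l)"
  have qr: "q = of_int (m * l) * p" "r = of_int (k * n) * p"
    using q r by (simp_all add: p_def field_simps)
  define c where "c = a [^] (m * l)" define d where "d = b [^] (k * n)"
  have cd: "c \<in> carrier A" "d \<in> carrier A" using * by (auto simp: c_def d_def)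
  have x: "x - frag_of (c, p) \<in> N"
    using N_add[OF *(2) pow_fraction[OF *(1), of "m * l" p]] by (simp add: qr c_def)
  have y: "y - frag_of (d, p) \<in> N"
    using N_add[OF *(4) pow_fraction[OF *(3), of "k * n" p]] by (simp add: qr d_def)
  \<comment> \<open>The quotient of \<open>c\<close> by \<open>d\<close>, since the difference of
    (c, p) and (d, p) is to become one generator with second entry \<open>p\<close>.\<close>
  define e where "e = c \<otimes> inv d"
  have e: "e \<in> carrier A" "e \<otimes> d = c" using cd by (auto simp: e_def m_assoc)
  have "frag_of (e \<otimes> d, p) - (frag_of (e, p) + frag_of (d, p)) \<in> tensor_relators A"
    unfolding tensor_relators_def using e cd by blast
  then have "frag_of (c, p) - (frag_of (e, p) + frag_of (d, p)) \<in> N"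
    using N_Rel e by simp
  from N_add[OF N_diff[OF x y] this] have "x - y - frag_of (e, p) \<in> N"
    by (simp add: algebra_simps)
  with e show ?case by blast
qed

text \<open>The rational extension of \<open>h\<close>, sending a \<otimes> q to q h(a).\<close>

definition "functional h = coset_eval (frag_eval (\<lambda>(a, q). q * rat_of_int (h a)))"

lemma functional_coset:
  assumes "int_hom A h"
  shows "functional h (frag_coset N x) = frag_eval (\<lambda>(a, q). q * rat_of_int (h a)) x"
  unfolding functional_def
proof (rule coset_eval_eq)
  fix r assume "r \<in> tensor_relators A"
  then consider a b q where "r = frag_of (a \<otimes> b, q) - (frag_of (a, q) + frag_of (b, q))"
      "a \<in> carrier A" "b \<in> carrier A"
    | a q s where "r = frag_of (a, q + s) - (frag_of (a, q) + frag_of (a, s))" "a \<in> carrier A"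
    unfolding tensor_relators_def by blast
  then show "frag_eval (\<lambda>(a, q). q * rat_of_int (h a)) r = 0"
  proof cases
    case (1 a b q)
    then show ?thesis using assms unfolding 1(1) int_hom_def
      by (simp add: frag_eval_diff frag_eval_add algebra_simps)
  next
    case (2 a q s)
    show ?thesis unfolding 2(1) by (simp add: frag_eval_diff frag_eval_add algebra_simps)
  qed
qed

lemma functional_linear:
  assumes "int_hom A h"
  shows "linear_functional V (functional h)"
proof -
  have "frag_eval (\<lambda>(a, q). q * rat_of_int (h a)) (scale s x) =
    s * frag_eval (\<lambda>(a, q). q * rat_of_int (h a)) x" for s x
  proof -
    have "Poly_Mapping.keys x \<subseteq> UNIV" by simp
    then show ?thesis
      by (induction x rule: frag_induction) (auto simp: scale_simps frag_eval_diff algebra_simps)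
  qed
  then show ?thesis unfolding linear_functional_def
    by (auto simp: V_simps V_add V_smult functional_coset[OF assms] frag_eval_add)
qed

text \<open>On a pure tensor a \<otimes> q the values are the products of \<open>q\<close> with
  \<open>\<phi> i a\<close>. If all vanish, then q = 0 or every \<open>\<phi> i\<close> kills a, and
  in both cases the tensor is zero.\<close>

lemma functional_separates:
  assumes "\<And>i. i \<in> I \<Longrightarrow> int_hom A (\<phi> i)"
    and "\<And>x. x \<in> carrier A \<Longrightarrow> \<forall>i\<in>I. \<phi> i x = 0 \<Longrightarrow> x = \<one>"
    and "v \<in> carrier V" "\<forall>i\<in>I. functional (\<phi> i) v = 0"
  shows "v = \<zero>\<^bsub>V\<^esub>"
proof -
  obtain x where x: "v = frag_coset N x" "Poly_Mapping.keys x \<subseteq> carrier A \<times> UNIV"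
    using assms(3) by (auto simp: V_simps)
  obtain a q where a: "a \<in> carrier A" "x - frag_of (a, q) \<in> N" using pure_tensor[OF x(2)] by blast
  then have v: "v = frag_coset N (frag_of (a, q))" using x coset_eq_iff by simp
  then have 0: "q = 0 \<or> \<phi> i a = 0" if "i \<in> I" for i
    using assms(4) functional_coset[OF assms(1)[OF that]] that by fastforce
  have "frag_of (a, q) \<in> N"
  proof (cases "q = 0")
    case True
    have "frag_of (a, 0 + 0) - (frag_of (a, 0) + frag_of (a, 0)) \<in> tensor_relators A"
      unfolding tensor_relators_def using a by blast
    from N_minus[OF N_Rel[OF this]] show ?thesis by (simp add: True)
  next
    case False
    then have "a = \<one>" using 0 assms(2) a by blast
    moreover have "frag_of (\<one> \<otimes> \<one>, q) - (frag_of (\<one>, q) + frag_of (\<one>, q)) \<in> tensor_relators A"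
      unfolding tensor_relators_def by blast
    ultimately show ?thesis using N_minus[OF N_Rel] by fastforce
  qed
  then show ?thesis unfolding v V_simps coset_eq_iff by simp
qed

end

text \<open>Zorn's lemma, because K_0 tensored with the rationals may be infinite dimensional and
  \<open>rat_dim\<close> chooses a basis there too.\<close>

lemma (in vectorspace) basis_exists: "\<exists>B. basis B"
proof -
  let ?P = "\<lambda>S. S \<subseteq> carrier V \<and> lin_indpt S"
  have "\<exists>M\<in>Collect ?P. \<forall>X\<in>Collect ?P. M \<subseteq> X \<longrightarrow> X = M"
  proof (rule subset_Zorn_nonempty)
    show "Collect ?P \<noteq> {}" by (auto simp: lin_dep_def intro!: exI[of _ "{}"])
    fix C assume C: "C \<noteq> {}" "subset.chain (Collect ?P) C"
    have "lin_indpt (\<Union>C)"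
    proof
      assume "lin_dep (\<Union>C)"
      then obtain A a v where A: "finite A" "A \<subseteq> \<Union>C" "a \<in> A \<rightarrow> carrier K" "lincomb a A = \<zero>\<^bsub>V\<^esub>"
        "v \<in> A" "a v \<noteq> \<zero>\<^bsub>K\<^esub>" unfolding lin_dep_def by blast
      obtain S where "S \<in> C" "A \<subseteq> S"
        using finite_subset_Union_chain[OF A(1,2) C] by blast
      then have "lin_dep S" using A unfolding lin_dep_def by blast
      with \<open>S \<in> C\<close> C show False by (auto simp: subset.chain_def)
    qed
    with C show "\<Union>C \<in> Collect ?P" by (auto simp: subset.chain_def)
  qed
  then obtain M where M: "M \<in> Collect ?P" "\<forall>X\<in>Collect ?P. M \<subseteq> X \<longrightarrow> X = M" by (rule bexE)
  then have "maximal M ?P" unfolding maximal_def by simp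
  then show ?thesis using max_li_is_basis by blast
qed

text \<open>The homomorphism \<open>\<psi>\<close> is chosen for each \<open>x\<close> separately, so \<open>A\<close> and \<open>B\<close> need not be
  paired by a map that is additive in \<open>x\<close>.\<close>

lemma rat_dim_tensor_le:
  fixes A :: "('a, 'c) monoid_scheme" and B :: "('b, 'd) monoid_scheme"
  assumes "comm_group A" "comm_group B" "finite I"
    and b: "\<And>i. i \<in> I \<Longrightarrow> b i \<in> carrier B"
    and \<phi>: "\<And>i. i \<in> I \<Longrightarrow> int_hom A (\<phi> i)"
    and sep: "\<And>x. x \<in> carrier A \<Longrightarrow> \<forall>i\<in>I. \<phi> i x = 0 \<Longrightarrow> x = \<one>\<^bsub>A\<^esub>"
    and pair: "\<And>x. x \<in> carrier A \<Longrightarrow> \<exists>\<psi>. int_hom B \<psi> \<and> (\<forall>i\<in>I. \<psi> (b i) = \<phi> i x)"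
  shows "rat_dim (tensor_rat A) \<le>o rat_dim (tensor_rat B)"
proof -
  interpret A: rational_tensor A using assms(1) by (simp add: rational_tensor_def)
  interpret B: rational_tensor B using assms(2) by (simp add: rational_tensor_def)
  interpret VA: field_space "tensor_rat A" by (rule A.V_space)
  interpret VB: field_space "tensor_rat B" by (rule B.V_space)
  define X where "X = (SOME X. VA.basis X)"
  define Y where "Y = (SOME Y. VB.basis Y)"
  have X: "VA.basis X" unfolding X_def by (rule someI_ex[OF VA.basis_exists])
  have Y: "VB.basis Y" unfolding Y_def by (rule someI_ex[OF VB.basis_exists])
  have XV: "X \<subseteq> carrier A.V" and liX: "VA.lin_indpt X" using X by (auto simp: VA.basis_def)
  have YV: "Y \<subseteq> carrier B.V" and genY: "VB.gen_set Y" using Y by (auto simp: VB.basis_def)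
  \<comment> \<open>Finitely many functionals separate the points of the left-hand space, so its
    dimension is finite whatever the other one is.\<close>
  have "finite X \<and> card X \<le> card I"
  proof (rule VA.li_card_le[OF assms(3) _ _ liX XV, of "\<lambda>i. A.functional (\<phi> i)"])
    show "linear_functional A.V (A.functional (\<phi> i))" if "i \<in> I" for i
      using A.functional_linear \<phi> that by blast
    show "v = \<zero>\<^bsub>A.V\<^esub>" if "v \<in> carrier A.V" "\<forall>i\<in>I. A.functional (\<phi> i) v = 0" for v
      using A.functional_separates[of I \<phi> v] \<phi> sep that by blast
  qed
  then have finX: "finite X" by simp
  \<comment> \<open>Only a finite \<open>Y\<close> smaller than \<open>X\<close> could prevent an
    injection; that case is led to a contradiction with the independence of
    \<open>X\<close>.\<close>
  have "\<exists>f. inj_on f X \<and> f ` X \<subseteq> Y"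
  proof (cases "finite Y \<and> card Y < card X")
    case False
    then obtain Z where "Z \<subseteq> Y" "card Z = card X" "finite Z"
      by (metis infinite_arbitrarily_large not_le obtain_subset_with_card_n finite_subset)
    then show ?thesis using finX finite_same_card_bij[of X Z]
      by (metis bij_betw_def subset_trans order_refl)
  next
    case True
    \<comment> \<open>Each basis vector is a pure tensor, so a homomorphism on B can be attached to
      its group component by \<open>pair\<close>.\<close>
    have "\<exists>a q. a \<in> carrier A \<and> s = frag_coset A.N (frag_of (a, q))" if s: "s \<in> X" for s
    proof -
      obtain x where x: "s = frag_coset A.N x" "Poly_Mapping.keys x \<subseteq> carrier A \<times> UNIV"
        using subsetD[OF XV s] by (auto simp: A.V_simps)
      show ?thesis using A.pure_tensor[OF x(2)] A.coset_eq_iff x(1) by metis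
    qed
    then obtain a q where aq: "\<And>s. s \<in> X \<Longrightarrow> a s \<in> carrier A"
      "\<And>s. s \<in> X \<Longrightarrow> s = frag_coset A.N (frag_of (a s, q s))" by metis
    have "\<exists>\<psi>. int_hom B \<psi> \<and> (\<forall>i\<in>I. \<psi> (b i) = \<phi> i (a s))" if "s \<in> X" for s
      using pair aq(1)[OF that] by blast
    then obtain \<psi> where \<psi>: "\<And>s. s \<in> X \<Longrightarrow> int_hom B (\<psi> s)"
      "\<And>s i. s \<in> X \<Longrightarrow> i \<in> I \<Longrightarrow> \<psi> s (b i) = \<phi> i (a s)" by metis
    \<comment> \<open>There are more functionals \<open>q s * B.functional (\<psi> s)\<close> than
      vectors in \<open>Y\<close>, so a nontrivial combination of them vanishes on the spanning set
      \<open>Y\<close> and hence everywhere.\<close>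
    obtain c where c: "\<exists>s\<in>X. c s \<noteq> 0"
      "\<And>y. y \<in> Y \<Longrightarrow> (\<Sum>s\<in>X. c s * (q s * B.functional (\<psi> s) y)) = 0"
      using linear_dependency[of Y X "\<lambda>s y. q s * B.functional (\<psi> s) y"] True finX by blast
    define g where "g w = (\<Sum>s\<in>X. c s * (q s * B.functional (\<psi> s) w))" for w
    have fl: "linear_functional B.V (B.functional (\<psi> s))" if "s \<in> X" for s
      using B.functional_linear[OF \<psi>(1)[OF that]] .
    have g: "linear_functional B.V g"
      unfolding linear_functional_def
    proof (intro conjI ballI allI)
      fix x y assume xy: "x \<in> carrier B.V" "y \<in> carrier B.V"
      have "g (x \<oplus>\<^bsub>B.V\<^esub> y) = (\<Sum>s\<in>X. c s * (q s * B.functional (\<psi> s) x) + c s * (q s * B.functional (\<psi> s) y))"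
        unfolding g_def
      proof (rule sum.cong)
        fix s assume "s \<in> X"
        then have "B.functional (\<psi> s) (x \<oplus>\<^bsub>B.V\<^esub> y) = B.functional (\<psi> s) x + B.functional (\<psi> s) y"
          using fl xy by (auto simp: linear_functional_def)
        then show "c s * (q s * B.functional (\<psi> s) (x \<oplus>\<^bsub>B.V\<^esub> y)) =
          c s * (q s * B.functional (\<psi> s) x) + c s * (q s * B.functional (\<psi> s) y)"
          by (simp add: distrib_left)
      qed simp
      then show "g (x \<oplus>\<^bsub>B.V\<^esub> y) = g x + g y" by (simp add: g_def sum.distrib)
    next
      fix t x assume x: "x \<in> carrier B.V"
      show "g (t \<odot>\<^bsub>B.V\<^esub> x) = t * g x"
        unfolding g_def sum_distrib_left
      proof (rule sum.cong)
        fix s assume "s \<in> X"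
        then have "B.functional (\<psi> s) (t \<odot>\<^bsub>B.V\<^esub> x) = t * B.functional (\<psi> s) x"
          using fl x by (auto simp: linear_functional_def)
        then show "c s * (q s * B.functional (\<psi> s) (t \<odot>\<^bsub>B.V\<^esub> x)) =
          t * (c s * (q s * B.functional (\<psi> s) x))" by simp
      qed simp
    qed
    have g0: "g w = 0" if w: "w \<in> carrier B.V" for w
    proof -
      obtain \<alpha> where "VB.lincomb \<alpha> Y = w" using genY w VB.finite_in_span[of Y w] True YV by auto
      then have "g w = (\<Sum>v\<in>Y. \<alpha> v * g v)" using VB.functional_lincomb[OF g, of Y \<alpha>] True YV by simp
      also have "\<dots> = 0" using c(2) by (intro sum.neutral) (auto simp: g_def)
      finally show ?thesis .
    qed
    \<comment> \<open>At b_i \<otimes> 1 the vanishing combination takes the value of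
      \<open>\<phi> i\<close> on \<open>VA.lincomb c X\<close>. That vector is therefore killed by
      all separating functionals and must be zero.\<close>
    have "A.functional (\<phi> i) (VA.lincomb c X) = 0" if i: "i \<in> I" for i
    proof -
      let ?w = "frag_coset B.N (frag_of (b i, 1))"
      have "A.functional (\<phi> i) (VA.lincomb c X) = (\<Sum>s\<in>X. c s * A.functional (\<phi> i) s)"
        using VA.functional_lincomb[OF A.functional_linear[OF \<phi>[OF i]] finX XV] .
      also have "\<dots> = g ?w" unfolding g_def
      proof (rule sum.cong)
        fix s assume s: "s \<in> X"
        have "A.functional (\<phi> i) s = q s * of_int (\<phi> i (a s))"
          by (subst aq(2)[OF s], subst A.functional_coset[OF \<phi>[OF i]]) simp
        then show "c s * A.functional (\<phi> i) s = c s * (q s * B.functional (\<psi> s) ?w)"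
          using B.functional_coset[OF \<psi>(1)[OF s]] \<psi>(2)[OF s i] by simp
      qed simp
      also have "?w \<in> carrier B.V" using b[OF i] by (auto simp: B.V_simps keys_frag_of)
      then have "g ?w = 0" by (rule g0)
      finally show ?thesis .
    qed
    moreover have "VA.lincomb c X \<in> carrier A.V" using XV by (auto simp: class_ring_simps)
    ultimately have "VA.lincomb c X = \<zero>\<^bsub>A.V\<^esub>"
      using A.functional_separates[of I \<phi> "VA.lincomb c X"] \<phi> sep by blast
    with c(1) have "VA.lin_dep X"
      using VA.lin_dep_crit[of X X c] finX by (auto simp: class_ring_simps)
    with liX show ?thesis by simp
  qed
  then have "|X| \<le>o |Y|" using card_of_ordLeq by blast
  then show ?thesis by (simp add: rat_dim_def X_def Y_def)
qed

section \<open>Left modules and group rings\<close>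

context left_module
begin

lemma smult_r_null [simp]: "a \<in> carrier R \<Longrightarrow> a \<odot>\<^bsub>M\<^esub> \<zero>\<^bsub>M\<^esub> = \<zero>\<^bsub>M\<^esub>"
  using smult_r_distr[of a "\<zero>\<^bsub>M\<^esub>" "\<zero>\<^bsub>M\<^esub>"] smult_closed[of a "\<zero>\<^bsub>M\<^esub>"]
    M.add.l_cancel_one'[of "a \<odot>\<^bsub>M\<^esub> \<zero>\<^bsub>M\<^esub>" "a \<odot>\<^bsub>M\<^esub> \<zero>\<^bsub>M\<^esub>"] by simp

lemma smult_l_null [simp]: "x \<in> carrier M \<Longrightarrow> \<zero>\<^bsub>R\<^esub> \<odot>\<^bsub>M\<^esub> x = \<zero>\<^bsub>M\<^esub>"
  using smult_l_distr[of "\<zero>\<^bsub>R\<^esub>" "\<zero>\<^bsub>R\<^esub>" x] smult_closed[of "\<zero>\<^bsub>R\<^esub>" x]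
    M.add.l_cancel_one'[of "\<zero>\<^bsub>R\<^esub> \<odot>\<^bsub>M\<^esub> x" "\<zero>\<^bsub>R\<^esub> \<odot>\<^bsub>M\<^esub> x"] by simp

lemma smult_minus_one: "x \<in> carrier M \<Longrightarrow> (\<ominus>\<^bsub>R\<^esub> \<one>\<^bsub>R\<^esub>) \<odot>\<^bsub>M\<^esub> x = \<ominus>\<^bsub>M\<^esub> x"
  using smult_l_distr[of "\<ominus>\<^bsub>R\<^esub> \<one>\<^bsub>R\<^esub>" "\<one>\<^bsub>R\<^esub>" x] smult_closed[of "\<ominus>\<^bsub>R\<^esub> \<one>\<^bsub>R\<^esub>" x]
  by (metis M.minus_equality R.l_neg R.add.inv_closed R.one_closed smult_l_null smult_one)

lemma smult_finsum:
  assumes "a \<in> carrier R" "f \<in> A \<rightarrow> carrier M"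
  shows "a \<odot>\<^bsub>M\<^esub> (\<Oplus>\<^bsub>M\<^esub>i\<in>A. f i) = (\<Oplus>\<^bsub>M\<^esub>i\<in>A. a \<odot>\<^bsub>M\<^esub> f i)"
  using assms(2)
proof (induction A rule: infinite_finite_induct)
  case (insert i A)
  then have "f i \<in> carrier M" "f \<in> A \<rightarrow> carrier M" "(\<lambda>i. a \<odot>\<^bsub>M\<^esub> f i) \<in> A \<rightarrow> carrier M"
    "a \<odot>\<^bsub>M\<^esub> f i \<in> carrier M" "finsum M f A \<in> carrier M"
    using assms(1) smult_closed by (auto intro!: M.finsum_closed)
  then show ?case using insert assms(1) by (simp add: smult_r_distr)
qed (use assms in simp_all)

end

definition left_submodule :: "('r, 'a) ring_scheme \<Rightarrow> 'm set \<Rightarrow> ('r, 'm, 'b) module_scheme \<Rightarrow> bool" where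
  "left_submodule R N M \<longleftrightarrow> N \<subseteq> carrier M \<and> \<zero>\<^bsub>M\<^esub> \<in> N \<and>
     (\<forall>x\<in>N. \<forall>y\<in>N. x \<oplus>\<^bsub>M\<^esub> y \<in> N) \<and> (\<forall>a\<in>carrier R. \<forall>x\<in>N. a \<odot>\<^bsub>M\<^esub> x \<in> N)"

lemma left_moduleI:
  assumes "ring R" "\<zero>\<^bsub>M\<^esub> \<in> carrier M"
    "\<And>x y. x \<in> carrier M \<Longrightarrow> y \<in> carrier M \<Longrightarrow> x \<oplus>\<^bsub>M\<^esub> y \<in> carrier M"
    "\<And>a x. a \<in> carrier R \<Longrightarrow> x \<in> carrier M \<Longrightarrow> a \<odot>\<^bsub>M\<^esub> x \<in> carrier M"
    "\<And>x y z. x \<in> carrier M \<Longrightarrow> y \<in> carrier M \<Longrightarrow> z \<in> carrier M \<Longrightarrow>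
      (x \<oplus>\<^bsub>M\<^esub> y) \<oplus>\<^bsub>M\<^esub> z = x \<oplus>\<^bsub>M\<^esub> (y \<oplus>\<^bsub>M\<^esub> z)"
    "\<And>x y. x \<in> carrier M \<Longrightarrow> y \<in> carrier M \<Longrightarrow> x \<oplus>\<^bsub>M\<^esub> y = y \<oplus>\<^bsub>M\<^esub> x"
    "\<And>x. x \<in> carrier M \<Longrightarrow> \<zero>\<^bsub>M\<^esub> \<oplus>\<^bsub>M\<^esub> x = x"
    "\<And>x. x \<in> carrier M \<Longrightarrow> \<exists>y\<in>carrier M. y \<oplus>\<^bsub>M\<^esub> x = \<zero>\<^bsub>M\<^esub>"
    "\<And>a b x. a \<in> carrier R \<Longrightarrow> b \<in> carrier R \<Longrightarrow> x \<in> carrier M \<Longrightarrow>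
         (a \<oplus>\<^bsub>R\<^esub> b) \<odot>\<^bsub>M\<^esub> x = (a \<odot>\<^bsub>M\<^esub> x) \<oplus>\<^bsub>M\<^esub> (b \<odot>\<^bsub>M\<^esub> x)"
    "\<And>a x y. a \<in> carrier R \<Longrightarrow> x \<in> carrier M \<Longrightarrow> y \<in> carrier M \<Longrightarrow>
         a \<odot>\<^bsub>M\<^esub> (x \<oplus>\<^bsub>M\<^esub> y) = (a \<odot>\<^bsub>M\<^esub> x) \<oplus>\<^bsub>M\<^esub> (a \<odot>\<^bsub>M\<^esub> y)"
    "\<And>a b x. a \<in> carrier R \<Longrightarrow> b \<in> carrier R \<Longrightarrow> x \<in> carrier M \<Longrightarrow>
         (a \<otimes>\<^bsub>R\<^esub> b) \<odot>\<^bsub>M\<^esub> x = a \<odot>\<^bsub>M\<^esub> (b \<odot>\<^bsub>M\<^esub> x)"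
    "\<And>x. x \<in> carrier M \<Longrightarrow> \<one>\<^bsub>R\<^esub> \<odot>\<^bsub>M\<^esub> x = x"
  shows "left_module R M"
proof -
  have "abelian_group M"
    by (rule abelian_groupI) (use assms in blast)+
  then show ?thesis
    unfolding left_module_def left_module_axioms_def using assms by blast
qed

context left_module
begin

lemma left_submodule_module:
  assumes "left_submodule R N M"
  shows "left_module R (M\<lparr>carrier := N\<rparr>)"
proof (rule left_moduleI)
  have N: "x \<in> N \<Longrightarrow> x \<in> carrier M" for x using assms by (auto simp: left_submodule_def)
  show "\<exists>y\<in>carrier (M\<lparr>carrier := N\<rparr>). y \<oplus>\<^bsub>M\<lparr>carrier := N\<rparr>\<^esub> x = \<zero>\<^bsub>M\<lparr>carrier := N\<rparr>\<^esub>"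
    if "x \<in> carrier (M\<lparr>carrier := N\<rparr>)" for x
  proof
    have x: "x \<in> N" "x \<in> carrier M" using that N by auto
    show "(\<ominus>\<^bsub>R\<^esub> \<one>\<^bsub>R\<^esub>) \<odot>\<^bsub>M\<^esub> x \<in> carrier (M\<lparr>carrier := N\<rparr>)"
      using assms x by (simp add: left_submodule_def)
    show "(\<ominus>\<^bsub>R\<^esub> \<one>\<^bsub>R\<^esub>) \<odot>\<^bsub>M\<^esub> x \<oplus>\<^bsub>M\<lparr>carrier := N\<rparr>\<^esub> x = \<zero>\<^bsub>M\<lparr>carrier := N\<rparr>\<^esub>"
      using x by (simp add: smult_minus_one M.l_neg)
  qed
qed (use assms in \<open>auto simp: left_submodule_def smult_l_distr smult_r_distr smult_assoc1 smult_one
      M.a_assoc R.ring_axioms subset_iff intro: M.a_comm\<close>)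

lemma left_submodule_self: "left_submodule R (carrier M) M"
  by (simp add: left_submodule_def smult_closed)

end

lemma mhomI:
  assumes "\<And>x. x \<in> carrier M \<Longrightarrow> f x \<in> carrier N"
    "\<And>x y. x \<in> carrier M \<Longrightarrow> y \<in> carrier M \<Longrightarrow> f (x \<oplus>\<^bsub>M\<^esub> y) = f x \<oplus>\<^bsub>N\<^esub> f y"
    "\<And>a x. a \<in> carrier R \<Longrightarrow> x \<in> carrier M \<Longrightarrow> f (a \<odot>\<^bsub>M\<^esub> x) = a \<odot>\<^bsub>N\<^esub> f x"
  shows "f \<in> mhom R M N"
  using assms by (auto simp: LinearCombinations.module_hom_def)

lemma mhomD:
  assumes "f \<in> mhom R M N"
  shows "x \<in> carrier M \<Longrightarrow> f x \<in> carrier N"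
    "x \<in> carrier M \<Longrightarrow> y \<in> carrier M \<Longrightarrow> f (x \<oplus>\<^bsub>M\<^esub> y) = f x \<oplus>\<^bsub>N\<^esub> f y"
    "a \<in> carrier R \<Longrightarrow> x \<in> carrier M \<Longrightarrow> f (a \<odot>\<^bsub>M\<^esub> x) = a \<odot>\<^bsub>N\<^esub> f x"
  using assms by (auto simp: LinearCombinations.module_hom_def)

lemma mhom_comp: "f \<in> mhom R M N \<Longrightarrow> g \<in> mhom R N L \<Longrightarrow> (\<lambda>x. g (f x)) \<in> mhom R M L"
  by (intro mhomI) (simp_all add: mhomD)

lemma mhom_zero:
  assumes "left_module R M" "left_module R N" "f \<in> mhom R M N"
  shows "f \<zero>\<^bsub>M\<^esub> = \<zero>\<^bsub>N\<^esub>"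
proof -
  interpret M: left_module R M by fact
  interpret N: left_module R N by fact
  have "f (\<zero>\<^bsub>R\<^esub> \<odot>\<^bsub>M\<^esub> \<zero>\<^bsub>M\<^esub>) = \<zero>\<^bsub>R\<^esub> \<odot>\<^bsub>N\<^esub> f \<zero>\<^bsub>M\<^esub>" by (rule mhomD(3)[OF assms(3)]) auto
  then show ?thesis using mhomD(1)[OF assms(3), of "\<zero>\<^bsub>M\<^esub>"] by simp
qed

lemma mhom_minus:
  assumes "left_module R M" "left_module R N" "f \<in> mhom R M N" "x \<in> carrier M" "y \<in> carrier M"
  shows "f (x \<ominus>\<^bsub>M\<^esub> y) = f x \<ominus>\<^bsub>N\<^esub> f y"
proof -
  interpret M: left_module R M by fact
  interpret N: left_module R N by fact
  have "f (x \<oplus>\<^bsub>M\<^esub> (\<ominus>\<^bsub>R\<^esub> \<one>\<^bsub>R\<^esub>) \<odot>\<^bsub>M\<^esub> y) = f x \<oplus>\<^bsub>N\<^esub> (\<ominus>\<^bsub>R\<^esub> \<one>\<^bsub>R\<^esub>) \<odot>\<^bsub>N\<^esub> f y"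
    using assms by (simp add: mhomD M.smult_closed)
  then show ?thesis using assms(4,5) mhomD(1)[OF assms(3)]
    by (simp add: M.smult_minus_one N.smult_minus_one a_minus_def)
qed

lemma mhom_image_submodule:
  assumes "left_module R M" "left_module R N" "f \<in> mhom R M N" "left_submodule R L M"
  shows "left_submodule R (f ` L) N"
  unfolding left_submodule_def
proof (intro conjI ballI)
  have L: "L \<subseteq> carrier M" "\<zero>\<^bsub>M\<^esub> \<in> L" "\<And>x y. x \<in> L \<Longrightarrow> y \<in> L \<Longrightarrow> x \<oplus>\<^bsub>M\<^esub> y \<in> L"
    "\<And>a x. a \<in> carrier R \<Longrightarrow> x \<in> L \<Longrightarrow> a \<odot>\<^bsub>M\<^esub> x \<in> L"
    using assms(4) by (auto simp: left_submodule_def)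
  show "f ` L \<subseteq> carrier N" using L mhomD(1)[OF assms(3)] by auto
  show "\<zero>\<^bsub>N\<^esub> \<in> f ` L" using mhom_zero[OF assms(1-3)] L(2) by (metis imageI)
  show "x \<oplus>\<^bsub>N\<^esub> y \<in> f ` L" if "x \<in> f ` L" "y \<in> f ` L" for x y
    using that L mhomD(2)[OF assms(3), symmetric] by (auto simp: subset_iff)
  show "a \<odot>\<^bsub>N\<^esub> x \<in> f ` L" if "a \<in> carrier R" "x \<in> f ` L" for a x
    using that L mhomD(3)[OF assms(3), symmetric] by (auto simp: subset_iff)
qed

lemma mhom_kernel_submodule:
  assumes "left_module R M" "left_module R N" "f \<in> mhom R M N"
  shows "left_submodule R {x \<in> carrier M. f x = \<zero>\<^bsub>N\<^esub>} M"
proof -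
  interpret M: left_module R M by fact
  interpret N: left_module R N by fact
  show ?thesis
    unfolding left_submodule_def
    using mhom_zero[OF assms] by (auto simp: mhomD[OF assms(3)] M.smult_closed)
qed

lemma mhom_inverse:
  assumes "left_module R M" "f \<in> mhom R M N" "bij_betw f (carrier M) (carrier N)"
  shows "inv_into (carrier M) f \<in> mhom R N M"
proof -
  interpret M: left_module R M by fact
  have inj: "inj_on f (carrier M)" and im: "f ` carrier M = carrier N"
    using assms(3) by (auto simp: bij_betw_def)
  let ?g = "inv_into (carrier M) f"
  have g: "?g y \<in> carrier M" "f (?g y) = y" if "y \<in> carrier N" for y
    using that im by (auto intro: inv_into_into f_inv_into_f)
  have gf: "?g (f x) = x" if "x \<in> carrier M" for x using inj that by simp
  show ?thesis
  proof (rule mhomI)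
    show "?g (x \<oplus>\<^bsub>N\<^esub> y) = ?g x \<oplus>\<^bsub>M\<^esub> ?g y" if "x \<in> carrier N" "y \<in> carrier N" for x y
      using gf[of "?g x \<oplus>\<^bsub>M\<^esub> ?g y"] g that by (simp add: mhomD[OF assms(2)])
    show "?g (a \<odot>\<^bsub>N\<^esub> x) = a \<odot>\<^bsub>M\<^esub> ?g x" if "a \<in> carrier R" "x \<in> carrier N" for a x
      using gf[of "a \<odot>\<^bsub>M\<^esub> ?g x"] g that by (simp add: mhomD[OF assms(2)] M.smult_closed)
  qed (use g in auto)
qed

section \<open>The ring structure of the group ring\<close>

lemma poly_mapping_induct [consumes 1, case_names zero single add]:
  assumes "Poly_Mapping.keys f \<subseteq> S" "P 0" "\<And>x a. x \<in> S \<Longrightarrow> P (Poly_Mapping.single x a)"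
    "\<And>f g. P f \<Longrightarrow> P g \<Longrightarrow> P (f + g)"
  shows "P (f :: 'a \<Rightarrow>\<^sub>0 'b::comm_monoid_add)"
proof -
  have eq: "f = (\<Sum>x\<in>Poly_Mapping.keys f. Poly_Mapping.single x (Poly_Mapping.lookup f x))"
    by (rule poly_mapping_eqI)
      (auto simp: lookup_sum lookup_single when_def in_keys_iff intro: sum.neutral)
  have "P (\<Sum>x\<in>A. Poly_Mapping.single x (Poly_Mapping.lookup f x))" if "finite A" "A \<subseteq> S" for A
    using that by (induction A rule: finite_induct) (auto intro: assms)
  then show ?thesis using assms(1) by (subst eq) simp
qed

locale group_algebra = group G for G :: "('g, 'a) monoid_scheme" (structure) +
  fixes k :: "'k::field itself"
begin

abbreviation "R \<equiv> group_ring k G"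

lemma R_simps: "carrier R = {f. Poly_Mapping.keys f \<subseteq> carrier G}"
  "\<one>\<^bsub>R\<^esub> = Poly_Mapping.single \<one> 1" "\<zero>\<^bsub>R\<^esub> = 0" "f \<oplus>\<^bsub>R\<^esub> g = f + g"
  by (simp_all add: group_ring_def)

text \<open>Index sets larger than the supports are allowed, so that both sides of a distributive
  law can be summed over the same set.\<close>

lemma R_mult_superset:
  assumes "finite A" "Poly_Mapping.keys f \<subseteq> A" "finite B" "Poly_Mapping.keys g \<subseteq> B"
  shows "f \<otimes>\<^bsub>R\<^esub> g = (\<Sum>x\<in>A. \<Sum>y\<in>B.
    Poly_Mapping.single (x \<otimes> y) (Poly_Mapping.lookup f x * Poly_Mapping.lookup g y))"
proof -
  have "(\<Sum>y\<in>Poly_Mapping.keys g. Poly_Mapping.single (x \<otimes> y) (Poly_Mapping.lookup f x * Poly_Mapping.lookup g y))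
     = (\<Sum>y\<in>B. Poly_Mapping.single (x \<otimes> y) (Poly_Mapping.lookup f x * Poly_Mapping.lookup g y))" for x
    using assms by (intro sum.mono_neutral_left) (auto simp: in_keys_iff)
  moreover have "(\<Sum>x\<in>Poly_Mapping.keys f. \<Sum>y\<in>B. Poly_Mapping.single (x \<otimes> y) (Poly_Mapping.lookup f x * Poly_Mapping.lookup g y))
     = (\<Sum>x\<in>A. \<Sum>y\<in>B. Poly_Mapping.single (x \<otimes> y) (Poly_Mapping.lookup f x * Poly_Mapping.lookup g y))"
    using assms by (intro sum.mono_neutral_left) (auto simp: in_keys_iff)
  ultimately show ?thesis by (simp add: group_ring_def)
qed

lemma R_mult_add_left: "(f + g) \<otimes>\<^bsub>R\<^esub> h = f \<otimes>\<^bsub>R\<^esub> h + g \<otimes>\<^bsub>R\<^esub> h"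
proof -
  let ?A = "Poly_Mapping.keys f \<union> Poly_Mapping.keys g" and ?B = "Poly_Mapping.keys h"
  show ?thesis using keys_add[of f g]
    by (simp add: R_mult_superset[of ?A _ ?B] lookup_add distrib_right single_add sum.distrib)
qed

lemma R_mult_add_right: "h \<otimes>\<^bsub>R\<^esub> (f + g) = h \<otimes>\<^bsub>R\<^esub> f + h \<otimes>\<^bsub>R\<^esub> g"
proof -
  let ?A = "Poly_Mapping.keys f \<union> Poly_Mapping.keys g" and ?B = "Poly_Mapping.keys h"
  show ?thesis using keys_add[of f g]
    by (simp add: R_mult_superset[of ?B _ ?A] lookup_add distrib_left single_add sum.distrib)
qed

lemma R_mult_single: "Poly_Mapping.single x a \<otimes>\<^bsub>R\<^esub> Poly_Mapping.single y b =
    Poly_Mapping.single (x \<otimes> y) (a * b)"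
  by (subst R_mult_superset[of "{x}" _ "{y}"]) auto

lemma R_mult_0: "0 \<otimes>\<^bsub>R\<^esub> f = 0" "f \<otimes>\<^bsub>R\<^esub> 0 = 0"
  by (simp_all add: group_ring_def)

lemma R_single: "x \<in> carrier G \<Longrightarrow> Poly_Mapping.single x a \<in> carrier R"
  by (simp add: R_simps)

lemma R_add: "f \<in> carrier R \<Longrightarrow> g \<in> carrier R \<Longrightarrow> f + g \<in> carrier R"
  using keys_add[of f g] by (auto simp: R_simps)

lemma R_induct [consumes 1, case_names zero single add]:
  assumes "f \<in> carrier R" "P 0" "\<And>x a. x \<in> carrier G \<Longrightarrow> P (Poly_Mapping.single x a)"
    "\<And>f g. P f \<Longrightarrow> P g \<Longrightarrow> P (f + g)"
  shows "P f"
  using poly_mapping_induct[of f "carrier G" P] assms by (simp add: R_simps)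

lemma R_mult_closed:
  assumes "f \<in> carrier R" "g \<in> carrier R"
  shows "f \<otimes>\<^bsub>R\<^esub> g \<in> carrier R"
  using assms(1)
proof (induction rule: R_induct)
  case (single x a)
  from assms(2) show ?case
    using single by (induction rule: R_induct)
      (simp_all add: R_mult_0 R_mult_single R_single R_mult_add_right R_add, simp add: R_simps)
qed (simp_all add: R_mult_0 R_mult_add_left R_add, simp add: R_simps)

lemma R_mult_assoc:
  assumes "f \<in> carrier R" "g \<in> carrier R" "h \<in> carrier R"
  shows "(f \<otimes>\<^bsub>R\<^esub> g) \<otimes>\<^bsub>R\<^esub> h = f \<otimes>\<^bsub>R\<^esub> (g \<otimes>\<^bsub>R\<^esub> h)"
  using assms(1)
proof (induction rule: R_induct)
  case (single x a)
  from assms(2) show ?case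
  proof (induction rule: R_induct)
    case (single y b)
    from assms(3) show ?case
      using \<open>x \<in> carrier G\<close> single
      by (induction rule: R_induct)
        (simp_all add: R_mult_0 R_mult_single R_mult_add_right m_assoc mult.assoc)
  qed (simp_all add: R_mult_0 R_mult_add_left R_mult_add_right)
qed (simp_all add: R_mult_0 R_mult_add_left)

lemma R_one_mult:
  assumes "f \<in> carrier R"
  shows "\<one>\<^bsub>R\<^esub> \<otimes>\<^bsub>R\<^esub> f = f" "f \<otimes>\<^bsub>R\<^esub> \<one>\<^bsub>R\<^esub> = f"
  using assms
  by (induction rule: R_induct, auto simp: R_simps R_mult_0 R_mult_single R_mult_add_left R_mult_add_right)

text \<open>The reason why eM and the set of module homomorphisms are K-subspaces although the group
  ring is not commutative.\<close>

lemma scalar_central: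
  assumes "f \<in> carrier R"
  shows "Poly_Mapping.single \<one> c \<otimes>\<^bsub>R\<^esub> f = f \<otimes>\<^bsub>R\<^esub> Poly_Mapping.single \<one> c"
  using assms
  by (induction rule: R_induct)
    (simp_all add: R_mult_0 R_mult_single R_mult_add_left R_mult_add_right mult.commute)

lemma ring_R: "ring R"
proof (rule ringI)
  show "abelian_group R"
  proof (rule abelian_groupI)
    show "f \<oplus>\<^bsub>R\<^esub> g \<in> carrier R" if "f \<in> carrier R" "g \<in> carrier R" for f g
      using R_add[OF that] by (simp add: R_simps(4))
  next
    fix f assume "f \<in> carrier R"
    then show "\<exists>y\<in>carrier R. y \<oplus>\<^bsub>R\<^esub> f = \<zero>\<^bsub>R\<^esub>"
      by (intro bexI[of _ "- f"]) (auto simp: R_simps in_keys_iff)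
  qed (auto simp: R_simps ac_simps)
  show "monoid R"
    by (rule monoidI) (simp_all add: R_mult_closed R_mult_assoc R_one_mult, simp add: R_simps)
qed (simp_all add: R_simps(4) R_mult_add_left R_mult_add_right)

end

section \<open>Underlying vector spaces and the components eM\<close>

definition scalar_space :: "('g, 'a) monoid_scheme \<Rightarrow> ('g \<Rightarrow>\<^sub>0 'k::field, 'm) module \<Rightarrow> ('k, 'm) module" where
  "scalar_space G M = restrict_scalars (Poly_Mapping.single \<one>\<^bsub>G\<^esub>) M"

lemma scalar_space_simps [simp]:
  "carrier (scalar_space G M) = carrier M" "\<zero>\<^bsub>scalar_space G M\<^esub> = \<zero>\<^bsub>M\<^esub>"
  "x \<oplus>\<^bsub>scalar_space G M\<^esub> y = x \<oplus>\<^bsub>M\<^esub> y"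
  "c \<odot>\<^bsub>scalar_space G M\<^esub> x = Poly_Mapping.single \<one>\<^bsub>G\<^esub> c \<odot>\<^bsub>M\<^esub> x"
  "scalar_space G (M\<lparr>carrier := N\<rparr>) = (scalar_space G M)\<lparr>carrier := N\<rparr>"
  "scalar_space (G\<lparr>carrier := H\<rparr>) M = scalar_space G M"
  by (simp_all add: scalar_space_def restrict_scalars_def)

abbreviation "kdim G M \<equiv> vectorspace.dim class_ring (scalar_space G M)"
abbreviation "kfin G M \<equiv> vectorspace.fin_dim class_ring (scalar_space G M)"

text \<open>For an idempotent \<open>e\<close> of the group ring R this is dim Hom(Re, M), by
  \<open>hom_dim_principal\<close>. It is taken as an integer so that it extends additively to
  virtual modules.\<close>

definition component_dim :: "('g, 'a) monoid_scheme \<Rightarrow> ('g \<Rightarrow>\<^sub>0 'k::field) \<Rightarrow> ('g \<Rightarrow>\<^sub>0 'k, 'm) module \<Rightarrow> int" where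
  "component_dim G e M = int (kdim G (M\<lparr>carrier := (\<lambda>x. e \<odot>\<^bsub>M\<^esub> x) ` carrier M\<rparr>))"

context group_algebra
begin

sublocale R: ring R by (rule ring_R)

lemma scalar_space: 
  assumes "left_module R M"
  shows "field_space (scalar_space G M)"
proof -
  interpret left_module R M by fact
  have s: "Poly_Mapping.single \<one> c \<in> carrier R" for c :: 'k by (simp add: R_single)
  have a: "Poly_Mapping.single \<one> (c + d) = Poly_Mapping.single \<one> c \<oplus>\<^bsub>R\<^esub> (Poly_Mapping.single \<one> d :: 'g \<Rightarrow>\<^sub>0 'k)"
    for c d by (simp add: R_simps single_add)
  have m: "Poly_Mapping.single \<one> (c * d) = Poly_Mapping.single \<one> c \<otimes>\<^bsub>R\<^esub> (Poly_Mapping.single \<one> d :: 'g \<Rightarrow>\<^sub>0 'k)"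
    for c d by (simp add: R_mult_single)
  have neg: "\<exists>y\<in>carrier M. x \<oplus>\<^bsub>M\<^esub> y = \<zero>\<^bsub>M\<^esub>" if "x \<in> carrier M" for x
    using that M.r_neg by blast
  show ?thesis unfolding field_space_def
    by (rule vs_criteria) (use neg in \<open>auto simp: class_field class_ring_simps smult_closed s M.a_ac
        a m smult_l_distr smult_r_distr smult_assoc1 smult_one[unfolded R_simps]\<close>)
qed

lemma mhom_scalar: "f \<in> mhom R M N \<Longrightarrow> f \<in> mhom class_ring (scalar_space G M) (scalar_space G N)"
  by (rule mhomI) (auto simp: mhomD R_single)

lemma kfin_submodule:
  assumes "left_module R M" "kfin G M" "left_submodule R N M"
  shows "kfin G (M\<lparr>carrier := N\<rparr>)"
proof -
  interpret left_module R M by fact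
  interpret field_space "scalar_space G M" using assms(1) by (rule scalar_space)
  show ?thesis
    by (rule fin_dim_inj[OF assms(2), of _ "\<lambda>x. x"])
      (use scalar_space[OF left_submodule_module[OF assms(3)]] assms(3) in
        \<open>auto intro!: mhomI simp: left_submodule_def subset_iff\<close>)
qed

lemma kdim_short_exact:
  assumes "left_module R M'" "left_module R M" "left_module R M''" "short_exact R M' M M''" "kfin G M"
  shows "kdim G M = kdim G M' + kdim G M''"
  using assms(4) dim_short_exact(1)[OF assms(1-3)[THEN scalar_space] mhom_scalar mhom_scalar _ _ _ assms(5)]
  unfolding short_exact_def by auto

text \<open>In general eM is no submodule; it is a K-subspace because scalars commute with
  \<open>e\<close>.\<close>

lemma component_space:
  assumes "left_module R M" "e \<in> carrier R" "kfin G M"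
  defines "E \<equiv> M\<lparr>carrier := (\<lambda>x. e \<odot>\<^bsub>M\<^esub> x) ` carrier M\<rparr>"
  shows "field_space (scalar_space G E)" "kfin G E"
proof -
  interpret L: left_module R M by fact
  interpret field_space "scalar_space G M" using assms(1) by (rule scalar_space)
  show *: "field_space (scalar_space G E)"
    unfolding E_def scalar_space_simps
  proof (rule subspace_space(2))
    show "x \<oplus>\<^bsub>scalar_space G M\<^esub> y \<in> (\<odot>\<^bsub>M\<^esub>) e ` carrier M"
      if xy: "x \<in> (\<odot>\<^bsub>M\<^esub>) e ` carrier M" "y \<in> (\<odot>\<^bsub>M\<^esub>) e ` carrier M" for x y
    proof -
      obtain u v where "u \<in> carrier M" "v \<in> carrier M" "x = e \<odot>\<^bsub>M\<^esub> u" "y = e \<odot>\<^bsub>M\<^esub> v"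
        using xy by auto
      then have "x \<oplus>\<^bsub>M\<^esub> y = e \<odot>\<^bsub>M\<^esub> (u \<oplus>\<^bsub>M\<^esub> v)" "u \<oplus>\<^bsub>M\<^esub> v \<in> carrier M"
        using assms(2) by (simp_all add: L.smult_r_distr)
      then show ?thesis by simp
    qed
    show "c \<odot>\<^bsub>scalar_space G M\<^esub> x \<in> (\<odot>\<^bsub>M\<^esub>) e ` carrier M" if x: "x \<in> (\<odot>\<^bsub>M\<^esub>) e ` carrier M" for c x
    proof -
      obtain y where y: "y \<in> carrier M" "x = e \<odot>\<^bsub>M\<^esub> y" using x by auto
      then have "Poly_Mapping.single \<one> c \<odot>\<^bsub>M\<^esub> x = e \<odot>\<^bsub>M\<^esub> (Poly_Mapping.single \<one> c \<odot>\<^bsub>M\<^esub> y)"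
        using assms(2) scalar_central[OF assms(2), of c] by (simp flip: L.smult_assoc1 add: R_single)
      then show ?thesis using y by (simp add: L.smult_closed R_single)
    qed
    have "\<zero>\<^bsub>M\<^esub> = e \<odot>\<^bsub>M\<^esub> \<zero>\<^bsub>M\<^esub>" using assms(2) by simp
    then show "\<zero>\<^bsub>scalar_space G M\<^esub> \<in> (\<odot>\<^bsub>M\<^esub>) e ` carrier M" by (metis imageI L.M.zero_closed scalar_space_simps(2))
  qed (use assms(2) in \<open>auto simp: L.smult_closed\<close>)
  show "kfin G E"
    by (rule fin_dim_inj[OF assms(3) *, of "\<lambda>x. x"])
      (use assms(2) in \<open>auto intro!: mhomI simp: E_def L.smult_closed\<close>)
qed

text \<open>Multiplication by an idempotent is an exact functor. Idempotency enters in the middle of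
  the sequence: a kernel element e m comes from some x, and then equally from e x.\<close>

lemma component_dim_exact:
  assumes M: "left_module R M'" "left_module R M" "left_module R M''" and ex: "short_exact R M' M M''"
    and fin: "kfin G M'" "kfin G M" "kfin G M''" and e: "e \<in> carrier R" "e \<otimes>\<^bsub>R\<^esub> e = e"
  shows "component_dim G e M = component_dim G e M' + component_dim G e M''"
proof -
  interpret M': left_module R M' by fact
  interpret M: left_module R M by fact
  interpret M'': left_module R M'' by fact
  obtain i p where ip: "i \<in> mhom R M' M" "p \<in> mhom R M M''" "inj_on i (carrier M')"
    "i ` carrier M' = {x \<in> carrier M. p x = \<zero>\<^bsub>M''\<^esub>}" "p ` carrier M = carrier M''"
    using ex unfolding short_exact_def by blast
  let ?E = "\<lambda>M :: ('g \<Rightarrow>\<^sub>0 'k, 'b) module. M\<lparr>carrier := (\<lambda>x. e \<odot>\<^bsub>M\<^esub> x) ` carrier M\<rparr>"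
  have ee: "e \<odot>\<^bsub>M\<^esub> (e \<odot>\<^bsub>M\<^esub> x) = e \<odot>\<^bsub>M\<^esub> x" if "x \<in> carrier M" for x
    using M.smult_assoc1[OF e(1) e(1) that] e(2) by simp
  have "kdim G (?E M) = kdim G (?E M') + kdim G (?E M'')"
  proof (rule dim_short_exact(1))
    show "i \<in> mhom class_ring (scalar_space G (?E M')) (scalar_space G (?E M))"
      using e(1) by (intro mhomI) (auto simp: mhomD[OF ip(1)] M'.smult_closed R_single)
    show "p \<in> mhom class_ring (scalar_space G (?E M)) (scalar_space G (?E M''))"
      using e(1) by (intro mhomI) (auto simp: mhomD[OF ip(2)] M.smult_closed R_single)
    show "inj_on i (carrier (scalar_space G (?E M')))"
      using ip(3) e(1) M'.smult_closed by (auto intro: inj_on_subset)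
    show "p ` carrier (scalar_space G (?E M)) = carrier (scalar_space G (?E M''))"
    proof -
      have "p ` ((\<odot>\<^bsub>M\<^esub>) e ` carrier M) = (\<odot>\<^bsub>M''\<^esub>) e ` (p ` carrier M)"
        unfolding image_image using e(1) by (intro image_cong) (auto simp: mhomD[OF ip(2)])
      then show ?thesis using ip(5) by simp
    qed
    show "i ` carrier (scalar_space G (?E M')) =
      {x \<in> carrier (scalar_space G (?E M)). p x = \<zero>\<^bsub>scalar_space G (?E M'')\<^esub>}"
    proof (intro equalityI subsetI)
      fix y assume "y \<in> i ` carrier (scalar_space G (?E M'))"
      then obtain x where x: "x \<in> carrier M'" "y = i (e \<odot>\<^bsub>M'\<^esub> x)" by auto
      have "y \<in> i ` carrier M'" unfolding x(2) using x(1) e(1) M'.smult_closed by blast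
      moreover have "y = e \<odot>\<^bsub>M\<^esub> i x" using x e(1) by (simp add: mhomD[OF ip(1)])
      ultimately show "y \<in> {x \<in> carrier (scalar_space G (?E M)). p x = \<zero>\<^bsub>scalar_space G (?E M'')\<^esub>}"
        using ip(4) x mhomD(1)[OF ip(1)] by auto
    next
      fix y assume "y \<in> {x \<in> carrier (scalar_space G (?E M)). p x = \<zero>\<^bsub>scalar_space G (?E M'')\<^esub>}"
      then obtain z where z: "z \<in> carrier M" "y = e \<odot>\<^bsub>M\<^esub> z" "p y = \<zero>\<^bsub>M''\<^esub>" by auto
      then have "y \<in> i ` carrier M'" unfolding ip(4) using e(1) M.smult_closed by auto
      then obtain x where x: "x \<in> carrier M'" "y = i x" by auto
      have "i (e \<odot>\<^bsub>M'\<^esub> x) = y" using x z e(1) ee by (simp add: mhomD[OF ip(1)] flip: x(2))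
      then have "y = i (e \<odot>\<^bsub>M'\<^esub> x)" ..
      then show "y \<in> i ` carrier (scalar_space G (?E M'))" using x(1) by auto
    qed
  qed (use component_space M fin e in auto)
  then show ?thesis by (simp add: component_dim_def)
qed

end

section \<open>Principal modules and spaces of homomorphisms\<close>

lemma mhom_finsum:
  assumes "left_module R M" "left_module R N" "f \<in> mhom R M N" "g \<in> A \<rightarrow> carrier M"
  shows "f (\<Oplus>\<^bsub>M\<^esub>i\<in>A. g i) = (\<Oplus>\<^bsub>N\<^esub>i\<in>A. f (g i))"
proof -
  interpret M: left_module R M by fact
  interpret N: left_module R N by fact
  show ?thesis using assms(4)
  proof (induction A rule: infinite_finite_induct)
    case (insert i A)
    then have "g i \<in> carrier M" "g \<in> A \<rightarrow> carrier M" "(\<lambda>i. f (g i)) \<in> A \<rightarrow> carrier N" "f (g i) \<in> carrier N"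
      by (auto intro: mhomD(1)[OF assms(3)])
    then show ?case using insert by (simp add: mhomD(2)[OF assms(3)])
  qed (simp_all add: mhom_zero[OF assms(1-3)])
qed

lemma mhom_eq_iff:
  assumes "left_module R M" "left_module R N" "f \<in> mhom R M N" "x \<in> carrier M" "y \<in> carrier M"
  shows "f x = f y \<longleftrightarrow> f (x \<ominus>\<^bsub>M\<^esub> y) = \<zero>\<^bsub>N\<^esub>"
proof -
  interpret N: left_module R N by fact
  show ?thesis
    using mhom_minus[OF assms] mhomD(1)[OF assms(3)] assms(4,5) N.M.minus_other_side by metis
qed

text \<open>\<open>h\<close> is constant on the fibres of \<open>f\<close>, so any choice of
  preimages defines the induced map and makes it linear.\<close>

lemma mhom_factor:
  assumes L: "left_module R M" "left_module R S" "left_module R T"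
    and f: "f \<in> mhom R M S" "f ` carrier M = carrier S" and h: "h \<in> mhom R M T"
    and ker: "\<And>x. x \<in> carrier M \<Longrightarrow> f x = \<zero>\<^bsub>S\<^esub> \<Longrightarrow> h x = \<zero>\<^bsub>T\<^esub>"
  shows "\<exists>g\<in>mhom R S T. \<forall>x\<in>carrier M. g (f x) = h x"
proof -
  interpret M: left_module R M by fact
  define g where "g y = h (inv_into (carrier M) f y)" for y
  have gf: "g (f x) = h x" if "x \<in> carrier M" for x
  proof -
    let ?x = "inv_into (carrier M) f (f x)"
    have x: "?x \<in> carrier M" "f ?x = f x"
      using that by (auto intro: inv_into_into f_inv_into_f)
    then have "f (?x \<ominus>\<^bsub>M\<^esub> x) = \<zero>\<^bsub>S\<^esub>" using mhom_eq_iff[OF L(1,2) f(1)] that by blast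
    then have "h (?x \<ominus>\<^bsub>M\<^esub> x) = \<zero>\<^bsub>T\<^esub>" using ker x that by simp
    then show ?thesis using mhom_eq_iff[OF L(1,3) h x(1) that] by (simp add: g_def)
  qed
  have ex: "\<exists>x\<in>carrier M. y = f x" if "y \<in> carrier S" for y using that f(2) by auto
  have "g \<in> mhom R S T"
  proof (rule mhomI)
    show "g y \<in> carrier T" if "y \<in> carrier S" for y
      using ex[OF that] gf mhomD(1)[OF h] by auto
    show "g (x \<oplus>\<^bsub>S\<^esub> y) = g x \<oplus>\<^bsub>T\<^esub> g y" if xy: "x \<in> carrier S" "y \<in> carrier S" for x y
    proof -
      obtain a b where ab: "a \<in> carrier M" "b \<in> carrier M" "x = f a" "y = f b"
        using ex xy by metis
      then have "x \<oplus>\<^bsub>S\<^esub> y = f (a \<oplus>\<^bsub>M\<^esub> b)" by (simp add: mhomD(2)[OF f(1)])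
      then show ?thesis using ab gf by (simp add: mhomD(2)[OF h])
    qed
    show "g (r \<odot>\<^bsub>S\<^esub> x) = r \<odot>\<^bsub>T\<^esub> g x" if rx: "r \<in> carrier R" "x \<in> carrier S" for r x
    proof -
      obtain a where ab: "a \<in> carrier M" "x = f a" using ex rx by metis
      then have "r \<odot>\<^bsub>S\<^esub> x = f (r \<odot>\<^bsub>M\<^esub> a)" using rx by (simp add: mhomD(3)[OF f(1)])
      then show ?thesis using ab gf rx by (simp add: mhomD(3)[OF h] M.smult_closed)
    qed
  qed
  with gf show ?thesis by blast
qed

text \<open>The left ideal \<open>Re\<close>, its elements encoded as constant sequences.\<close>

definition principal_module :: "('r, 'a) ring_scheme \<Rightarrow> 'r \<Rightarrow> 'r fmod" where
  "principal_module R e =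
     \<lparr>carrier = (\<lambda>r. \<lambda>_. r \<otimes>\<^bsub>R\<^esub> e) ` carrier R, monoid.mult = undefined, one = undefined,
      zero = (\<lambda>_. \<zero>\<^bsub>R\<^esub>), add = (\<lambda>x y _. x 0 \<oplus>\<^bsub>R\<^esub> y 0), smult = (\<lambda>r x _. r \<otimes>\<^bsub>R\<^esub> x 0)\<rparr>"

context ring
begin

abbreviation "Pm \<equiv> principal_module R"

lemma Pm_simps: "\<zero>\<^bsub>Pm e\<^esub> = (\<lambda>_. \<zero>)" "x \<oplus>\<^bsub>Pm e\<^esub> y = (\<lambda>_. x 0 \<oplus> y 0)"
  "r \<odot>\<^bsub>Pm e\<^esub> x = (\<lambda>_. r \<otimes> x 0)"
  by (simp_all add: principal_module_def)

lemma Pm_carrier: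
  assumes "e \<in> carrier R" "e \<otimes> e = e"
  shows "x \<in> carrier (Pm e) \<longleftrightarrow> (\<exists>r\<in>carrier R. r \<otimes> e = r \<and> x = (\<lambda>_. r))"
proof
  assume "x \<in> carrier (Pm e)"
  then obtain r where "r \<in> carrier R" "x = (\<lambda>_. r \<otimes> e)" by (auto simp: principal_module_def)
  then show "\<exists>r\<in>carrier R. r \<otimes> e = r \<and> x = (\<lambda>_. r)"
    using assms by (intro bexI[of _ "r \<otimes> e"]) (auto simp: m_assoc)
qed (force simp: principal_module_def)

lemma Pm_left_module:
  assumes e: "e \<in> carrier R" "e \<otimes> e = e"
  shows "left_module R (Pm e)"
proof -
  note P = Pm_carrier[OF e]
  have neg: "\<exists>y\<in>carrier (Pm e). y \<oplus>\<^bsub>Pm e\<^esub> x = \<zero>\<^bsub>Pm e\<^esub>" if x: "x \<in> carrier (Pm e)" for x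
  proof -
    obtain r where r: "r \<in> carrier R" "r \<otimes> e = r" "x = (\<lambda>_. r)" using x P by auto
    then show ?thesis using e
      by (intro bexI[of _ "\<lambda>_. \<ominus> r"]) (auto simp: P Pm_simps l_neg l_minus intro!: bexI[of _ "\<ominus> r"])
  qed
  have cl: "x \<oplus>\<^bsub>Pm e\<^esub> y \<in> carrier (Pm e)" if xy: "x \<in> carrier (Pm e)" "y \<in> carrier (Pm e)" for x y
  proof -
    obtain r s where "r \<in> carrier R" "r \<otimes> e = r" "x = (\<lambda>_. r)" "s \<in> carrier R" "s \<otimes> e = s" "y = (\<lambda>_. s)"
      using xy P by auto
    then show ?thesis using e unfolding P Pm_simps by (intro bexI[of _ "r \<oplus> s"]) (auto simp: l_distr)
  qed
  have sm: "a \<odot>\<^bsub>Pm e\<^esub> x \<in> carrier (Pm e)" if ax: "a \<in> carrier R" "x \<in> carrier (Pm e)" for a x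
  proof -
    obtain r where "r \<in> carrier R" "r \<otimes> e = r" "x = (\<lambda>_. r)" using ax P by auto
    then show ?thesis using e ax unfolding P Pm_simps by (intro bexI[of _ "a \<otimes> r"]) (auto simp: m_assoc)
  qed
  show ?thesis
    by (rule left_moduleI[OF ring_axioms _ cl sm _ _ _ neg])
      (use e in \<open>auto simp: P Pm_simps a_ac l_distr r_distr m_assoc intro!: bexI[of _ \<zero>]\<close>)
qed

lemma Pm_generator:
  assumes "e \<in> carrier R" "e \<otimes> e = e"
  shows "(\<lambda>_. e) \<in> carrier (Pm e)" "x \<in> carrier (Pm e) \<Longrightarrow> x = x 0 \<odot>\<^bsub>Pm e\<^esub> (\<lambda>_. e)"
    "x \<in> carrier (Pm e) \<Longrightarrow> x 0 \<in> carrier R"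
  using assms by (auto simp: Pm_carrier[OF assms] Pm_simps)

lemma Pm_fin_generated:
  assumes e: "e \<in> carrier R" "e \<otimes> e = e"
  shows "fin_generated R (Pm e)"
proof -
  interpret P: left_module R "Pm e" by (rule Pm_left_module[OF e])
  note g = Pm_generator[OF e]
  have fs: "(\<Oplus>\<^bsub>Pm e\<^esub>x\<in>{\<lambda>_. e}. c x \<odot>\<^bsub>Pm e\<^esub> x) = c (\<lambda>_. e) \<odot>\<^bsub>Pm e\<^esub> (\<lambda>_. e)"
    if "c (\<lambda>_. e) \<in> carrier R" for c
    using P.smult_closed[OF that g(1)] by simp
  have "carrier (Pm e) = {\<Oplus>\<^bsub>Pm e\<^esub>x\<in>{\<lambda>_. e}. c x \<odot>\<^bsub>Pm e\<^esub> x | c. c \<in> {\<lambda>_. e} \<rightarrow> carrier R}"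
  proof (intro equalityI subsetI)
    fix x assume x: "x \<in> carrier (Pm e)"
    then have "x = (\<Oplus>\<^bsub>Pm e\<^esub>y\<in>{\<lambda>_. e}. (\<lambda>_. x 0) y \<odot>\<^bsub>Pm e\<^esub> y)"
      using fs[of "\<lambda>_. x 0"] g(2,3) by simp
    then show "x \<in> {\<Oplus>\<^bsub>Pm e\<^esub>x\<in>{\<lambda>_. e}. c x \<odot>\<^bsub>Pm e\<^esub> x | c. c \<in> {\<lambda>_. e} \<rightarrow> carrier R}"
      using g(3)[OF x] unfolding mem_Collect_eq by (intro exI[of _ "\<lambda>_. x 0"]) auto
  next
    fix x assume "x \<in> {\<Oplus>\<^bsub>Pm e\<^esub>x\<in>{\<lambda>_. e}. c x \<odot>\<^bsub>Pm e\<^esub> x | c. c \<in> {\<lambda>_. e} \<rightarrow> carrier R}"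
    then show "x \<in> carrier (Pm e)" using fs g(1) P.smult_closed by auto
  qed
  moreover have "finite {\<lambda>_::nat. e}" "{\<lambda>_. e} \<subseteq> carrier (Pm e)" using g(1) by simp_all
  ultimately show ?thesis unfolding fin_generated_def by blast
qed

lemma Pm_mhom:
  assumes e: "e \<in> carrier R" "e \<otimes> e = e" and M: "left_module R M" and m: "m \<in> carrier M"
  shows "(\<lambda>x. x 0 \<odot>\<^bsub>M\<^esub> m) \<in> mhom R (Pm e) M"
proof -
  interpret M: left_module R M by fact
  show ?thesis
    using m Pm_generator(3)[OF e]
    by (intro mhomI) (auto simp: Pm_simps M.smult_closed M.smult_l_distr M.smult_assoc1)
qed

text \<open>It suffices to lift the generator: if p m = f e, then r \<mapsto> r m lifts f, because
  every r in Re satisfies r e = r. The preimage m may be arbitrary.\<close>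

lemma Pm_projective:
  assumes e: "e \<in> carrier R" "e \<otimes> e = e"
  shows "projective R (Pm e)"
  unfolding projective_def
proof (intro allI ballI impI)
  fix M N :: "'a fmod" and p f
  assume p: "p \<in> mhom R M N" and f: "f \<in> mhom R (Pm e) N"
    and *: "left_module R M \<and> left_module R N \<and> p ` carrier M = carrier N"
  note g = Pm_generator[OF e]
  have "f (\<lambda>_. e) \<in> p ` carrier M" using * mhomD(1)[OF f g(1)] by simp
  then obtain m where m: "m \<in> carrier M" "f (\<lambda>_. e) = p m" by auto
  have "p (x 0 \<odot>\<^bsub>M\<^esub> m) = f x" if "x \<in> carrier (Pm e)" for x
    using mhomD(3)[OF p g(3)[OF that] m(1)] mhomD(3)[OF f g(3)[OF that] g(1)] g(2)[OF that] m(2)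
    by simp
  then show "\<exists>g\<in>mhom R (Pm e) M. \<forall>x\<in>carrier (Pm e). p (g x) = f x"
    using Pm_mhom[OF e _ m(1)] * by (intro bexI[of _ "\<lambda>x. x 0 \<odot>\<^bsub>M\<^esub> m"]) auto
qed

lemma Pm_fg_projective: "e \<in> carrier R \<Longrightarrow> e \<otimes> e = e \<Longrightarrow> Pm e \<in> fg_projectives R"
  by (simp add: fg_projectives_def Pm_left_module Pm_fin_generated Pm_projective)

end

text \<open>Extensional functions make homomorphisms that agree on the carrier equal, so that the
  zero vector and the vector space laws are genuine equalities.\<close>

definition hom_space ::
  "('g, 'a) monoid_scheme \<Rightarrow> ('g \<Rightarrow>\<^sub>0 'k::field, 'p) module \<Rightarrow> ('g \<Rightarrow>\<^sub>0 'k, 'm) module \<Rightarrow> ('k, 'p \<Rightarrow> 'm) module" where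
  "hom_space G P M =
     \<lparr>carrier = mhom (group_ring TYPE('k) G) P M \<inter> extensional (carrier P),
      monoid.mult = undefined, one = undefined,
      zero = (\<lambda>x\<in>carrier P. \<zero>\<^bsub>M\<^esub>), add = (\<lambda>f g. \<lambda>x\<in>carrier P. f x \<oplus>\<^bsub>M\<^esub> g x),
      smult = (\<lambda>c f. \<lambda>x\<in>carrier P. Poly_Mapping.single \<one>\<^bsub>G\<^esub> c \<odot>\<^bsub>M\<^esub> f x)\<rparr>"

abbreviation "hom_dim G P M \<equiv> int (vectorspace.dim class_ring (hom_space G P M))"

lemma (in field_space) dim_trivial:
  assumes "carrier V = {\<zero>}"
  shows "dim = 0"
proof -
  have "basis {}" using assms span_empty by (auto simp: basis_def lin_dep_def)
  then show ?thesis using dim_basis[of "{}"] by simp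
qed

context group_algebra
begin

lemma component_dim_eq_0_iff:
  assumes "left_module R M" "e \<in> carrier R" "kfin G M"
  shows "component_dim G e M = 0 \<longleftrightarrow> (\<forall>x\<in>carrier M. e \<odot>\<^bsub>M\<^esub> x = \<zero>\<^bsub>M\<^esub>)"
proof -
  interpret L: left_module R M by fact
  let ?E = "M\<lparr>carrier := (\<lambda>x. e \<odot>\<^bsub>M\<^esub> x) ` carrier M\<rparr>"
  interpret E: field_space "scalar_space G ?E" using component_space assms by blast
  have "component_dim G e M = 0 \<longleftrightarrow> carrier (scalar_space G ?E) = {\<zero>\<^bsub>scalar_space G ?E\<^esub>}"
    using E.dim_zeroD[OF component_space(2)[OF assms]] E.dim_trivial
    unfolding component_dim_def of_nat_eq_0_iff by (rule iffI)
  also have "\<dots> \<longleftrightarrow> (\<lambda>x. e \<odot>\<^bsub>M\<^esub> x) ` carrier M = {\<zero>\<^bsub>M\<^esub>}" by simp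
  also have "\<dots> \<longleftrightarrow> (\<forall>x\<in>carrier M. e \<odot>\<^bsub>M\<^esub> x = \<zero>\<^bsub>M\<^esub>)"
  proof
    assume *: "(\<lambda>x. e \<odot>\<^bsub>M\<^esub> x) ` carrier M = {\<zero>\<^bsub>M\<^esub>}"
    show "\<forall>x\<in>carrier M. e \<odot>\<^bsub>M\<^esub> x = \<zero>\<^bsub>M\<^esub>"
    proof
      fix x assume "x \<in> carrier M"
      then have "e \<odot>\<^bsub>M\<^esub> x \<in> (\<lambda>x. e \<odot>\<^bsub>M\<^esub> x) ` carrier M" by (rule imageI)
      then show "e \<odot>\<^bsub>M\<^esub> x = \<zero>\<^bsub>M\<^esub>" unfolding * by simp
    qed
  qed (auto intro!: image_eqI[OF _ L.M.zero_closed])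
  finally show ?thesis .
qed

lemma hom_space_simps:
  "carrier (hom_space G P M) = mhom R P M \<inter> extensional (carrier P)"
  "\<zero>\<^bsub>hom_space G P M\<^esub> = (\<lambda>x\<in>carrier P. \<zero>\<^bsub>M\<^esub>)"
  "f \<oplus>\<^bsub>hom_space G P M\<^esub> g = (\<lambda>x\<in>carrier P. f x \<oplus>\<^bsub>M\<^esub> g x)"
  "c \<odot>\<^bsub>hom_space G P M\<^esub> f = (\<lambda>x\<in>carrier P. Poly_Mapping.single \<one> c \<odot>\<^bsub>M\<^esub> f x)"
  by (simp_all add: hom_space_def group_ring_def)

lemma hom_space_restrict:
  assumes "left_module R P" "f \<in> mhom R P M"
  shows "restrict f (carrier P) \<in> carrier (hom_space G P M)"
proof -
  interpret P: left_module R P by fact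
  show ?thesis unfolding hom_space_simps using assms(2)
    by (auto intro!: mhomI simp: mhomD[OF assms(2)] P.smult_closed)
qed

lemma hom_space:
  assumes P: "left_module R P" and M: "left_module R M"
  shows "field_space (hom_space G P M)"
proof -
  interpret P: left_module R P by fact
  interpret M: left_module R M by fact
  let ?H = "hom_space G P M"
  have s: "Poly_Mapping.single \<one> c \<in> carrier R" for c :: 'k by (simp add: R_single)
  have hom: "f \<in> mhom R P M" "f x \<in> carrier M" if "f \<in> carrier ?H" "x \<in> carrier P" for f x
    using that mhomD(1) by (auto simp: hom_space_simps)
  have add: "f \<oplus>\<^bsub>?H\<^esub> g \<in> carrier ?H" if fg: "f \<in> carrier ?H" "g \<in> carrier ?H" for f g
  proof -
    have fg': "f \<in> mhom R P M" "g \<in> mhom R P M" using fg by (auto simp: hom_space_simps)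
    have "(\<lambda>x. f x \<oplus>\<^bsub>M\<^esub> g x) \<in> mhom R P M"
      by (rule mhomI) (auto simp: mhomD[OF fg'(1)] mhomD[OF fg'(2)] M.smult_r_distr M.M.a_ac)
    from hom_space_restrict[OF P this] show ?thesis by (simp add: hom_space_simps(3))
  qed
  have smult: "c \<odot>\<^bsub>?H\<^esub> f \<in> carrier ?H" if f: "f \<in> carrier ?H" for c f
  proof -
    have f': "f \<in> mhom R P M" using f by (auto simp: hom_space_simps)
    have "Poly_Mapping.single \<one> c \<odot>\<^bsub>M\<^esub> (a \<odot>\<^bsub>M\<^esub> f x) = a \<odot>\<^bsub>M\<^esub> (Poly_Mapping.single \<one> c \<odot>\<^bsub>M\<^esub> f x)"
      if "a \<in> carrier R" "x \<in> carrier P" for a x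
      using scalar_central[OF that(1), of c] mhomD(1)[OF f' that(2)]
      by (simp add: that(1) s flip: M.smult_assoc1)
    then have "(\<lambda>x. Poly_Mapping.single \<one> c \<odot>\<^bsub>M\<^esub> f x) \<in> mhom R P M"
      by (intro mhomI) (auto simp: mhomD[OF f'] M.smult_r_distr M.smult_closed s)
    from hom_space_restrict[OF P this] show ?thesis by (simp add: hom_space_simps(4))
  qed
  have zero: "\<zero>\<^bsub>?H\<^esub> \<in> carrier ?H"
  proof -
    have "(\<lambda>x. \<zero>\<^bsub>M\<^esub>) \<in> mhom R P M" by (rule mhomI) auto
    from hom_space_restrict[OF P this] show ?thesis by (simp add: hom_space_simps(2))
  qed
  have neg: "\<exists>g\<in>carrier ?H. f \<oplus>\<^bsub>?H\<^esub> g = \<zero>\<^bsub>?H\<^esub>" if f: "f \<in> carrier ?H" for f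
  proof
    show "(-1) \<odot>\<^bsub>?H\<^esub> f \<in> carrier ?H" using f by (rule smult)
    have "f x \<oplus>\<^bsub>M\<^esub> Poly_Mapping.single \<one> (-1) \<odot>\<^bsub>M\<^esub> f x = \<zero>\<^bsub>M\<^esub>" if x: "x \<in> carrier P" for x
    proof -
      have "f x \<oplus>\<^bsub>M\<^esub> Poly_Mapping.single \<one> (-1) \<odot>\<^bsub>M\<^esub> f x =
         (\<one>\<^bsub>R\<^esub> \<oplus>\<^bsub>R\<^esub> Poly_Mapping.single \<one> (-1)) \<odot>\<^bsub>M\<^esub> f x"
        using M.smult_l_distr[OF R.one_closed s hom(2)[OF f x], of "-1"] M.smult_one[OF hom(2)[OF f x]] by simp
      also have "\<one>\<^bsub>R\<^esub> \<oplus>\<^bsub>R\<^esub> Poly_Mapping.single \<one> (-1) = \<zero>\<^bsub>R\<^esub>" by (simp add: R_simps flip: single_add)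
      finally show ?thesis using hom(2)[OF f x] by simp
    qed
    then show "f \<oplus>\<^bsub>?H\<^esub> ((-1) \<odot>\<^bsub>?H\<^esub> f) = \<zero>\<^bsub>?H\<^esub>"
      by (auto simp: hom_space_simps)
  qed
  have ext: "f = g" if "f \<in> carrier ?H" "g \<in> carrier ?H" "\<And>x. x \<in> carrier P \<Longrightarrow> f x = g x" for f g
    using that by (intro extensionalityI[of _ "carrier P"]) (auto simp: hom_space_simps)
  have a: "Poly_Mapping.single \<one> (c + d) = Poly_Mapping.single \<one> c \<oplus>\<^bsub>R\<^esub> (Poly_Mapping.single \<one> d :: 'g \<Rightarrow>\<^sub>0 'k)"
    for c d by (simp add: R_simps single_add)
  have m: "Poly_Mapping.single \<one> (c * d) = Poly_Mapping.single \<one> c \<otimes>\<^bsub>R\<^esub> (Poly_Mapping.single \<one> d :: 'g \<Rightarrow>\<^sub>0 'k)"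
    for c d by (simp add: R_mult_single)
  note hs = hom_space_simps(2-4)
  show ?thesis unfolding field_space_def
  proof (rule vs_criteria)
    show "\<forall>v w. v \<in> carrier ?H \<and> w \<in> carrier ?H \<longrightarrow> v \<oplus>\<^bsub>?H\<^esub> w = w \<oplus>\<^bsub>?H\<^esub> v"
      using hom(2) by (auto simp: hs M.M.a_comm intro!: restrict_ext)
    show "\<forall>v w x. v \<in> carrier ?H \<and> w \<in> carrier ?H \<and> x \<in> carrier ?H \<longrightarrow>
        v \<oplus>\<^bsub>?H\<^esub> w \<oplus>\<^bsub>?H\<^esub> x = v \<oplus>\<^bsub>?H\<^esub> (w \<oplus>\<^bsub>?H\<^esub> x)"
      using hom(2) by (auto simp: hs M.M.a_assoc intro!: restrict_ext)
    show "\<forall>v\<in>carrier ?H. v \<oplus>\<^bsub>?H\<^esub> \<zero>\<^bsub>?H\<^esub> = v"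
      using hom(2) by (auto intro!: ext add zero) (auto simp: hs)
    show "\<forall>a b v. a \<in> carrier class_ring \<and> b \<in> carrier class_ring \<and> v \<in> carrier ?H \<longrightarrow>
        (a \<otimes>\<^bsub>class_ring\<^esub> b) \<odot>\<^bsub>?H\<^esub> v = a \<odot>\<^bsub>?H\<^esub> (b \<odot>\<^bsub>?H\<^esub> v)"
      using hom(2) by (auto simp: hs m class_ring_simps M.smult_assoc1 s intro!: restrict_ext)
    show "\<forall>v\<in>carrier ?H. \<one>\<^bsub>class_ring\<^esub> \<odot>\<^bsub>?H\<^esub> v = v"
      using hom(2) by (auto intro!: ext smult) (auto simp: hs class_ring_simps M.smult_one[unfolded R_simps])
    show "\<forall>a b v. a \<in> carrier class_ring \<and> b \<in> carrier class_ring \<and> v \<in> carrier ?H \<longrightarrow>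
        (a \<oplus>\<^bsub>class_ring\<^esub> b) \<odot>\<^bsub>?H\<^esub> v = a \<odot>\<^bsub>?H\<^esub> v \<oplus>\<^bsub>?H\<^esub> b \<odot>\<^bsub>?H\<^esub> v"
      using hom(2) by (auto simp: hs a class_ring_simps M.smult_l_distr s intro!: restrict_ext)
    show "\<forall>a v w. a \<in> carrier class_ring \<and> v \<in> carrier ?H \<and> w \<in> carrier ?H \<longrightarrow>
        a \<odot>\<^bsub>?H\<^esub> (v \<oplus>\<^bsub>?H\<^esub> w) = a \<odot>\<^bsub>?H\<^esub> v \<oplus>\<^bsub>?H\<^esub> a \<odot>\<^bsub>?H\<^esub> w"
      using hom(2) by (auto simp: hs M.smult_r_distr s intro!: restrict_ext)
  qed (use add smult zero neg class_field in auto)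
qed

text \<open>A homomorphism is determined by its values on finitely many generators, and these values
  are separated by finitely many functionals on M. The pairs of a generator and a functional thus
  separate the points of Hom(P, M).\<close>

lemma hom_space_fin_dim:
  assumes P: "left_module R P" "fin_generated R P" and M: "left_module R M" "kfin G M"
  shows "vectorspace.fin_dim class_ring (hom_space G P M)"
proof -
  interpret P: left_module R P by fact
  interpret M: left_module R M by fact
  interpret S: field_space "scalar_space G M" using M(1) by (rule scalar_space)
  interpret H: field_space "hom_space G P M" by (rule hom_space[OF P(1) M(1)])
  obtain J :: "'c set" and h where h: "finite J" "\<forall>j\<in>J. linear_functional (scalar_space G M) (h j)"
     "\<forall>v\<in>carrier M. (\<forall>j\<in>J. h j v = 0) \<longrightarrow> v = \<zero>\<^bsub>M\<^esub>"
    using S.separating_functionals[OF M(2)] by auto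
  obtain A where A: "finite A" "A \<subseteq> carrier P"
    "carrier P = {\<Oplus>\<^bsub>P\<^esub>x\<in>A. c x \<odot>\<^bsub>P\<^esub> x | c. c \<in> A \<rightarrow> carrier R}"
    using P(2) by (auto simp: fin_generated_def)
  show ?thesis
  proof (rule H.fin_dim_if_separated[of "A \<times> J" "\<lambda>(a, j) f. h j (f a)"])
    show "finite (A \<times> J)" using A h by simp
    show "linear_functional (hom_space G P M) ((\<lambda>(a, j) f. h j (f a)) i)" if iAJ: "i \<in> A \<times> J" for i
    proof -
      obtain a j where i: "i = (a, j)" "a \<in> carrier P" "j \<in> J" using iAJ A(2) by blast
      have "f a \<in> carrier M" if "f \<in> carrier (hom_space G P M)" for f
        using that i mhomD(1) by (auto simp: hom_space_simps(1))
      then show ?thesis using h(2) i unfolding linear_functional_def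
        by (auto simp: hom_space_simps(3,4))
    qed
    fix f assume f: "f \<in> carrier (hom_space G P M)" "\<forall>i\<in>A \<times> J. (\<lambda>(a, j) f. h j (f a)) i f = 0"
    have f': "f \<in> mhom R P M" "f \<in> extensional (carrier P)" using f by (auto simp: hom_space_simps)
    have fa: "f a = \<zero>\<^bsub>M\<^esub>" if "a \<in> A" for a
    proof -
      have "f a \<in> carrier M" using mhomD(1)[OF f'(1)] A(2) that by blast
      then show ?thesis using f(2) h(3) that by auto
    qed
    have "f x = \<zero>\<^bsub>M\<^esub>" if "x \<in> carrier P" for x
    proof -
      obtain c where c: "c \<in> A \<rightarrow> carrier R" "x = (\<Oplus>\<^bsub>P\<^esub>x\<in>A. c x \<odot>\<^bsub>P\<^esub> x)" using \<open>x \<in> carrier P\<close> A(3) by auto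
      have "f x = (\<Oplus>\<^bsub>M\<^esub>a\<in>A. f (c a \<odot>\<^bsub>P\<^esub> a))" unfolding c(2)
        using c(1) A(2) by (intro mhom_finsum[OF P(1) M(1) f'(1)]) (auto intro!: P.smult_closed)
      also have "\<dots> = (\<Oplus>\<^bsub>M\<^esub>a\<in>A. \<zero>\<^bsub>M\<^esub>)"
        using c(1) A(2) fa by (intro M.M.finsum_cong') (auto simp: mhomD(3)[OF f'(1)] Pi_iff subset_iff)
      finally show ?thesis by simp
    qed
    then show "f = \<zero>\<^bsub>hom_space G P M\<^esub>" using f'(2) unfolding hom_space_simps
      by (auto intro!: extensionalityI[of _ "carrier P"])
  qed
qed

text \<open>Hom(-, M) is left exact. It is exact on the right as well here, because the projective
  P'' splits the sequence and homomorphisms on P' extend to P.\<close>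

lemma hom_dim_exact:
  fixes P' P P'' :: "('g \<Rightarrow>\<^sub>0 'k) fmod"
  assumes P: "P' \<in> fg_projectives R" "P \<in> fg_projectives R" "P'' \<in> fg_projectives R"
    and ex: "short_exact R P' P P''" and M: "left_module R M" "kfin G M"
  shows "hom_dim G P M = hom_dim G P' M + hom_dim G P'' M"
proof -
  have LP: "left_module R P'" "left_module R P" "left_module R P''" "projective R P''" "fin_generated R P"
    using P by (auto simp: fg_projectives_def)
  interpret P': left_module R P' by fact
  interpret P: left_module R P by fact
  interpret P'': left_module R P'' by fact
  interpret M: left_module R M by fact
  obtain i p where ip: "i \<in> mhom R P' P" "p \<in> mhom R P P''" "inj_on i (carrier P')"
    "i ` carrier P' = {x \<in> carrier P. p x = \<zero>\<^bsub>P''\<^esub>}" "p ` carrier P = carrier P''"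
    using ex unfolding short_exact_def by blast
  \<comment> \<open>Lifting the identity of P'' along \<open>p\<close> yields a section of
    \<open>p\<close>.\<close>
  have id: "(\<lambda>x. x) \<in> mhom R P'' P''" by (rule mhomI) auto
  have "\<exists>s\<in>mhom R P'' P. \<forall>x\<in>carrier P''. p (s x) = x"
    by (rule LP(4)[unfolded projective_def, rule_format, OF ip(2) id]) (simp add: LP ip(5))
  then obtain s where s: "s \<in> mhom R P'' P" "\<forall>x\<in>carrier P''. p (s x) = x" by (rule bexE)
  let ?H = "\<lambda>P. hom_space G P M"
  let ?\<alpha> = "\<lambda>f. \<lambda>x\<in>carrier P. f (p x)" and ?\<beta> = "\<lambda>f. \<lambda>x\<in>carrier P'. f (i x)"
  have pi0: "p (i x) = \<zero>\<^bsub>P''\<^esub>" if "x \<in> carrier P'" for x using ip(4) that by blast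
  have \<alpha>: "?\<alpha> f \<in> carrier (?H P)" if "f \<in> carrier (?H P'')" for f
    using that by (intro hom_space_restrict[OF LP(2)] mhom_comp[OF ip(2)]) (simp add: hom_space_simps)
  have \<beta>: "?\<beta> f \<in> carrier (?H P')" if "f \<in> carrier (?H P)" for f
    using that by (intro hom_space_restrict[OF LP(1)] mhom_comp[OF ip(1)]) (simp add: hom_space_simps)
  have "vectorspace.dim class_ring (?H P) = vectorspace.dim class_ring (?H P'') + vectorspace.dim class_ring (?H P')"
  proof (rule dim_short_exact(1))
    show "?\<alpha> \<in> mhom class_ring (?H P'') (?H P)"
      by (rule mhomI) (use \<alpha> in \<open>auto simp: hom_space_simps(3,4) mhomD(1)[OF ip(2)] intro!: restrict_ext\<close>)
    show "?\<beta> \<in> mhom class_ring (?H P) (?H P')"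
      by (rule mhomI) (use \<beta> in \<open>auto simp: hom_space_simps(3,4) mhomD(1)[OF ip(1)] intro!: restrict_ext\<close>)
    show "inj_on ?\<alpha> (carrier (?H P''))"
    proof (rule inj_onI)
      fix f g assume fg: "f \<in> carrier (?H P'')" "g \<in> carrier (?H P'')" "?\<alpha> f = ?\<alpha> g"
      have "f y = g y" if y: "y \<in> carrier P''" for y
      proof -
        obtain x where "x \<in> carrier P" "y = p x" using y ip(5) by auto
        then show ?thesis using fun_cong[OF fg(3), of x] by simp
      qed
      then show "f = g" using fg(1,2)
        by (intro extensionalityI[of _ "carrier P''"]) (auto simp: hom_space_simps(1))
    qed
    show "?\<alpha> ` carrier (?H P'') = {f \<in> carrier (?H P). ?\<beta> f = \<zero>\<^bsub>?H P'\<^esub>}"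
    proof (intro equalityI subsetI)
      fix f assume "f \<in> ?\<alpha> ` carrier (?H P'')"
      then obtain g where g: "g \<in> carrier (?H P'')" "f = ?\<alpha> g" by auto
      then have "g \<zero>\<^bsub>P''\<^esub> = \<zero>\<^bsub>M\<^esub>" using mhom_zero[OF LP(3) M(1)] by (auto simp: hom_space_simps(1))
      then have "?\<beta> f = \<zero>\<^bsub>?H P'\<^esub>" unfolding g(2) hom_space_simps(2)
        using mhomD(1)[OF ip(1)] by (intro restrict_ext) (simp add: pi0)
      then show "f \<in> {f \<in> carrier (?H P). ?\<beta> f = \<zero>\<^bsub>?H P'\<^esub>}" using \<alpha>[OF g(1)] g(2) by simp
    next
      fix f assume f: "f \<in> {f \<in> carrier (?H P). ?\<beta> f = \<zero>\<^bsub>?H P'\<^esub>}"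
      then have f': "f \<in> mhom R P M" "f \<in> extensional (carrier P)" by (auto simp: hom_space_simps(1))
      have ker: "f x = \<zero>\<^bsub>M\<^esub>" if x: "x \<in> carrier P" "p x = \<zero>\<^bsub>P''\<^esub>" for x
      proof -
        have "x \<in> i ` carrier P'" using x ip(4) by simp
        then obtain y where y: "y \<in> carrier P'" "x = i y" by auto
        have "?\<beta> f y = (\<lambda>x\<in>carrier P'. \<zero>\<^bsub>M\<^esub>) y" using f by (simp add: hom_space_simps(2))
        then show ?thesis using y by simp
      qed
      obtain g where g: "g \<in> mhom R P'' M" "\<forall>x\<in>carrier P. g (p x) = f x"
        using mhom_factor[OF LP(2,3) M(1) ip(2,5) f'(1) ker] by blast
      have "f = ?\<alpha> (restrict g (carrier P''))"
        using g(2) f'(2) mhomD(1)[OF ip(2)] by (intro extensionalityI[of _ "carrier P"]) auto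
      then show "f \<in> ?\<alpha> ` carrier (?H P'')" using hom_space_restrict[OF LP(3) g(1)] by blast
    qed
    show "?\<beta> ` carrier (?H P) = carrier (?H P')"
    proof (intro equalityI subsetI)
      fix f assume "f \<in> carrier (?H P')"
      then have f: "f \<in> mhom R P' M" "f \<in> extensional (carrier P')" by (auto simp: hom_space_simps(1))
      \<comment> \<open>\<open>q\<close> projects P onto the kernel of \<open>p\<close>, which is
        the image of \<open>i\<close>. Followed by the inverse of \<open>i\<close> it is a
        retraction of P onto P', and composing \<open>f\<close> with it extends
        \<open>f\<close>.\<close>
      define q where "q x = x \<ominus>\<^bsub>P\<^esub> s (p x)" for x
      have sp: "s (p x) \<in> carrier P" if "x \<in> carrier P" for x
        using that mhomD(1)[OF s(1)] mhomD(1)[OF ip(2)] by blast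
      have q: "q \<in> mhom R P P"
      proof (rule mhomI)
        show "q x \<in> carrier P" if "x \<in> carrier P" for x using that sp by (simp add: q_def)
        show "q (x \<oplus>\<^bsub>P\<^esub> y) = q x \<oplus>\<^bsub>P\<^esub> q y" if "x \<in> carrier P" "y \<in> carrier P" for x y
          using that sp by (simp add: q_def mhomD(1,2)[OF s(1)] mhomD(1,2)[OF ip(2)]
              a_minus_def P.M.minus_add P.M.a_ac)
        show "q (a \<odot>\<^bsub>P\<^esub> x) = a \<odot>\<^bsub>P\<^esub> q x" if "a \<in> carrier R" "x \<in> carrier P" for a x
        proof -
          have "(\<lambda>x. a \<odot>\<^bsub>P\<^esub> x) (x \<oplus>\<^bsub>P\<^esub> (\<ominus>\<^bsub>R\<^esub> \<one>\<^bsub>R\<^esub>) \<odot>\<^bsub>P\<^esub> s (p x)) =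
            a \<odot>\<^bsub>P\<^esub> x \<oplus>\<^bsub>P\<^esub> (\<ominus>\<^bsub>R\<^esub> \<one>\<^bsub>R\<^esub>) \<odot>\<^bsub>P\<^esub> (a \<odot>\<^bsub>P\<^esub> s (p x))"
            using that sp[OF that(2)]
            by (simp add: P.smult_r_distr P.smult_closed R.l_minus R.r_minus flip: P.smult_assoc1)
          then show ?thesis using that sp[OF that(2)] P.smult_closed
            by (simp add: q_def a_minus_def P.smult_minus_one mhomD[OF s(1)] mhomD[OF ip(2)])
        qed
      qed
      have qi: "q x \<in> i ` carrier P'" if x: "x \<in> carrier P" for x
      proof -
        have "p (q x) = p x \<ominus>\<^bsub>P''\<^esub> p (s (p x))" unfolding q_def
          by (rule mhom_minus[OF LP(2,3) ip(2) x sp[OF x]])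
        also have "\<dots> = \<zero>\<^bsub>P''\<^esub>" using s(2) mhomD(1)[OF ip(2) x] by (simp add: P''.M.minus_other_side)
        finally show ?thesis using ip(4) mhomD(1)[OF q x] by simp
      qed
      define r where "r x = inv_into (carrier P') i (q x)" for x
      have r: "r x \<in> carrier P'" "i (r x) = q x" if "x \<in> carrier P" for x
        using qi[OF that] by (auto simp: r_def inv_into_into f_inv_into_f)
      have ri: "r (i x) = x" if x: "x \<in> carrier P'" for x
      proof -
        have "q (i x) = i x" using pi0[OF x] mhom_zero[OF LP(3,2) s(1)] mhomD(1)[OF ip(1) x]
          by (simp add: q_def a_minus_def)
        then show ?thesis using x ip(3) by (simp add: r_def)
      qed
      have "r \<in> mhom R P P'"
      proof (rule mhomI)
        show "r (x \<oplus>\<^bsub>P\<^esub> y) = r x \<oplus>\<^bsub>P'\<^esub> r y" if "x \<in> carrier P" "y \<in> carrier P" for x y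
          by (rule inj_onD[OF ip(3)]) (use r that in \<open>auto simp: mhomD[OF ip(1)] mhomD[OF q]\<close>)
        show "r (a \<odot>\<^bsub>P\<^esub> x) = a \<odot>\<^bsub>P'\<^esub> r x" if "a \<in> carrier R" "x \<in> carrier P" for a x
          by (rule inj_onD[OF ip(3)]) (use r that in \<open>auto simp: mhomD[OF ip(1)] mhomD[OF q] P.smult_closed P'.smult_closed\<close>)
      qed (use r in auto)
      then have "restrict (\<lambda>x. f (r x)) (carrier P) \<in> carrier (?H P)"
        by (intro hom_space_restrict[OF LP(2)] mhom_comp[OF _ f(1)])
      moreover have "f = ?\<beta> (restrict (\<lambda>x. f (r x)) (carrier P))"
        using f(2) ri mhomD(1)[OF ip(1)] by (intro extensionalityI[of _ "carrier P'"]) auto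
      ultimately show "f \<in> ?\<beta> ` carrier (?H P)" by blast
    qed (use \<beta> in auto)
  qed (use hom_space hom_space_fin_dim LP M in auto)
  then show ?thesis by simp
qed

text \<open>Evaluation at the generator identifies Hom(Re, M) with eM: f(e) = e f(e) determines f,
  and r \<mapsto> r m takes the value e m there.\<close>

lemma hom_dim_principal:
  assumes e: "e \<in> carrier R" "e \<otimes>\<^bsub>R\<^esub> e = e" and M: "left_module R M" "kfin G M"
  shows "hom_dim G (R.Pm e) M = component_dim G e M"
proof -
  interpret M: left_module R M by fact
  let ?P = "R.Pm e" and ?E = "M\<lparr>carrier := (\<lambda>x. e \<odot>\<^bsub>M\<^esub> x) ` carrier M\<rparr>"
  let ?T = "\<lambda>f. f (\<lambda>_. e)"
  note P = R.Pm_left_module[OF e] R.Pm_fin_generated[OF e] and g = R.Pm_generator[OF e]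
  interpret H: field_space "hom_space G ?P M" by (rule hom_space[OF P(1) M(1)])
  interpret E: field_space "scalar_space G ?E" by (rule component_space(1)[OF M(1) e(1) M(2)])
  have ge: "(\<lambda>_. e) = e \<odot>\<^bsub>?P\<^esub> (\<lambda>_. e)" using e(2) by (simp add: R.Pm_simps)
  have T: "?T f \<in> carrier ?E" if "f \<in> carrier (hom_space G ?P M)" for f
  proof -
    have f: "f \<in> mhom R ?P M" using that by (simp add: hom_space_simps(1))
    have "?T f = e \<odot>\<^bsub>M\<^esub> ?T f" using mhomD(3)[OF f e(1) g(1)] ge by simp
    then show ?thesis using mhomD(1)[OF f g(1)] by auto
  qed
  interpret T: linear_map class_ring "hom_space G ?P M" "scalar_space G ?E" ?T
    by unfold_locales (rule mhomI, use T in \<open>auto simp: hom_space_simps(3,4) g(1)\<close>)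
  have inj: "inj_on ?T (carrier (hom_space G ?P M))"
  proof (rule inj_onI)
    fix f h assume fh: "f \<in> carrier (hom_space G ?P M)" "h \<in> carrier (hom_space G ?P M)" "?T f = ?T h"
    then have fh': "f \<in> mhom R ?P M" "h \<in> mhom R ?P M" by (auto simp: hom_space_simps(1))
    have "f x = h x" if "x \<in> carrier ?P" for x
      using mhomD(3)[OF fh'(1) g(3)[OF that] g(1)] mhomD(3)[OF fh'(2) g(3)[OF that] g(1)] fh(3) g(2)[OF that]
      by simp
    then show "f = h" using fh(1,2)
      by (intro extensionalityI[of _ "carrier ?P"]) (auto simp: hom_space_simps(1))
  qed
  have surj: "?T ` carrier (hom_space G ?P M) = carrier (scalar_space G ?E)"
  proof (intro equalityI subsetI)
    fix y assume "y \<in> carrier (scalar_space G ?E)"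
    then obtain m where m: "m \<in> carrier M" "y = e \<odot>\<^bsub>M\<^esub> m" by auto
    let ?f = "restrict (\<lambda>x. x 0 \<odot>\<^bsub>M\<^esub> m) (carrier ?P)"
    have "?f \<in> carrier (hom_space G ?P M)"
      by (rule hom_space_restrict[OF P(1) R.Pm_mhom[OF e M(1) m(1)]])
    moreover have "?T ?f = y" using m g(1) by simp
    ultimately show "y \<in> ?T ` carrier (hom_space G ?P M)" by blast
  qed (use T in auto)
  have "H.dim = E.dim"
    using hom_space_fin_dim[OF P M] inj surj by (intro T.dim_eq) auto
  then show ?thesis by (simp add: component_dim_def)
qed

end

section \<open>Simple modules over the group ring of a finite group\<close>

definition simple_module :: "('r, 'a) ring_scheme \<Rightarrow> ('r, 'm, 'b) module_scheme \<Rightarrow> bool" where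
  "simple_module R S \<longleftrightarrow> left_module R S \<and> carrier S \<noteq> {\<zero>\<^bsub>S\<^esub>} \<and>
     (\<forall>N. left_submodule R N S \<longrightarrow> N = {\<zero>\<^bsub>S\<^esub>} \<or> N = carrier S)"

definition module_iso :: "('r, 'a) ring_scheme \<Rightarrow> ('r, 'm, 'b) module_scheme \<Rightarrow> ('r, 'n, 'c) module_scheme \<Rightarrow> bool" where
  "module_iso R M N \<longleftrightarrow> (\<exists>f\<in>mhom R M N. bij_betw f (carrier M) (carrier N))"

lemma module_iso_refl: "module_iso R M M"
  unfolding module_iso_def by (intro bexI[of _ "\<lambda>x. x"] mhomI) (auto simp: bij_betw_def)

lemma module_iso_sym: "left_module R M \<Longrightarrow> module_iso R M N \<Longrightarrow> module_iso R N M"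
  unfolding module_iso_def using mhom_inverse bij_betw_inv_into by metis

lemma module_iso_trans:
  assumes "module_iso R M N" "module_iso R N L"
  shows "module_iso R M L"
proof -
  obtain f g where "f \<in> mhom R M N" "bij_betw f (carrier M) (carrier N)"
    "g \<in> mhom R N L" "bij_betw g (carrier N) (carrier L)"
    using assms by (auto simp: module_iso_def)
  then show ?thesis unfolding module_iso_def
    using mhom_comp[of f R M N g L] bij_betw_trans[of f _ _ g]
    by (intro bexI[of _ "\<lambda>x. g (f x)"]) (auto simp: comp_def)
qed

text \<open>Kernel and image are submodules, and a nonzero map between simple modules leaves only
  the zero kernel and the full image.\<close>

lemma schur:
  assumes S: "simple_module R S" and T: "simple_module R T"
    and f: "f \<in> mhom R S T" "x \<in> carrier S" "f x \<noteq> \<zero>\<^bsub>T\<^esub>"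
  shows "bij_betw f (carrier S) (carrier T)"
proof -
  have L: "left_module R S" "left_module R T" using S T by (auto simp: simple_module_def)
  interpret S: left_module R S by fact
  interpret T: left_module R T by fact
  have "{x \<in> carrier S. f x = \<zero>\<^bsub>T\<^esub>} \<noteq> carrier S" using f by auto
  then have ker: "{x \<in> carrier S. f x = \<zero>\<^bsub>T\<^esub>} = {\<zero>\<^bsub>S\<^esub>}"
    using S mhom_kernel_submodule[OF L f(1)] by (auto simp: simple_module_def)
  have "f x \<in> f ` carrier S" using f(2) by simp
  then have "f ` carrier S \<noteq> {\<zero>\<^bsub>T\<^esub>}" using f(3) by auto
  then have im: "f ` carrier S = carrier T"
    using T mhom_image_submodule[OF L f(1) S.left_submodule_self] by (auto simp: simple_module_def)
  have "inj_on f (carrier S)"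
  proof (rule inj_onI)
    fix y z assume yz: "y \<in> carrier S" "z \<in> carrier S" "f y = f z"
    then have "f (y \<ominus>\<^bsub>S\<^esub> z) = \<zero>\<^bsub>T\<^esub>" using mhom_eq_iff[OF L f(1)] by blast
    then have "y \<ominus>\<^bsub>S\<^esub> z \<in> {x \<in> carrier S. f x = \<zero>\<^bsub>T\<^esub>}" using yz by simp
    then have "y \<ominus>\<^bsub>S\<^esub> z = \<zero>\<^bsub>S\<^esub>" unfolding ker by simp
    then show "y = z" using yz S.M.minus_other_side by blast
  qed
  with im show ?thesis by (simp add: bij_betw_def)
qed

lemma groth_relators_quotient: "frag_quotient S (groth_relators R S)"
proof
  show "groth_relators R S \<subseteq> carrier (free_Abelian_group S)"
    unfolding groth_relators_def using keys_relator[of _ S] by auto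
qed

text \<open>An isomorphism is a short exact sequence M, L, Z with a zero module Z at the end, and
  the sequence Z, Z, Z gives [Z] = 0.\<close>

lemma groth_iso:
  assumes "M \<in> S" "L \<in> S" "left_module R M" "left_module R L" "module_iso R M L"
    and Z: "Z \<in> S" "left_module R Z" "carrier Z = {\<zero>\<^bsub>Z\<^esub>}"
  shows "frag_of M - frag_of L \<in> groth_subgroup R S"
proof -
  interpret frag_quotient S "groth_relators R S" by (rule groth_relators_quotient)
  interpret M: left_module R M by fact
  interpret L: left_module R L by fact
  interpret Z: left_module R Z by fact
  obtain f where f: "f \<in> mhom R M L" "bij_betw f (carrier M) (carrier L)"
    using assms(5) by (auto simp: module_iso_def)
  have z: "(\<lambda>_. \<zero>\<^bsub>L\<^esub>) \<in> mhom R Z L" "(\<lambda>x. x) \<in> mhom R Z Z"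
    by (auto intro!: mhomI)
  have zz: "(\<lambda>_. \<zero>\<^bsub>Z\<^esub>) \<in> mhom R L Z" by (auto intro!: mhomI)
  have "short_exact R M L Z" unfolding short_exact_def
    using f zz Z(3) by (intro bexI[of _ f] bexI[of _ "\<lambda>_. \<zero>\<^bsub>Z\<^esub>"]) (auto simp: bij_betw_def)
  then have 1: "frag_of L - (frag_of M + frag_of Z) \<in> N"
    using assms by (intro N_Rel) (auto simp: groth_relators_def)
  have "short_exact R Z Z Z" unfolding short_exact_def
    using z Z(3) by (intro bexI[of _ "\<lambda>x. x"]) auto
  then have 2: "frag_of Z - (frag_of Z + frag_of Z) \<in> N"
    using Z by (intro N_Rel) (unfold groth_relators_def, blast)
  from N_diff[OF 2 1] show ?thesis unfolding groth_subgroup_def by simp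
qed

section \<open>Maschke's theorem\<close>

locale finite_group_algebra = group_algebra G k
  for G :: "('g, 'a) monoid_scheme" (structure) and k :: "'k::field_char_0 itself" +
  assumes finite_carrier: "finite (carrier G)"
begin

lemma single_factor: "x \<in> carrier G \<Longrightarrow>
    Poly_Mapping.single x c = Poly_Mapping.single \<one> c \<otimes>\<^bsub>R\<^esub> Poly_Mapping.single x (1 :: 'k)"
  by (simp add: R_mult_single)

text \<open>The finitely many translates of the generators by group elements span M over K.\<close>

lemma fin_generated_kfin:
  assumes "left_module R M" "fin_generated R M"
  shows "kfin G M"
proof -
  interpret L: left_module R M by fact
  interpret V: field_space "scalar_space G M" using assms(1) by (rule scalar_space)
  obtain A where A: "finite A" "A \<subseteq> carrier M"
    "carrier M = {\<Oplus>\<^bsub>M\<^esub>x\<in>A. c x \<odot>\<^bsub>M\<^esub> x | c. c \<in> A \<rightarrow> carrier R}"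
    using assms(2) by (auto simp: fin_generated_def)
  define B where "B = (\<lambda>(h, a). Poly_Mapping.single h 1 \<odot>\<^bsub>M\<^esub> a) ` (carrier G \<times> A)"
  have B: "finite B" "B \<subseteq> carrier M"
    unfolding B_def using A(1,2) finite_carrier by (auto intro!: L.smult_closed R_single)
  have "submodule class_ring (V.span B) (scalar_space G M)"
    using B by (intro V.span_is_submodule) simp
  then have sp: "x \<in> V.span B \<Longrightarrow> y \<in> V.span B \<Longrightarrow> x \<oplus>\<^bsub>M\<^esub> y \<in> V.span B" "\<zero>\<^bsub>M\<^esub> \<in> V.span B"
    "x \<in> V.span B \<Longrightarrow> Poly_Mapping.single \<one> c \<odot>\<^bsub>M\<^esub> x \<in> V.span B" for x y c
    unfolding submodule_def by (auto simp: class_ring_simps)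
  have gen: "c \<in> carrier R \<and> c \<odot>\<^bsub>M\<^esub> a \<in> V.span B" if a: "a \<in> A" and c: "c \<in> carrier R" for a c
    using c
  proof (induction rule: R_induct)
    case zero
    have "\<zero>\<^bsub>R\<^esub> \<odot>\<^bsub>M\<^esub> a = \<zero>\<^bsub>M\<^esub>" using a A(2) by (intro L.smult_l_null) auto
    then show ?case using sp(2) R.zero_closed by (simp add: R_simps(3))
  next
    case (single x t)
    have "Poly_Mapping.single x 1 \<odot>\<^bsub>M\<^esub> a \<in> B" using single a by (auto simp: B_def)
    then have "Poly_Mapping.single x 1 \<odot>\<^bsub>M\<^esub> a \<in> V.span B" using V.in_own_span[of B] B(2) by auto
    from sp(3)[OF this, of t] show ?case using single a A(2)
      by (subst (2) single_factor) (auto simp: L.smult_assoc1 R_single)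
  next
    case (add f g)
    then have "(f \<oplus>\<^bsub>R\<^esub> g) \<odot>\<^bsub>M\<^esub> a = f \<odot>\<^bsub>M\<^esub> a \<oplus>\<^bsub>M\<^esub> g \<odot>\<^bsub>M\<^esub> a"
      using a A(2) by (intro L.smult_l_distr) auto
    then show ?case using add sp(1) R_add by (simp add: R_simps(4))
  qed
  have fs: "(\<Oplus>\<^bsub>M\<^esub>x\<in>F. c x \<odot>\<^bsub>M\<^esub> x) \<in> V.span B" if "finite F" "F \<subseteq> A" "c \<in> A \<rightarrow> carrier R" for F c
    using that
  proof (induction F rule: finite_induct)
    case empty
    then show ?case using sp(2) by simp
  next
    case (insert x F)
    have "(\<Oplus>\<^bsub>M\<^esub>x\<in>insert x F. c x \<odot>\<^bsub>M\<^esub> x) = c x \<odot>\<^bsub>M\<^esub> x \<oplus>\<^bsub>M\<^esub> (\<Oplus>\<^bsub>M\<^esub>x\<in>F. c x \<odot>\<^bsub>M\<^esub> x)"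
      using insert A(2) by (intro L.M.finsum_insert) (auto intro!: L.smult_closed)
    then show ?case using insert gen sp(1) by (auto simp: Pi_iff)
  qed
  have "carrier M \<subseteq> V.span B"
  proof
    fix x assume "x \<in> carrier M"
    then obtain c where "c \<in> A \<rightarrow> carrier R" "x = (\<Oplus>\<^bsub>M\<^esub>x\<in>A. c x \<odot>\<^bsub>M\<^esub> x)"
      by (subst (asm) A(3)) auto
    then show "x \<in> V.span B" using fs[OF A(1)] by simp
  qed
  moreover have "V.span B \<subseteq> carrier M" using V.span_is_subset2[of B] B(2) by simp
  ultimately show ?thesis unfolding V.fin_dim_def using B by (intro exI[of _ B]) auto
qed

text \<open>Repeated addition as multiplication by a scalar, the form in which the group order
  cancels when a projection is averaged.\<close>

lemma finsum_const:
  assumes "left_module R M" "finite A" "x \<in> carrier M"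
  shows "(\<Oplus>\<^bsub>M\<^esub>i\<in>A. x) = Poly_Mapping.single \<one> (of_nat (card A)) \<odot>\<^bsub>M\<^esub> x"
  using assms(2)
proof (induction A rule: finite_induct)
  interpret L: left_module R M by fact
  case empty
  then show ?case using L.smult_l_null[OF assms(3)] by (simp add: R_simps)
next
  interpret L: left_module R M by fact
  case (insert i A)
  have "Poly_Mapping.single \<one> (of_nat (card (insert i A)) :: 'k) =
      \<one>\<^bsub>R\<^esub> \<oplus>\<^bsub>R\<^esub> Poly_Mapping.single \<one> (of_nat (card A))"
    using insert by (simp add: R_simps single_add)
  then have "Poly_Mapping.single \<one> (of_nat (card (insert i A))) \<odot>\<^bsub>M\<^esub> x =
    x \<oplus>\<^bsub>M\<^esub> Poly_Mapping.single \<one> (of_nat (card A)) \<odot>\<^bsub>M\<^esub> x"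
    using L.smult_l_distr[OF R.one_closed R_single[OF one_closed] assms(3)] L.smult_one[OF assms(3)] by simp
  then show ?case using insert assms(3) by simp
qed

text \<open>The mean of the conjugates g p g^-1 of a K-linear projection \<open>p\<close> onto N
  commutes with the group, still has values in N and is still the identity on N.\<close>

lemma maschke:
  assumes M: "left_module R M" "kfin G M" and N: "left_submodule R N M"
  shows "\<exists>\<pi>\<in>mhom R M M. \<pi> ` carrier M = N \<and> (\<forall>x\<in>N. \<pi> x = x)"
proof -
  interpret L: left_module R M by fact
  interpret V: field_space "scalar_space G M" using M(1) by (rule scalar_space)
  interpret N: left_module R "M\<lparr>carrier := N\<rparr>" by (rule L.left_submodule_module[OF N])
  have NM: "x \<in> N \<Longrightarrow> x \<in> carrier M" for x using N by (auto simp: left_submodule_def)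
  have Nsm: "a \<in> carrier R \<Longrightarrow> x \<in> N \<Longrightarrow> a \<odot>\<^bsub>M\<^esub> x \<in> N" for a x using N by (auto simp: left_submodule_def)
  have "subspace class_ring N (scalar_space G M)"
    using N by (intro V.subspace_space(1)) (auto simp: left_submodule_def R_single)
  from V.projection_exists[OF M(2) this] obtain p where
    p: "p \<in> mhom class_ring (scalar_space G M) (scalar_space G M)"
      "\<And>x. x \<in> carrier M \<Longrightarrow> p x \<in> N" "\<And>x. x \<in> N \<Longrightarrow> p x = x" by auto
  have padd: "p (x \<oplus>\<^bsub>M\<^esub> y) = p x \<oplus>\<^bsub>M\<^esub> p y" if "x \<in> carrier M" "y \<in> carrier M" for x y
    using mhomD(2)[OF p(1), of x y] that by simp
  have psc: "p (Poly_Mapping.single \<one> c \<odot>\<^bsub>M\<^esub> x) = Poly_Mapping.single \<one> c \<odot>\<^bsub>M\<^esub> p x"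
    if "x \<in> carrier M" for c x
    using mhomD(3)[OF p(1), of c x] that by (simp add: class_ring_simps)
  let ?\<delta> = "\<lambda>x. Poly_Mapping.single x (1 :: 'k)"
  have \<delta>: "?\<delta> x \<in> carrier R" if "x \<in> carrier G" for x using that by (rule R_single)
  define F where "F x g = ?\<delta> g \<odot>\<^bsub>M\<^esub> p (?\<delta> (inv g) \<odot>\<^bsub>M\<^esub> x)" for x g
  define T where "T x = (\<Oplus>\<^bsub>M\<^esub>g\<in>carrier G. F x g)" for x
  have FN: "F x g \<in> N" if "x \<in> carrier M" "g \<in> carrier G" for x g
    unfolding F_def using that by (intro Nsm p(2) L.smult_closed \<delta>) auto
  have FM: "F x \<in> carrier G \<rightarrow> carrier M" if "x \<in> carrier M" for x using FN[OF that] NM by auto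
  have TN: "T x \<in> N" if x: "x \<in> carrier M" for x
  proof -
    have "(\<Oplus>\<^bsub>M\<^esub>g\<in>A. F x g) \<in> N" if "finite A" "A \<subseteq> carrier G" for A
      using that
    proof (induction A rule: finite_induct)
      case (insert g A)
      have "(\<Oplus>\<^bsub>M\<^esub>g\<in>insert g A. F x g) = F x g \<oplus>\<^bsub>M\<^esub> (\<Oplus>\<^bsub>M\<^esub>g\<in>A. F x g)"
        using insert FM[OF x] by (intro L.M.finsum_insert) auto
      then show ?case using insert FN[OF x] N by (auto simp: left_submodule_def)
    qed (use N in \<open>simp add: left_submodule_def\<close>)
    then show ?thesis using finite_carrier by (simp add: T_def)
  qed
  have Tadd: "T (x \<oplus>\<^bsub>M\<^esub> y) = T x \<oplus>\<^bsub>M\<^esub> T y" if xy: "x \<in> carrier M" "y \<in> carrier M" for x y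
  proof -
    have "T x \<oplus>\<^bsub>M\<^esub> T y = (\<Oplus>\<^bsub>M\<^esub>g\<in>carrier G. F x g \<oplus>\<^bsub>M\<^esub> F y g)"
      unfolding T_def by (rule L.M.finsum_addf[symmetric]) (use FM xy in auto)
    also have "\<dots> = T (x \<oplus>\<^bsub>M\<^esub> y)"
      unfolding T_def
    proof (rule L.M.finsum_cong'[OF refl])
      fix g assume g: "g \<in> carrier G"
      have "?\<delta> (inv g) \<odot>\<^bsub>M\<^esub> x \<in> carrier M" "?\<delta> (inv g) \<odot>\<^bsub>M\<^esub> y \<in> carrier M"
        using xy g \<delta> by (auto intro!: L.smult_closed)
      then show "F x g \<oplus>\<^bsub>M\<^esub> F y g = F (x \<oplus>\<^bsub>M\<^esub> y) g"
        unfolding F_def using xy g \<delta> p(2) NM by (simp add: L.smult_r_distr padd)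
    qed (use FM xy in auto)
    finally show ?thesis by simp
  qed
  have Tsc: "T (Poly_Mapping.single \<one> c \<odot>\<^bsub>M\<^esub> x) = Poly_Mapping.single \<one> c \<odot>\<^bsub>M\<^esub> T x"
    if x: "x \<in> carrier M" for c x
  proof -
    let ?c = "Poly_Mapping.single \<one> c"
    have cR: "?c \<in> carrier R" by (simp add: R_single)
    have comm: "a \<odot>\<^bsub>M\<^esub> (?c \<odot>\<^bsub>M\<^esub> y) = ?c \<odot>\<^bsub>M\<^esub> (a \<odot>\<^bsub>M\<^esub> y)" if "a \<in> carrier R" "y \<in> carrier M" for a y
      using scalar_central[OF that(1), of c] that cR by (simp flip: L.smult_assoc1)
    have "?c \<odot>\<^bsub>M\<^esub> T x = (\<Oplus>\<^bsub>M\<^esub>g\<in>carrier G. ?c \<odot>\<^bsub>M\<^esub> F x g)"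
      unfolding T_def by (rule L.smult_finsum[OF cR FM[OF x]])
    also have "\<dots> = T (?c \<odot>\<^bsub>M\<^esub> x)"
      unfolding T_def
    proof (rule L.M.finsum_cong'[OF refl])
      fix g assume g: "g \<in> carrier G"
      have 1: "?\<delta> (inv g) \<odot>\<^bsub>M\<^esub> x \<in> carrier M" using x g \<delta> by (auto intro!: L.smult_closed)
      then show "?c \<odot>\<^bsub>M\<^esub> F x g = F (?c \<odot>\<^bsub>M\<^esub> x) g"
        unfolding F_def using x g \<delta> by (simp add: comm psc[OF 1] NM[OF p(2)[OF 1]])
    qed (use FM L.smult_closed[OF cR x] in auto)
    finally show ?thesis by simp
  qed
  have Tg: "T (?\<delta> h \<odot>\<^bsub>M\<^esub> x) = ?\<delta> h \<odot>\<^bsub>M\<^esub> T x" if x: "x \<in> carrier M" and h: "h \<in> carrier G" for h x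
  proof -
    have hx: "?\<delta> h \<odot>\<^bsub>M\<^esub> x \<in> carrier M" using x h \<delta> by (auto intro!: L.smult_closed)
    \<comment> \<open>Left translation by \<open>h\<close> permutes the summands, which turns T(h x)
      into h T(x).\<close>
    have surj: "(\<lambda>g. h \<otimes> g) ` carrier G = carrier G"
      using h by (rule surj_const_mult)
    have "T (?\<delta> h \<odot>\<^bsub>M\<^esub> x) = (\<Oplus>\<^bsub>M\<^esub>g\<in>carrier G. F (?\<delta> h \<odot>\<^bsub>M\<^esub> x) (h \<otimes> g))"
      using L.M.finsum_reindex[of "F (?\<delta> h \<odot>\<^bsub>M\<^esub> x)" "\<lambda>g. h \<otimes> g" "carrier G"]
        FM[OF hx] inj_on_cmult[OF h] unfolding T_def surj by blast
    also have "\<dots> = (\<Oplus>\<^bsub>M\<^esub>g\<in>carrier G. ?\<delta> h \<odot>\<^bsub>M\<^esub> F x g)"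
    proof (rule L.M.finsum_cong'[OF refl])
      fix g assume g: "g \<in> carrier G"
      have "inv (h \<otimes> g) \<otimes> h = inv g" using g h by (simp add: inv_mult_group m_assoc)
      then have "?\<delta> (inv (h \<otimes> g)) \<odot>\<^bsub>M\<^esub> (?\<delta> h \<odot>\<^bsub>M\<^esub> x) = ?\<delta> (inv g) \<odot>\<^bsub>M\<^esub> x"
        using x g h \<delta> by (simp add: R_mult_single flip: L.smult_assoc1)
      moreover have "?\<delta> (h \<otimes> g) = ?\<delta> h \<otimes>\<^bsub>R\<^esub> ?\<delta> g" by (simp add: R_mult_single)
      moreover have "p (?\<delta> (inv g) \<odot>\<^bsub>M\<^esub> x) \<in> carrier M"
        using x g \<delta> by (intro NM[OF p(2)] L.smult_closed) auto
      ultimately show "F (?\<delta> h \<odot>\<^bsub>M\<^esub> x) (h \<otimes> g) = ?\<delta> h \<odot>\<^bsub>M\<^esub> F x g"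
        unfolding F_def using g h \<delta> by (simp add: L.smult_assoc1)
    qed (use FM[OF x] h \<delta> in \<open>auto intro!: L.smult_closed\<close>)
    also have "\<dots> = ?\<delta> h \<odot>\<^bsub>M\<^esub> T x"
      unfolding T_def by (rule L.smult_finsum[OF \<delta>[OF h] FM[OF x], symmetric])
    finally show ?thesis .
  qed
  \<comment> \<open>Equivariance passes from scalars and group elements to the whole group ring by
    additivity. Membership in the ring is part of the claim because the sum case of
    \<open>R_induct\<close> supplies nothing else about the summands.\<close>
  have TR: "a \<in> carrier R \<and> (\<forall>x\<in>carrier M. T (a \<odot>\<^bsub>M\<^esub> x) = a \<odot>\<^bsub>M\<^esub> T x)" if "a \<in> carrier R" for a
    using that
  proof (induction rule: R_induct)
    case zero
    have "T \<zero>\<^bsub>M\<^esub> \<oplus>\<^bsub>M\<^esub> T \<zero>\<^bsub>M\<^esub> = T \<zero>\<^bsub>M\<^esub>" using Tadd[of "\<zero>\<^bsub>M\<^esub>" "\<zero>\<^bsub>M\<^esub>"] by simp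
    then have "T \<zero>\<^bsub>M\<^esub> = \<zero>\<^bsub>M\<^esub>" using NM[OF TN[of "\<zero>\<^bsub>M\<^esub>"]] by (simp add: L.M.add.l_cancel_one)
    moreover have "0 \<odot>\<^bsub>M\<^esub> x = \<zero>\<^bsub>M\<^esub>" if "x \<in> carrier M" for x
      using L.smult_l_null[OF that] by (simp add: R_simps)
    ultimately show ?case using NM[OF TN] R.zero_closed by (simp add: R_simps(3))
  next
    case (single h t)
    have "T (Poly_Mapping.single h t \<odot>\<^bsub>M\<^esub> x) = Poly_Mapping.single h t \<odot>\<^bsub>M\<^esub> T x" if x: "x \<in> carrier M" for x
    proof -
      have 1: "Poly_Mapping.single h t \<odot>\<^bsub>M\<^esub> y = Poly_Mapping.single \<one> t \<odot>\<^bsub>M\<^esub> (?\<delta> h \<odot>\<^bsub>M\<^esub> y)"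
        if "y \<in> carrier M" for y
        using that single \<delta> by (subst single_factor) (auto simp: L.smult_assoc1 R_single)
      have 2: "?\<delta> h \<odot>\<^bsub>M\<^esub> x \<in> carrier M" using x single \<delta> by (auto intro!: L.smult_closed)
      show ?thesis unfolding 1[OF x] 1[OF NM[OF TN[OF x]]] Tsc[OF 2] Tg[OF x single] ..
    qed
    then show ?case using single R_single by blast
  next
    case (add a b)
    have "T ((a + b) \<odot>\<^bsub>M\<^esub> x) = (a + b) \<odot>\<^bsub>M\<^esub> T x" if x: "x \<in> carrier M" for x
    proof -
      have 1: "(a + b) \<odot>\<^bsub>M\<^esub> y = a \<odot>\<^bsub>M\<^esub> y \<oplus>\<^bsub>M\<^esub> b \<odot>\<^bsub>M\<^esub> y" if "y \<in> carrier M" for y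
        using L.smult_l_distr[of a b y] add that by (simp add: R_simps(4))
      show ?thesis unfolding 1[OF x] 1[OF NM[OF TN[OF x]]]
        using add x by (simp add: Tadd L.smult_closed)
    qed
    then show ?case using add R_add by blast
  qed
  \<comment> \<open>Characteristic 0 makes the order of the group invertible.\<close>
  define c where "c = Poly_Mapping.single \<one> (1 / of_nat (card (carrier G)) :: 'k)"
  have c: "c \<in> carrier R" by (simp add: c_def R_single)
  define \<pi> where "\<pi> x = c \<odot>\<^bsub>M\<^esub> T x" for x
  have "\<pi> \<in> mhom R M M"
  proof (rule mhomI)
    show "\<pi> (x \<oplus>\<^bsub>M\<^esub> y) = \<pi> x \<oplus>\<^bsub>M\<^esub> \<pi> y" if "x \<in> carrier M" "y \<in> carrier M" for x y
      using that c NM TN by (simp add: \<pi>_def Tadd L.smult_r_distr)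
    show "\<pi> (a \<odot>\<^bsub>M\<^esub> x) = a \<odot>\<^bsub>M\<^esub> \<pi> x" if "a \<in> carrier R" "x \<in> carrier M" for a x
      using that c NM TN TR[OF that(1)] scalar_central[OF that(1)]
      by (simp add: \<pi>_def c_def flip: L.smult_assoc1)
  qed (use c TN NM in \<open>auto simp: \<pi>_def L.smult_closed\<close>)
  moreover have "\<pi> x \<in> N" if "x \<in> carrier M" for x using Nsm[OF c TN[OF that]] by (simp add: \<pi>_def)
  moreover have "\<pi> x = x" if x: "x \<in> N" for x
  proof -
    have "F x g = x" if g: "g \<in> carrier G" for g
    proof -
      have "p (?\<delta> (inv g) \<odot>\<^bsub>M\<^esub> x) = ?\<delta> (inv g) \<odot>\<^bsub>M\<^esub> x" using x g \<delta> by (intro p(3) Nsm) auto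
      then have "F x g = (?\<delta> g \<otimes>\<^bsub>R\<^esub> ?\<delta> (inv g)) \<odot>\<^bsub>M\<^esub> x"
        using g \<delta> NM[OF x] by (simp add: F_def L.smult_assoc1)
      also have "\<dots> = x" using g L.smult_one[OF NM[OF x]] by (simp add: R_mult_single R_simps)
      finally show ?thesis .
    qed
    then have "T x = (\<Oplus>\<^bsub>M\<^esub>g\<in>carrier G. x)"
      unfolding T_def using NM[OF x] by (intro L.M.finsum_cong') auto
    also have "\<dots> = Poly_Mapping.single \<one> (of_nat (card (carrier G))) \<odot>\<^bsub>M\<^esub> x"
      by (rule finsum_const[OF M(1) finite_carrier NM[OF x]])
    finally have "\<pi> x = (c \<otimes>\<^bsub>R\<^esub> Poly_Mapping.single \<one> (of_nat (card (carrier G)))) \<odot>\<^bsub>M\<^esub> x"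
      using c NM[OF x] by (simp add: \<pi>_def L.smult_assoc1 R_single)
    also have "c \<otimes>\<^bsub>R\<^esub> Poly_Mapping.single \<one> (of_nat (card (carrier G))) = \<one>\<^bsub>R\<^esub>"
      using finite_carrier one_closed by (auto simp: c_def R_mult_single R_simps card_eq_0_iff)
    finally show ?thesis using L.smult_one[OF NM[OF x]] by simp
  qed
  ultimately show ?thesis using NM by (intro bexI[of _ \<pi>]) (auto simp: image_iff intro: NM sym)
qed

end

lemma finsum_scalar_space: "finsum (scalar_space G M) f A = finsum M f A"
  by (simp add: finsum_def finprod_def scalar_space_def restrict_scalars_def)

text \<open>Every simple module is a quotient of the regular module, so a finite set with this property
  for the regular module bounds the number of simple modules.\<close>

definition represents_quotients ::
  "('r, 'a) ring_scheme \<Rightarrow> ('r, 'm) module set \<Rightarrow> ('r, 'm) module \<Rightarrow> bool" where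
  "represents_quotients R X M \<longleftrightarrow>
     (\<forall>(T :: ('r, 'm) module) f x. simple_module R T \<longrightarrow> f \<in> mhom R M T \<longrightarrow> x \<in> carrier M \<longrightarrow>
       f x \<noteq> \<zero>\<^bsub>T\<^esub> \<longrightarrow> (\<exists>S\<in>X. module_iso R S T))"

lemma represents_quotientsI:
  assumes "\<And>(T :: ('r, 'm) module) f x. simple_module R T \<Longrightarrow> f \<in> mhom R M T \<Longrightarrow> x \<in> carrier M \<Longrightarrow>
    f x \<noteq> \<zero>\<^bsub>T\<^esub> \<Longrightarrow> \<exists>S\<in>X. module_iso R S T"
  shows "represents_quotients R X (M :: ('r, 'm) module)"
  using assms unfolding represents_quotients_def by blast

lemma represents_quotientsD:
  fixes M T :: "('r, 'm) module"
  assumes "represents_quotients R X M" "simple_module R T" "f \<in> mhom R M T" "x \<in> carrier M" "f x \<noteq> \<zero>\<^bsub>T\<^esub>"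
  shows "\<exists>S\<in>X. module_iso R S T"
  using assms unfolding represents_quotients_def by blast

context group_algebra
begin

text \<open>A K-basis generates over the group ring. This direction holds for every group, while the
  converse \<open>fin_generated_kfin\<close> uses a finite one.\<close>

lemma kfin_fin_generated:
  assumes "left_module R M" "kfin G M"
  shows "fin_generated R M"
proof -
  interpret L: left_module R M by fact
  interpret V: field_space "scalar_space G M" using assms(1) by (rule scalar_space)
  obtain A where A: "finite A" "V.basis A" using V.finite_basis_exists[OF assms(2)] by blast
  then have AM: "A \<subseteq> carrier M" and gen: "V.span A = carrier M" by (auto simp: V.basis_def)
  have "carrier M = {\<Oplus>\<^bsub>M\<^esub>x\<in>A. c x \<odot>\<^bsub>M\<^esub> x | c. c \<in> A \<rightarrow> carrier R}"
  proof (intro equalityI subsetI)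
    fix v assume "v \<in> carrier M"
    then obtain a where "V.lincomb a A = v"
      using V.finite_in_span[OF A(1), of v] AM gen by auto
    then have "v = (\<Oplus>\<^bsub>M\<^esub>x\<in>A. Poly_Mapping.single \<one> (a x) \<odot>\<^bsub>M\<^esub> x)"
      by (simp add: V.lincomb_def finsum_scalar_space)
    then show "v \<in> {\<Oplus>\<^bsub>M\<^esub>x\<in>A. c x \<odot>\<^bsub>M\<^esub> x | c. c \<in> A \<rightarrow> carrier R}"
      unfolding mem_Collect_eq
      by (intro exI[of _ "\<lambda>x. Poly_Mapping.single \<one> (a x)"] conjI) (auto intro!: R_single)
  next
    fix v assume "v \<in> {\<Oplus>\<^bsub>M\<^esub>x\<in>A. c x \<odot>\<^bsub>M\<^esub> x | c. c \<in> A \<rightarrow> carrier R}"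
    then show "v \<in> carrier M" using AM by (auto intro!: L.M.finsum_closed L.smult_closed)
  qed
  then show ?thesis unfolding fin_generated_def using A(1) AM by blast
qed

end

section \<open>Decomposition into simple modules and separating idempotents\<close>

context finite_group_algebra
begin

lemma fg_modules_iff: "M \<in> fg_modules R \<longleftrightarrow> left_module R M \<and> kfin G M"
  using kfin_fin_generated fin_generated_kfin by (auto simp: fg_modules_def)

text \<open>By Maschke's theorem the annihilator of an element \<open>s \<noteq> 0\<close> of \<open>S\<close> is \<open>Ru\<close> for an
  idempotent \<open>u\<close>; take \<open>e = 1 - u\<close>. If \<open>e\<close> does not annihilate \<open>t\<close>, then \<open>rs \<mapsto> ret\<close> is a
  nonzero homomorphism.\<close>

lemma simple_idempotent:
  fixes S :: "('g \<Rightarrow>\<^sub>0 'k, 'm) module"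
  assumes S: "simple_module R S"
  shows "\<exists>e\<in>carrier R. e \<otimes>\<^bsub>R\<^esub> e = e \<and> (\<exists>x\<in>carrier S. e \<odot>\<^bsub>S\<^esub> x \<noteq> \<zero>\<^bsub>S\<^esub>) \<and>
    (\<forall>T :: ('g \<Rightarrow>\<^sub>0 'k, 'm) module. simple_module R T \<and> (\<exists>t\<in>carrier T. e \<odot>\<^bsub>T\<^esub> t \<noteq> \<zero>\<^bsub>T\<^esub>) \<longrightarrow>
      module_iso R S T)"
proof -
  let ?P = "R.Pm \<one>\<^bsub>R\<^esub>" and ?g = "\<lambda>_::nat. \<one>\<^bsub>R\<^esub>"
  have one: "\<one>\<^bsub>R\<^esub> \<in> carrier R" "\<one>\<^bsub>R\<^esub> \<otimes>\<^bsub>R\<^esub> \<one>\<^bsub>R\<^esub> = \<one>\<^bsub>R\<^esub>" by auto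
  note P = R.Pm_left_module[OF one] R.Pm_generator[OF one]
  have LS: "left_module R S" using S by (simp add: simple_module_def)
  interpret P: left_module R ?P by (rule P(1))
  interpret S: left_module R S by (rule LS)
  obtain s where s: "s \<in> carrier S" "s \<noteq> \<zero>\<^bsub>S\<^esub>"
    using S S.M.zero_closed by (auto simp: simple_module_def)
  define f where "f x = x 0 \<odot>\<^bsub>S\<^esub> s" for x :: "nat \<Rightarrow> 'g \<Rightarrow>\<^sub>0 'k"
  have f: "f \<in> mhom R ?P S" unfolding f_def by (rule R.Pm_mhom[OF one LS s(1)])
  have f1: "f ?g = s" using s S.smult_one by (simp add: f_def)
  have "f ` carrier ?P \<noteq> {\<zero>\<^bsub>S\<^esub>}" using f1 s(2) P(2) by (metis imageI singletonD)
  then have fS: "f ` carrier ?P = carrier S"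
    using S mhom_image_submodule[OF P(1) LS f P.left_submodule_self] by (auto simp: simple_module_def)
  let ?L = "{x \<in> carrier ?P. f x = \<zero>\<^bsub>S\<^esub>}"
  obtain \<pi> where \<pi>: "\<pi> \<in> mhom R ?P ?P" "\<pi> ` carrier ?P = ?L" "\<forall>x\<in>?L. \<pi> x = x"
    using maschke[OF P(1) fin_generated_kfin[OF P(1) R.Pm_fin_generated[OF one]]
        mhom_kernel_submodule[OF P(1) LS f]] by auto
  \<comment> \<open>An endomorphism of the regular module is right multiplication by its value at 1;
    for the projection \<open>\<pi>\<close> this value is the idempotent \<open>u\<close>.\<close>
  define u where "u = \<pi> ?g 0"
  have \<pi>1: "\<pi> ?g \<in> ?L" using \<pi>(2) P(2) by blast
  have u: "u \<in> carrier R" unfolding u_def by (rule P(4)[OF mhomD(1)[OF \<pi>(1) P(2)]])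
  have \<pi>r: "\<pi> (\<lambda>_. r) = (\<lambda>_. r \<otimes>\<^bsub>R\<^esub> u)" if "r \<in> carrier R" for r
    using mhomD(3)[OF \<pi>(1) that P(2)] that by (simp add: R.Pm_simps u_def)
  have \<pi>1u: "\<pi> ?g = (\<lambda>_. u)" using \<pi>r[of "\<one>\<^bsub>R\<^esub>"] u by simp
  have us: "u \<odot>\<^bsub>S\<^esub> s = \<zero>\<^bsub>S\<^esub>" using \<pi>1 by (simp add: f_def \<pi>1u)
  have "\<pi> (\<lambda>_. u) = (\<lambda>_. u)" using \<pi>(3) \<pi>1 by (simp add: \<pi>1u)
  then have uu: "u \<otimes>\<^bsub>R\<^esub> u = u" using \<pi>r[OF u] by (metis (mono_tags))
  define e where "e = \<one>\<^bsub>R\<^esub> \<ominus>\<^bsub>R\<^esub> u"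
  have e: "e \<in> carrier R" using u by (simp add: e_def)
  have ue: "u \<otimes>\<^bsub>R\<^esub> e = \<zero>\<^bsub>R\<^esub>" using u by (simp add: e_def a_minus_def R.r_distr R.r_minus uu R.r_neg)
  have ee: "e \<otimes>\<^bsub>R\<^esub> e = e"
  proof -
    have "e \<otimes>\<^bsub>R\<^esub> e = \<one>\<^bsub>R\<^esub> \<otimes>\<^bsub>R\<^esub> e \<oplus>\<^bsub>R\<^esub> \<ominus>\<^bsub>R\<^esub> (u \<otimes>\<^bsub>R\<^esub> e)"
      using u e by (subst (1) e_def) (simp add: a_minus_def R.l_distr R.l_minus)
    then show ?thesis using e by (simp add: ue)
  qed
  have es: "e \<odot>\<^bsub>S\<^esub> s = s"
  proof -
    have "e \<odot>\<^bsub>S\<^esub> s = \<one>\<^bsub>R\<^esub> \<odot>\<^bsub>S\<^esub> s \<oplus>\<^bsub>S\<^esub> (\<ominus>\<^bsub>R\<^esub> \<one>\<^bsub>R\<^esub> \<otimes>\<^bsub>R\<^esub> u) \<odot>\<^bsub>S\<^esub> s"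
      using u s by (simp add: e_def a_minus_def S.smult_l_distr R.l_minus)
    also have "(\<ominus>\<^bsub>R\<^esub> \<one>\<^bsub>R\<^esub> \<otimes>\<^bsub>R\<^esub> u) \<odot>\<^bsub>S\<^esub> s = \<zero>\<^bsub>S\<^esub>"
      using u s us by (subst S.smult_assoc1) auto
    finally show ?thesis using s S.smult_one by simp
  qed
  have "module_iso R S T" if T: "simple_module R T" and t: "t \<in> carrier T" "e \<odot>\<^bsub>T\<^esub> t \<noteq> \<zero>\<^bsub>T\<^esub>"
    for T :: "('g \<Rightarrow>\<^sub>0 'k, 'm) module" and t
  proof -
    have LT: "left_module R T" using T by (simp add: simple_module_def)
    interpret T: left_module R T by (rule LT)
    define t' where "t' = e \<odot>\<^bsub>T\<^esub> t"
    have t': "t' \<in> carrier T" using t e by (simp add: t'_def T.smult_closed)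
    \<comment> \<open>Since \<open>u\<close> kills t', so does the whole annihilator Ru of
      \<open>s\<close>, and \<open>h\<close> factors through \<open>f\<close>.\<close>
    have ut: "u \<odot>\<^bsub>T\<^esub> t' = \<zero>\<^bsub>T\<^esub>" using u e t by (simp add: t'_def ue flip: T.smult_assoc1)
    define h where "h x = x 0 \<odot>\<^bsub>T\<^esub> t'" for x :: "nat \<Rightarrow> 'g \<Rightarrow>\<^sub>0 'k"
    have h: "h \<in> mhom R ?P T" unfolding h_def by (rule R.Pm_mhom[OF one LT t'])
    have "h x = \<zero>\<^bsub>T\<^esub>" if x: "x \<in> carrier ?P" "f x = \<zero>\<^bsub>S\<^esub>" for x
    proof -
      obtain r where r: "r \<in> carrier R" "x = (\<lambda>_. r)" using x(1) R.Pm_carrier[OF one] by auto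
      have "(\<lambda>_. r \<otimes>\<^bsub>R\<^esub> u) = (\<lambda>_::nat. r)" using \<pi>(3) x \<pi>r[OF r(1)] r(2) by auto
      then have "r \<otimes>\<^bsub>R\<^esub> u = r" by (rule fun_cong)
      then have "h x = r \<odot>\<^bsub>T\<^esub> (u \<odot>\<^bsub>T\<^esub> t')" using T.smult_assoc1[OF r(1) u t'] by (simp add: h_def r(2))
      then show ?thesis using r(1) by (simp add: ut)
    qed
    then obtain g where g: "g \<in> mhom R S T" "\<forall>x\<in>carrier ?P. g (f x) = h x"
      using mhom_factor[OF P(1) LS LT f fS h] by blast
    have "g s = t'" using g(2) P(2) f1 T.smult_one[OF t'] by (metis h_def)
    then have "bij_betw g (carrier S) (carrier T)"
      using schur[OF S T g(1) s(1)] t(2) by (simp add: t'_def)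
    with g(1) show ?thesis by (auto simp: module_iso_def)
  qed
  moreover have "\<exists>x\<in>carrier S. e \<odot>\<^bsub>S\<^esub> x \<noteq> \<zero>\<^bsub>S\<^esub>"
    using s es by (intro bexI[of _ s]) auto
  ultimately show ?thesis using e ee by blast
qed

sublocale FQ: frag_quotient "fg_modules R" "groth_relators R (fg_modules R)"
  by (rule groth_relators_quotient)

lemma groth_subgroup_eq: "groth_subgroup R (fg_modules R) = FQ.N"
  by (simp add: groth_subgroup_def)

text \<open>Induction on the dimension: Maschke's theorem splits a module that is neither zero nor
  simple into N and the kernel C of a projection onto N, both smaller. The simple modules collected
  along the way also account for all simple quotients of M, which later shows that there are
  finitely many in total.\<close>

lemma simple_decomposition:
  fixes M :: "('g \<Rightarrow>\<^sub>0 'k) fmod"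
  assumes "M \<in> fg_modules R"
  shows "\<exists>X u. finite X \<and> X \<subseteq> {S \<in> fg_modules R. simple_module R S} \<and>
    Poly_Mapping.keys u \<subseteq> X \<and> frag_of M - u \<in> FQ.N \<and>
    represents_quotients R X M"
  using assms
proof (induction "kdim G M" arbitrary: M rule: less_induct)
  case less
  have M: "left_module R M" "kfin G M" using less.prems by (auto simp: fg_modules_iff)
  interpret L: left_module R M by (rule M(1))
  consider "carrier M = {\<zero>\<^bsub>M\<^esub>}" | "simple_module R M"
    | N where "left_submodule R N M" "N \<noteq> {\<zero>\<^bsub>M\<^esub>}" "N \<noteq> carrier M"
    using M(1) by (auto simp: simple_module_def)
  then show ?case
  proof cases
    case 1
    \<comment> \<open>For a zero module the sequence M, M, M with identity maps is exact and gives
      [M] = 0, so no simple module is required.\<close>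
    have "(\<lambda>x. x) \<in> mhom R M M" by (rule mhomI) auto
    then have "short_exact R M M M" unfolding short_exact_def
      using 1 by (intro bexI[of _ "\<lambda>x. x"]) auto
    then have "frag_of M - (frag_of M + frag_of M) \<in> FQ.N"
      using less.prems by (intro FQ.N_Rel) (unfold groth_relators_def, blast)
    from FQ.N_minus[OF this] have *: "frag_of M - 0 \<in> FQ.N" by simp
    have "f x = \<zero>\<^bsub>T\<^esub>" if "simple_module R T" "f \<in> mhom R M T" "x \<in> carrier M"
      for T :: "('g \<Rightarrow>\<^sub>0 'k) fmod" and f x
      using that 1 mhom_zero[OF M(1) _ that(2)] by (auto simp: simple_module_def)
    then have "represents_quotients R {} M" by (intro represents_quotientsI) blast
    with * show ?thesis by (intro exI[of _ "{}"] exI[of _ 0]) auto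
  next
    case 2
    have "module_iso R M T" if "simple_module R T" "f \<in> mhom R M T" "x \<in> carrier M" "f x \<noteq> \<zero>\<^bsub>T\<^esub>"
      for T :: "('g \<Rightarrow>\<^sub>0 'k) fmod" and f x
      using schur[OF 2 that(1,2,3)] that(2,4) by (auto simp: module_iso_def)
    then have "represents_quotients R {M} M" by (intro represents_quotientsI) blast
    then show ?thesis using 2 less.prems FQ.N_zero
      by (intro exI[of _ "{M}"] exI[of _ "frag_of M"]) (auto simp: keys_frag_of)
  next
    case (3 N)
    obtain \<pi> where \<pi>: "\<pi> \<in> mhom R M M" "\<pi> ` carrier M = N" "\<forall>x\<in>N. \<pi> x = x"
      using maschke[OF M 3(1)] by blast
    define C where "C = {x \<in> carrier M. \<pi> x = \<zero>\<^bsub>M\<^esub>}"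
    have C: "left_submodule R C M" unfolding C_def by (rule mhom_kernel_submodule[OF M(1) M(1) \<pi>(1)])
    have NM: "N \<subseteq> carrier M" using 3(1) by (simp add: left_submodule_def)
    let ?N = "M\<lparr>carrier := N\<rparr>" and ?C = "M\<lparr>carrier := C\<rparr>"
    have LN: "left_module R ?N" "left_module R ?C" using L.left_submodule_module 3(1) C by blast+
    have fN: "kfin G ?N" "kfin G ?C" using kfin_submodule[OF M] 3(1) C by blast+
    have fg: "?N \<in> fg_modules R" "?C \<in> fg_modules R" using LN fN by (auto simp: fg_modules_iff)
    have diff: "x \<ominus>\<^bsub>M\<^esub> \<pi> x \<in> C" "\<pi> x \<in> N" if "x \<in> carrier M" for x
    proof -
      show N: "\<pi> x \<in> N" using that \<pi>(2) by auto
      then have "\<pi> (x \<ominus>\<^bsub>M\<^esub> \<pi> x) = \<zero>\<^bsub>M\<^esub>"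
        using mhom_minus[OF M(1) M(1) \<pi>(1) that, of "\<pi> x"] NM \<pi>(3) by (auto simp: subset_iff)
      then show "x \<ominus>\<^bsub>M\<^esub> \<pi> x \<in> C" using that N NM by (auto simp: C_def)
    qed
    have ex: "short_exact R ?C M ?N" unfolding short_exact_def
    proof -
      have i: "(\<lambda>x. x) \<in> mhom R ?C M" by (rule mhomI) (auto simp: C_def)
      have p: "\<pi> \<in> mhom R M ?N" using \<pi>(2) by (intro mhomI) (auto simp: mhomD[OF \<pi>(1)])
      show "\<exists>i\<in>mhom R ?C M. \<exists>p\<in>mhom R M ?N. inj_on i (carrier ?C) \<and>
        i ` carrier ?C = {x \<in> carrier M. p x = \<zero>\<^bsub>?N\<^esub>} \<and> p ` carrier M = carrier ?N"
        using \<pi>(2) by (intro bexI[OF _ i] bexI[OF _ p]) (auto simp: C_def)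
    qed
    have dim: "kdim G M = kdim G ?C + kdim G ?N"
      by (rule kdim_short_exact[OF LN(2) M(1) LN(1) ex M(2)])
    have "C \<noteq> {\<zero>\<^bsub>M\<^esub>}"
    proof
      assume C0: "C = {\<zero>\<^bsub>M\<^esub>}"
      have "x \<in> N" if x: "x \<in> carrier M" for x
      proof -
        have "x \<ominus>\<^bsub>M\<^esub> \<pi> x = \<zero>\<^bsub>M\<^esub>" using diff(1)[OF x] C0 by simp
        then have "x = \<pi> x" using diff(2)[OF x] NM x L.M.minus_other_side by blast
        then show ?thesis using diff(2)[OF x] by simp
      qed
      with NM 3(3) show False by blast
    qed
    then have "kdim G ?C \<noteq> 0" "kdim G ?N \<noteq> 0"
      using 3(2) field_space.dim_zeroD[OF scalar_space[OF LN(2)] fN(2)]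
        field_space.dim_zeroD[OF scalar_space[OF LN(1)] fN(1)] by auto
    then have lt: "kdim G ?C < kdim G M" "kdim G ?N < kdim G M" using dim by auto
    obtain X u where X: "finite X" "X \<subseteq> {S \<in> fg_modules R. simple_module R S}"
      "Poly_Mapping.keys u \<subseteq> X" "frag_of ?C - u \<in> FQ.N"
      "represents_quotients R X ?C"
      using less.hyps[OF lt(1) fg(2)] by blast
    obtain Y v where Y: "finite Y" "Y \<subseteq> {S \<in> fg_modules R. simple_module R S}"
      "Poly_Mapping.keys v \<subseteq> Y" "frag_of ?N - v \<in> FQ.N"
      "represents_quotients R Y ?N"
      using less.hyps[OF lt(2) fg(1)] by blast
    have "frag_of M - (frag_of ?C + frag_of ?N) \<in> FQ.N"
      using less.prems fg ex by (intro FQ.N_Rel) (unfold groth_relators_def, blast)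
    from FQ.N_add[OF this FQ.N_add[OF X(4) Y(4)]]
    have "frag_of M - (u + v) \<in> FQ.N" by (simp add: algebra_simps)
    moreover have "Poly_Mapping.keys (u + v) \<subseteq> X \<union> Y" using keys_add[of u v] X(3) Y(3) by blast
    moreover have "represents_quotients R (X \<union> Y) M"
    proof (rule represents_quotientsI)
      fix T :: "('g \<Rightarrow>\<^sub>0 'k) fmod" and f x
      assume T: "simple_module R T" "f \<in> mhom R M T" "x \<in> carrier M" "f x \<noteq> \<zero>\<^bsub>T\<^esub>"
      have LT: "left_module R T" using T(1) by (simp add: simple_module_def)
      interpret T: left_module R T by (rule LT)
      have sub: "f \<in> mhom R (M\<lparr>carrier := A\<rparr>) T" if "A \<subseteq> carrier M" for A
        using that by (intro mhomI) (auto simp: mhomD[OF T(2)] subset_iff)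
      \<comment> \<open>Since x is the sum of \<open>\<pi> x\<close> in N and its difference from
        \<open>\<pi> x\<close> in C, a homomorphism that is nonzero at x is nonzero on N or on
        C.\<close>
      show "\<exists>S\<in>X \<union> Y. module_iso R S T"
      proof (cases "f (\<pi> x) = \<zero>\<^bsub>T\<^esub>")
        case True
        have "f (x \<ominus>\<^bsub>M\<^esub> \<pi> x) = f x \<ominus>\<^bsub>T\<^esub> f (\<pi> x)"
          using diff(2)[OF T(3)] NM by (intro mhom_minus[OF M(1) LT T(2) T(3)]) auto
        then have "f (x \<ominus>\<^bsub>M\<^esub> \<pi> x) \<noteq> \<zero>\<^bsub>T\<^esub>" using T(3,4) mhomD(1)[OF T(2)] T.M.zero_closed by (simp add: True)
        moreover have "C \<subseteq> carrier M" using C by (simp add: left_submodule_def)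
        ultimately show ?thesis
          using represents_quotientsD[OF X(5) T(1) sub, of "x \<ominus>\<^bsub>M\<^esub> \<pi> x"] diff(1)[OF T(3)] by auto
      next
        case False
        then show ?thesis
          using represents_quotientsD[OF Y(5) T(1) sub[OF NM], of "\<pi> x"] diff(2)[OF T(3)] by auto
      qed
    qed
    ultimately show ?thesis using X(1,2) Y(1,2)
      by (intro exI[of _ "X \<union> Y"] exI[of _ "u + v"]) blast
  qed
qed

lemma component_dim_groth:
  assumes e: "e \<in> carrier R" "e \<otimes>\<^bsub>R\<^esub> e = e" and r: "r \<in> groth_relators R (fg_modules R)"
  shows "frag_eval (component_dim G e) r = 0"
proof -
  obtain M' M M'' where "r = frag_of M - (frag_of M' + frag_of M'')" "M' \<in> fg_modules R"
    "M \<in> fg_modules R" "M'' \<in> fg_modules R" "short_exact R M' M M''"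
    using r unfolding groth_relators_def by blast
  then show ?thesis
    using component_dim_exact[of M' M M'' e] e
    by (simp add: fg_modules_iff frag_eval_diff frag_eval_add)
qed

text \<open>Every simple module is a quotient of the regular module, so finitely many represent all
  of them, and their classes generate the Grothendieck group. With one idempotent \<open>e S\<close>
  for each representative, dim (e S)T vanishes exactly for T different from S; the functionals
  therefore read off the coefficients of a combination of simple classes up to nonzero
  factors.\<close>

lemma finite_separating_idempotents:
  "\<exists>E. finite E \<and> (\<forall>e\<in>E. e \<in> carrier R \<and> e \<otimes>\<^bsub>R\<^esub> e = e) \<and>
    (\<forall>x. Poly_Mapping.keys x \<subseteq> fg_modules R \<longrightarrow> (\<forall>e\<in>E. frag_eval (component_dim G e) x = 0) \<longrightarrow> x \<in> FQ.N)"
proof -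
  let ?P = "R.Pm \<one>\<^bsub>R\<^esub>" and ?Z = "R.Pm \<zero>\<^bsub>R\<^esub>"
  have one: "\<one>\<^bsub>R\<^esub> \<in> carrier R" "\<one>\<^bsub>R\<^esub> \<otimes>\<^bsub>R\<^esub> \<one>\<^bsub>R\<^esub> = \<one>\<^bsub>R\<^esub>" by auto
  have zero: "\<zero>\<^bsub>R\<^esub> \<in> carrier R" "\<zero>\<^bsub>R\<^esub> \<otimes>\<^bsub>R\<^esub> \<zero>\<^bsub>R\<^esub> = \<zero>\<^bsub>R\<^esub>" by auto
  have P: "?P \<in> fg_modules R" "left_module R ?P" and Z: "?Z \<in> fg_modules R" "left_module R ?Z"
    using R.Pm_fg_projective[OF one] R.Pm_fg_projective[OF zero]
    by (auto simp: fg_projectives_def fg_modules_def)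
  have Z0: "carrier ?Z = {\<zero>\<^bsub>?Z\<^esub>}"
    using R.Pm_carrier[OF zero] by (auto simp: R.Pm_simps)
  define si where "si = {S \<in> fg_modules R. simple_module R S}"
  obtain X where X: "finite X" "X \<subseteq> si" "represents_quotients R X ?P"
    using simple_decomposition[OF P(1)] unfolding si_def by blast
  have siL: "left_module R S" if "S \<in> si" for S using that by (auto simp: si_def simple_module_def)
  \<comment> \<open>A fixed representative of each isomorphism class: it makes isomorphic members of
    \<open>Y\<close> equal, as needed for a diagonal matrix.\<close>
  define c where "c S = (SOME T. T \<in> si \<and> module_iso R S T)" for S :: "('g \<Rightarrow>\<^sub>0 'k) fmod"
  have c: "c S \<in> si" "module_iso R S (c S)" if "S \<in> si" for S
    using someI[of "\<lambda>T. T \<in> si \<and> module_iso R S T" S] that module_iso_refl by (auto simp: c_def)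
  have c_eq: "c S = c T" if ST: "S \<in> si" "T \<in> si" "module_iso R S T" for S T
  proof -
    have "module_iso R S = (module_iso R T :: ('g \<Rightarrow>\<^sub>0 'k) fmod \<Rightarrow> bool)"
      using module_iso_trans[OF ST(3)] module_iso_trans[OF module_iso_sym[OF siL[OF ST(1)] ST(3)]]
      by (intro ext iffI)
    then show ?thesis by (simp add: c_def)
  qed
  define Y where "Y = c ` X"
  have Y: "finite Y" "Y \<subseteq> si" using X c by (auto simp: Y_def)
  have cY: "c T \<in> Y" if T: "T \<in> si" for T
  proof -
    have sT: "simple_module R T" and LT: "left_module R T" using T siL by (auto simp: si_def)
    interpret T: left_module R T by (rule LT)
    obtain t where t: "t \<in> carrier T" "t \<noteq> \<zero>\<^bsub>T\<^esub>"
      using sT T.M.zero_closed by (auto simp: simple_module_def)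
    \<comment> \<open>The homomorphism from the regular module that sends 1 to \<open>t\<close> is
      nonzero, so T is one of its simple quotients.\<close>
    have "(\<lambda>_. \<one>\<^bsub>R\<^esub>) 0 \<odot>\<^bsub>T\<^esub> t \<noteq> \<zero>\<^bsub>T\<^esub>" using t T.smult_one by simp
    then obtain S where S: "S \<in> X" "module_iso R S T"
      using represents_quotientsD[OF X(3) sT R.Pm_mhom[OF one LT t(1)] R.Pm_generator(1)[OF one]] by auto
    have "c T = c S" using c_eq[of S T] X(2) S T by auto
    then show ?thesis using S(1) by (simp add: Y_def)
  qed
  have Y_iso: "S = T" if ST: "S \<in> Y" "T \<in> Y" "module_iso R S T" for S T
  proof -
    obtain S0 T0 where *: "S0 \<in> X" "S = c S0" "T0 \<in> X" "T = c T0" using ST by (auto simp: Y_def)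
    then have "c S0 = c S" "c T0 = c T" using c c_eq X(2) by blast+
    moreover have "c S = c T" using c_eq Y(2) ST by blast
    ultimately show ?thesis using * by simp
  qed
  define Q where "Q S e \<longleftrightarrow> e \<in> carrier R \<and> e \<otimes>\<^bsub>R\<^esub> e = e \<and>
    (\<exists>x\<in>carrier S. e \<odot>\<^bsub>S\<^esub> x \<noteq> \<zero>\<^bsub>S\<^esub>) \<and>
    (\<forall>T :: ('g \<Rightarrow>\<^sub>0 'k) fmod. simple_module R T \<and> (\<exists>t\<in>carrier T. e \<odot>\<^bsub>T\<^esub> t \<noteq> \<zero>\<^bsub>T\<^esub>) \<longrightarrow>
      module_iso R S T)" for S :: "('g \<Rightarrow>\<^sub>0 'k) fmod" and e
  define e where "e S = (SOME e. Q S e)" for S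
  have Q: "Q S (e S)" if "S \<in> Y" for S
  proof -
    have "simple_module R S" using that Y(2) by (auto simp: si_def)
    then have "\<exists>e. Q S e" using simple_idempotent[of S] unfolding Q_def by blast
    then show ?thesis unfolding e_def by (rule someI_ex)
  qed
  have e: "\<And>S. S \<in> Y \<Longrightarrow> e S \<in> carrier R" "\<And>S. S \<in> Y \<Longrightarrow> e S \<otimes>\<^bsub>R\<^esub> e S = e S"
    "\<And>S. S \<in> Y \<Longrightarrow> \<exists>x\<in>carrier S. e S \<odot>\<^bsub>S\<^esub> x \<noteq> \<zero>\<^bsub>S\<^esub>"
    "\<And>S (T :: ('g \<Rightarrow>\<^sub>0 'k) fmod). S \<in> Y \<Longrightarrow> simple_module R T \<Longrightarrow> \<exists>t\<in>carrier T. e S \<odot>\<^bsub>T\<^esub> t \<noteq> \<zero>\<^bsub>T\<^esub> \<Longrightarrow>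
      module_iso R S T"
    using Q unfolding Q_def by blast+
  have cd: "component_dim G (e S) T = 0 \<longleftrightarrow> S \<noteq> T" if "S \<in> Y" "T \<in> Y" for S T
  proof -
    have T: "left_module R T" "kfin G T" "simple_module R T" using that Y(2) by (auto simp: si_def fg_modules_iff)
    show ?thesis
      unfolding component_dim_eq_0_iff[OF T(1) e(1)[OF that(1)] T(2)]
      using e(3)[OF that(1)] e(4)[OF that(1) T(3)] Y_iso[OF that] by blast
  qed
  \<comment> \<open>Replacing simple modules by their representatives does not change the class, by
    \<open>groth_iso\<close> with the zero module \<open>?Z\<close>.\<close>
  have red: "u - frag_extend (\<lambda>S. frag_of (c S)) u \<in> FQ.N" if "Poly_Mapping.keys u \<subseteq> si" for u
    using that
  proof (induction u rule: frag_induction)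
    case (one S)
    then show ?case
      using groth_iso[of S "fg_modules R" "c S" R ?Z] c[OF one] siL Z Z0
      by (auto simp: si_def groth_subgroup_eq)
  next
    case (diff a b)
    from FQ.N_diff[OF this] show ?case by (simp add: frag_extend_diff algebra_simps)
  qed (simp add: FQ.N_zero)
  have red_keys: "Poly_Mapping.keys (frag_extend (\<lambda>S. frag_of (c S)) u) \<subseteq> Y"
    if "Poly_Mapping.keys u \<subseteq> si" for u
    using keys_frag_extend[of "\<lambda>S. frag_of (c S)" u] cY that by (fastforce simp: keys_frag_of)
  have gen: "\<exists>u. Poly_Mapping.keys u \<subseteq> Y \<and> x - u \<in> FQ.N" if "Poly_Mapping.keys x \<subseteq> fg_modules R" for x
    using that
  proof (induction x rule: frag_induction)
    case zero
    then show ?case using FQ.N_zero by (intro exI[of _ 0]) simp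
  next
    case (one M)
    then obtain X u where u: "X \<subseteq> si" "Poly_Mapping.keys u \<subseteq> X" "frag_of M - u \<in> FQ.N"
      using simple_decomposition[of M] unfolding si_def by blast
    then have us: "Poly_Mapping.keys u \<subseteq> si" by blast
    from FQ.N_add[OF u(3) red[OF us]] show ?case using red_keys[OF us] by auto
  next
    case (diff a b)
    then obtain u v where uv: "Poly_Mapping.keys u \<subseteq> Y" "a - u \<in> FQ.N" "Poly_Mapping.keys v \<subseteq> Y" "b - v \<in> FQ.N"
      by blast
    have "a - b - (u - v) \<in> FQ.N" using FQ.N_diff[OF uv(2,4)] by (simp add: algebra_simps)
    moreover have "Poly_Mapping.keys (u - v) \<subseteq> Y" using keys_diff[of u v] uv by blast
    ultimately show ?case by blast
  qed
  have "x \<in> FQ.N" if x: "Poly_Mapping.keys x \<subseteq> fg_modules R"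
    "\<forall>e\<in>e ` Y. frag_eval (component_dim G e) x = 0" for x
  proof -
    obtain u where u: "Poly_Mapping.keys u \<subseteq> Y" "x - u \<in> FQ.N" using gen[OF x(1)] by blast
    have "Poly_Mapping.lookup u S = 0" if S: "S \<in> Y" for S
    proof -
      have "frag_eval (component_dim G (e S)) (x - u) = 0"
        using u(2) component_dim_groth[OF e(1)[OF S] e(2)[OF S]] by (rule FQ.frag_eval_N)
      then have "frag_eval (component_dim G (e S)) u = 0"
        using x(2) S by (simp add: frag_eval_diff)
      moreover have "frag_eval (component_dim G (e S)) u =
          (\<Sum>T\<in>Y. Poly_Mapping.lookup u T * component_dim G (e S) T)"
        using frag_eval_superset[OF Y(1) u(1), of "component_dim G (e S)"] by simp
      \<comment> \<open>Only the diagonal term survives, a nonzero multiple of the coefficient at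
        \<open>S\<close>.\<close>
      moreover have "\<dots> = (\<Sum>T\<in>{S}. Poly_Mapping.lookup u T * component_dim G (e S) T)"
        using S cd[OF S] by (intro sum.mono_neutral_right[OF Y(1)]) auto
      ultimately show ?thesis using cd[OF S S] by simp
    qed
    then have "u = 0" using u(1) by (intro poly_mapping_eqI) (auto simp: in_keys_iff subset_iff)
    with u(2) show ?thesis by simp
  qed
  then show ?thesis using Y(1) e(1,2) by (intro exI[of _ "e ` Y"]) auto
qed

end

section \<open>The pairing\<close>

lemma frag_eval_cong:
  "(\<And>m. m \<in> Poly_Mapping.keys x \<Longrightarrow> f m = g m) \<Longrightarrow> frag_eval f x = frag_eval g x"
  by (simp add: frag_eval_def)

lemma frag_eval_fun_add: "frag_eval (\<lambda>m. f m + g m) x = frag_eval f x + frag_eval g x"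
  by (simp add: frag_eval_def distrib_left sum.distrib)

lemma (in frag_quotient) int_hom_coset_eval:
  assumes "\<And>r. r \<in> Rel \<Longrightarrow> frag_eval f r = 0"
  shows "int_hom Q (coset_eval (frag_eval f))"
  unfolding int_hom_def carrier_Q
  by (auto simp: mult_Q coset_eval_eq[OF assms] frag_eval_add simp del: mult_FactGroup)

section \<open>Restriction to subgroups and conjugation of idempotents\<close>

lemma group_ring_subgroup:
  "group_ring k (G\<lparr>carrier := H\<rparr>) = (group_ring k G)\<lparr>carrier := {f. Poly_Mapping.keys f \<subseteq> H}\<rparr>"
  by (simp add: group_ring_def)

lemma group_ring_map_id: "group_ring_map (\<lambda>h. h) = (\<lambda>f. f)"
proof
  fix f :: "'a \<Rightarrow>\<^sub>0 'b::field"
  show "group_ring_map (\<lambda>h. h) f = f"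
    unfolding group_ring_map_def
    by (rule poly_mapping_eqI)
      (auto simp: lookup_sum lookup_single when_def in_keys_iff intro: sum.neutral)
qed

lemma restrict_scalars_id: "restrict_scalars (\<lambda>r. r) = (\<lambda>M. M)"
  by (rule ext) (simp add: restrict_scalars_def)

text \<open>The underlying K-space involves the group only through its unit, so dim eM is the same
  number over \<Gamma> and over H. This identifies values of the pairing over \<Gamma> with
  functionals on G(K[H]).\<close>

lemma component_dim_subgroup: "component_dim (G\<lparr>carrier := H\<rparr>) e = component_dim G e"
  by (rule ext) (simp add: component_dim_def)

context group_algebra
begin

lemma subgroup_ring_carrier:
  assumes "subgroup H G"
  shows "carrier (group_ring k (G\<lparr>carrier := H\<rparr>)) \<subseteq> carrier R"
  using subgroup.subset[OF assms] by (auto simp: group_ring_def)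

lemma left_module_subgroup:
  assumes "subgroup H G" "left_module R M"
  shows "left_module (group_ring k (G\<lparr>carrier := H\<rparr>)) M"
proof -
  interpret L: left_module R M by fact
  interpret H: group_algebra "G\<lparr>carrier := H\<rparr>" k
    using subgroup_imp_group[OF assms(1)] by (simp add: group_algebra_def)
  have s: "f \<in> carrier H.R \<Longrightarrow> f \<in> carrier R" for f using subgroup_ring_carrier[OF assms(1)] by blast
  have eq: "f \<oplus>\<^bsub>H.R\<^esub> g = f \<oplus>\<^bsub>R\<^esub> g" "f \<otimes>\<^bsub>H.R\<^esub> g = f \<otimes>\<^bsub>R\<^esub> g" "\<one>\<^bsub>H.R\<^esub> = \<one>\<^bsub>R\<^esub>" for f g
    by (simp_all add: group_ring_def)
  show ?thesis
    by (intro left_module.intro left_module_axioms.intro)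
      (simp_all add: eq s H.ring_R L.M.abelian_group_axioms L.smult_closed L.smult_l_distr
        L.smult_r_distr L.smult_assoc1 L.smult_one)
qed

lemma short_exact_subgroup:
  assumes "subgroup H G" "short_exact R M' M M''"
  shows "short_exact (group_ring k (G\<lparr>carrier := H\<rparr>)) M' M M''"
proof -
  have "f \<in> mhom R A B \<Longrightarrow> f \<in> mhom (group_ring k (G\<lparr>carrier := H\<rparr>)) A B"
    for f and A B :: "('g \<Rightarrow>\<^sub>0 'k, 'c) module"
    using subgroup_ring_carrier[OF assms(1)] by (auto simp: LinearCombinations.module_hom_def)
  with assms(2) show ?thesis unfolding short_exact_def by blast
qed

lemma findim_modules_iff: "M \<in> findim_modules k G \<longleftrightarrow> left_module R M \<and> kfin G M"
  by (simp add: findim_modules_def scalar_space_def)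

lemma findim_fg_modules:
  assumes "subgroup H G" "M \<in> findim_modules k G"
  shows "M \<in> fg_modules (group_ring k (G\<lparr>carrier := H\<rparr>))"
proof -
  interpret H: group_algebra "G\<lparr>carrier := H\<rparr>" k
    using subgroup_imp_group[OF assms(1)] by (simp add: group_algebra_def)
  have "left_module H.R M" 
    by (rule left_module_subgroup[OF assms(1)]) (use assms(2) in \<open>simp add: findim_modules_iff\<close>)
  then show ?thesis
    using H.kfin_fin_generated[of M] assms(2) by (simp add: fg_modules_def findim_modules_iff)
qed

text \<open>Multiplication by \<open>u\<close> maps eM isomorphically onto (u e u^-1)M, with inverse
  multiplication by u^-1.\<close>

lemma component_dim_conj:
  assumes M: "left_module R M" "kfin G M" and u: "u \<in> carrier G" and e: "e \<in> carrier R"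
  defines "e' \<equiv> Poly_Mapping.single u 1 \<otimes>\<^bsub>R\<^esub> e \<otimes>\<^bsub>R\<^esub> Poly_Mapping.single (inv u) 1"
  shows "component_dim G e' M = component_dim G e M"
proof -
  interpret L: left_module R M by fact
  let ?u = "Poly_Mapping.single u 1 :: 'g \<Rightarrow>\<^sub>0 'k" and ?v = "Poly_Mapping.single (inv u) 1 :: 'g \<Rightarrow>\<^sub>0 'k"
  have uv: "?u \<in> carrier R" "?v \<in> carrier R" using u by (auto intro!: R_single)
  have e': "e' \<in> carrier R" using uv e by (simp add: e'_def)
  have vu: "?v \<otimes>\<^bsub>R\<^esub> ?u = \<one>\<^bsub>R\<^esub>" "?u \<otimes>\<^bsub>R\<^esub> ?v = \<one>\<^bsub>R\<^esub>" using u by (simp_all add: R_mult_single R_simps)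
  have vum: "?v \<odot>\<^bsub>M\<^esub> (?u \<odot>\<^bsub>M\<^esub> x) = x" "?u \<odot>\<^bsub>M\<^esub> (?v \<odot>\<^bsub>M\<^esub> x) = x" if "x \<in> carrier M" for x
    using L.smult_one[OF that] uv vu that by (simp_all flip: L.smult_assoc1)
  have e'm: "e' \<odot>\<^bsub>M\<^esub> x = ?u \<odot>\<^bsub>M\<^esub> (e \<odot>\<^bsub>M\<^esub> (?v \<odot>\<^bsub>M\<^esub> x))" if "x \<in> carrier M" for x
    using that e uv by (simp add: e'_def L.smult_assoc1 L.smult_closed)
  let ?E = "\<lambda>e. M\<lparr>carrier := (\<lambda>x. e \<odot>\<^bsub>M\<^esub> x) ` carrier M\<rparr>"
  interpret E: field_space "scalar_space G (?E e)" by (rule component_space(1)[OF M(1) e M(2)])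
  interpret E': field_space "scalar_space G (?E e')" by (rule component_space(1)[OF M(1) e' M(2)])
  have im: "(\<lambda>x. ?u \<odot>\<^bsub>M\<^esub> x) ` carrier (?E e) = carrier (?E e')"
  proof (intro equalityI subsetI)
    fix y assume "y \<in> (\<lambda>x. ?u \<odot>\<^bsub>M\<^esub> x) ` carrier (?E e)"
    then obtain x where x: "x \<in> carrier M" "y = ?u \<odot>\<^bsub>M\<^esub> (e \<odot>\<^bsub>M\<^esub> x)" by auto
    then have "y = e' \<odot>\<^bsub>M\<^esub> (?u \<odot>\<^bsub>M\<^esub> x)" "?u \<odot>\<^bsub>M\<^esub> x \<in> carrier M"
      using e'm vum uv L.smult_closed by simp_all
    then show "y \<in> carrier (?E e')" by simp
  next
    fix y assume "y \<in> carrier (?E e')"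
    then obtain x where x: "x \<in> carrier M" "y = e' \<odot>\<^bsub>M\<^esub> x" by auto
    then have "y = ?u \<odot>\<^bsub>M\<^esub> (e \<odot>\<^bsub>M\<^esub> (?v \<odot>\<^bsub>M\<^esub> x))" "?v \<odot>\<^bsub>M\<^esub> x \<in> carrier M"
      using e'm uv L.smult_closed by simp_all
    then show "y \<in> (\<lambda>x. ?u \<odot>\<^bsub>M\<^esub> x) ` carrier (?E e)" by simp
  qed
  have EM: "x \<in> carrier M" if "x \<in> carrier (?E e)" for x using that e L.smult_closed by auto
  have comm: "?u \<odot>\<^bsub>M\<^esub> (Poly_Mapping.single \<one> c \<odot>\<^bsub>M\<^esub> x) = Poly_Mapping.single \<one> c \<odot>\<^bsub>M\<^esub> (?u \<odot>\<^bsub>M\<^esub> x)"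
    if "x \<in> carrier M" for c x
    using scalar_central[OF uv(1), of c] that uv R_single[OF one_closed] by (simp flip: L.smult_assoc1)
  interpret T: linear_map class_ring "scalar_space G (?E e)" "scalar_space G (?E e')" "\<lambda>x. ?u \<odot>\<^bsub>M\<^esub> x"
  proof unfold_locales
    show "(\<lambda>x. ?u \<odot>\<^bsub>M\<^esub> x) \<in> mhom class_ring (scalar_space G (?E e)) (scalar_space G (?E e'))"
    proof (rule mhomI)
      show "?u \<odot>\<^bsub>M\<^esub> x \<in> carrier (scalar_space G (?E e'))" if "x \<in> carrier (scalar_space G (?E e))" for x
        using that im by (auto simp del: image_image)
    qed (use EM comm uv in \<open>auto simp: L.smult_r_distr\<close>)
  qed
  have inj: "inj_on (\<lambda>x. ?u \<odot>\<^bsub>M\<^esub> x) (carrier (scalar_space G (?E e)))"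
    by (rule inj_on_inverseI[of _ "\<lambda>x. ?v \<odot>\<^bsub>M\<^esub> x"]) (use EM vum in auto)
  have "E.dim = E'.dim"
    using component_space(2)[OF M(1) e M(2)] inj im by (intro T.dim_eq) auto
  then show ?thesis by (simp add: component_dim_def)
qed

end

section \<open>The image of j and the comparison of dimensions\<close>

locale finite_subgroup_family = group_algebra G k
  for G :: "('g, 'a) monoid_scheme" (structure) and k :: "'k::field_char_0 itself" +
  fixes \<F> :: "'g set set"
  assumes family: "\<F> \<subseteq> finite_subgroups G"
begin

abbreviation "RS H \<equiv> group_ring k (G\<lparr>carrier := H\<rparr>)"
abbreviation "NS H \<equiv> groth_subgroup (RS H) (fg_modules (RS H))"
abbreviation "FD \<equiv> findim_modules k G"

lemma familyD: "H \<in> \<F> \<Longrightarrow> subgroup H G" "H \<in> \<F> \<Longrightarrow> finite H"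
  using family by (auto simp: finite_subgroups_def)

lemma subgroup_algebra: "H \<in> \<F> \<Longrightarrow> finite_group_algebra (G\<lparr>carrier := H\<rparr>)"
  using subgroup_imp_group[OF familyD(1)] familyD(2)
  by (simp add: finite_group_algebra_def group_algebra_def finite_group_algebra_axioms_def)

sublocale Gf: frag_quotient FD "groth_relators R FD"
  by (rule groth_relators_quotient)

sublocale K0: frag_quotient "fg_projectives R" "groth_relators R (fg_projectives R)"
  by (rule groth_relators_quotient)

text \<open>Restriction to H changes neither the module records nor the maps of an exact sequence,
  so a relation over \<Gamma> is literally one over H.\<close>

lemma Gf_N_subset:
  assumes H: "H \<in> \<F>" and x: "x \<in> Gf.N"
  shows "x \<in> NS H"
proof -
  interpret H: finite_group_algebra "G\<lparr>carrier := H\<rparr>" k by (rule subgroup_algebra[OF H])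
  show ?thesis using x unfolding H.groth_subgroup_eq
  proof (induction rule: Gf.N_induct)
    case (Rel r)
    then obtain M' M M'' where "r = frag_of M - (frag_of M' + frag_of M'')" "M' \<in> FD" "M \<in> FD" "M'' \<in> FD"
      "short_exact R M' M M''" unfolding groth_relators_def by blast
    then have "r \<in> groth_relators H.R (fg_modules H.R)"
      unfolding groth_relators_def
      using findim_fg_modules[OF familyD(1)[OF H]] short_exact_subgroup[OF familyD(1)[OF H]] by blast
    then show ?case by (rule H.FQ.N_Rel)
  qed (simp_all add: H.FQ.N_zero H.FQ.N_minus H.FQ.N_add)
qed

text \<open>Pulling back along the inclusion is the identity on records, so a class and its
  restriction have a common representative \<open>x\<close>.\<close>

lemma res_map_coset:
  assumes H: "H \<in> \<F>"
  shows "res_map k G H (frag_coset Gf.N x) = frag_coset (NS H) x"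
proof -
  interpret H: finite_group_algebra "G\<lparr>carrier := H\<rparr>" k by (rule subgroup_algebra[OF H])
  have "H.FQ.N <#>\<^bsub>free_Abelian_group (fg_modules H.R)\<^esub> ((\<lambda>x. x) ` frag_coset Gf.N x) = frag_coset H.FQ.N x"
    using Gf_N_subset[OF H] Gf.N_zero by (intro H.FQ.set_mult_coset_image) (auto simp: H.groth_subgroup_eq)
  then show ?thesis
    by (simp add: res_map_def pullback_def groth_map_def group_ring_map_id restrict_scalars_id
        H.groth_subgroup_eq flip: frag_expansion)
qed

text \<open>The family of restrictions of a virtual finite dimensional \<Gamma>-module. Elements of
  the image of j are handled through such representatives.\<close>

definition "\<rho> x = (\<lambda>H\<in>\<F>. frag_coset (NS H) x)"

abbreviation "J \<equiv> im_j k G \<F>"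

lemma J_carrier: "carrier J = \<rho> ` {x. Poly_Mapping.keys x \<subseteq> FD}"
proof -
  have "carrier J = (\<lambda>X. \<lambda>H\<in>\<F>. res_map k G H X) ` carrier (Gf_group k G)"
    by (simp add: im_j_def j_map_def G_bar_def)
  also have "carrier (Gf_group k G) = frag_coset Gf.N ` {x. Poly_Mapping.keys x \<subseteq> FD}"
    by (simp add: Gf_group_def groth_group_def groth_subgroup_def Gf.carrier_Q)
  finally show ?thesis
    unfolding image_image \<rho>_def using res_map_coset by (auto intro!: image_cong restrict_ext)
qed

lemma FD_keys: "H \<in> \<F> \<Longrightarrow> Poly_Mapping.keys x \<subseteq> FD \<Longrightarrow> Poly_Mapping.keys x \<subseteq> fg_modules (RS H)"
  using findim_fg_modules[OF familyD(1)] by blast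

lemma J_mult:
  assumes "Poly_Mapping.keys x \<subseteq> FD" "Poly_Mapping.keys y \<subseteq> FD"
  shows "\<rho> x \<otimes>\<^bsub>J\<^esub> \<rho> y = \<rho> (x + y)"
proof -
  have "frag_coset (NS H) x \<otimes>\<^bsub>G_group (RS H)\<^esub> frag_coset (NS H) y = frag_coset (NS H) (x + y)"
    if H: "H \<in> \<F>" for H
  proof -
    interpret H: finite_group_algebra "G\<lparr>carrier := H\<rparr>" k by (rule subgroup_algebra[OF H])
    show ?thesis using H.FQ.mult_Q[OF FD_keys[OF H assms(1)] FD_keys[OF H assms(2)]]
      by (simp add: G_group_def groth_group_def H.groth_subgroup_eq)
  qed
  then show ?thesis
    by (auto simp: im_j_def G_lim_def G_prod_def \<rho>_def intro!: restrict_ext)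
qed

lemma J_one: "\<one>\<^bsub>J\<^esub> = \<rho> 0"
  by (auto simp: im_j_def G_lim_def G_prod_def \<rho>_def G_group_def groth_group_def frag_coset_def
      intro!: restrict_ext)

text \<open>The group laws descend along \<open>\<rho>\<close> from the free abelian group on the
  finite dimensional modules.\<close>

lemma J_comm_group: "comm_group J"
proof (rule comm_groupI)
  have k: "Poly_Mapping.keys (x + y) \<subseteq> FD" if "Poly_Mapping.keys x \<subseteq> FD" "Poly_Mapping.keys y \<subseteq> FD"
    for x y :: "('g \<Rightarrow>\<^sub>0 'k) fmod \<Rightarrow>\<^sub>0 int" using keys_add[of x y] that by blast
  show "a \<otimes>\<^bsub>J\<^esub> b \<in> carrier J" if "a \<in> carrier J" "b \<in> carrier J" for a b
    using that by (auto simp: J_carrier J_mult k)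
  show "\<one>\<^bsub>J\<^esub> \<in> carrier J" by (auto simp: J_carrier J_one)
  show "a \<otimes>\<^bsub>J\<^esub> b \<otimes>\<^bsub>J\<^esub> c = a \<otimes>\<^bsub>J\<^esub> (b \<otimes>\<^bsub>J\<^esub> c)" if "a \<in> carrier J" "b \<in> carrier J" "c \<in> carrier J" for a b c
    using that by (auto simp: J_carrier J_mult k add.assoc)
  show "a \<otimes>\<^bsub>J\<^esub> b = b \<otimes>\<^bsub>J\<^esub> a" if "a \<in> carrier J" "b \<in> carrier J" for a b
    using that by (auto simp: J_carrier J_mult add.commute)
  show "\<one>\<^bsub>J\<^esub> \<otimes>\<^bsub>J\<^esub> a = a" if "a \<in> carrier J" for a
    using that by (auto simp: J_carrier J_mult J_one)
  show "\<exists>b\<in>carrier J. b \<otimes>\<^bsub>J\<^esub> a = \<one>\<^bsub>J\<^esub>" if a: "a \<in> carrier J" for a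
  proof -
    obtain x where x: "a = \<rho> x" "Poly_Mapping.keys x \<subseteq> FD" using a by (auto simp: J_carrier)
    then show ?thesis by (intro bexI[of _ "\<rho> (- x)"]) (auto simp: J_mult J_one J_carrier)
  qed
qed

definition "\<phi> H e a = coset_eval (frag_eval (component_dim G e)) (a H)"

lemma \<phi>_\<rho>:
  assumes "H \<in> \<F>" "e \<in> carrier (RS H)" "e \<otimes>\<^bsub>R\<^esub> e = e"
  shows "\<phi> H e (\<rho> x) = frag_eval (component_dim G e) x"
proof -
  interpret H: finite_group_algebra "G\<lparr>carrier := H\<rparr>" k by (rule subgroup_algebra[OF assms(1)])
  have "e \<otimes>\<^bsub>H.R\<^esub> e = e" using assms(3) by (simp add: group_ring_subgroup)
  then have "coset_eval (frag_eval (component_dim G e)) (frag_coset H.FQ.N x) = frag_eval (component_dim G e) x"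
    using H.component_dim_groth[OF assms(2)] by (intro H.FQ.coset_eval_eq) (simp add: component_dim_subgroup)
  then show ?thesis using assms(1) by (simp add: \<phi>_def \<rho>_def H.groth_subgroup_eq)
qed

text \<open>Conjugation by u^-1 carries the group ring of u H u^-1 into that of H; by additivity
  this is a computation with single group elements.\<close>

lemma conj_ring:
  assumes u: "u \<in> carrier G" and H: "subgroup H G" and f: "Poly_Mapping.keys f \<subseteq> conj_subgroup G u H"
  shows "Poly_Mapping.keys (Poly_Mapping.single (inv u) 1 \<otimes>\<^bsub>R\<^esub> f \<otimes>\<^bsub>R\<^esub> Poly_Mapping.single u (1 :: 'k)) \<subseteq> H"
  using f
proof (induction f rule: poly_mapping_induct)
  case zero
  then show ?case by (simp add: R_mult_0)
next
  case (single x a)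
  then obtain h where h: "h \<in> H" "x = u \<otimes> h \<otimes> inv u" by (auto simp: conj_subgroup_def)
  have "h \<in> carrier G" using h subgroup.mem_carrier[OF H] by blast
  moreover from this have "inv u \<otimes> (u \<otimes> h) = h" using u by (simp flip: m_assoc)
  ultimately have "inv u \<otimes> x \<otimes> u = h" using u by (simp add: h(2) m_assoc)
  then show ?case using h(1) by (simp add: R_mult_single)
next
  case (add f g)
  then show ?case
    using keys_add[of "Poly_Mapping.single (inv u) 1 \<otimes>\<^bsub>R\<^esub> f \<otimes>\<^bsub>R\<^esub> Poly_Mapping.single u (1 :: 'k)"
        "Poly_Mapping.single (inv u) 1 \<otimes>\<^bsub>R\<^esub> g \<otimes>\<^bsub>R\<^esub> Poly_Mapping.single u (1 :: 'k)"]
    by (simp add: R_mult_add_left R_mult_add_right) blast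
qed

text \<open>The idempotent \<open>e\<close> over u H u^-1 is moved to u^-1 e u over H. On
  \<Gamma>-modules this preserves dim eM, and over H the moved idempotent kills every
  relation.\<close>

lemma component_dim_conj_vanishes:
  assumes H: "H \<in> \<F>" and u: "u \<in> carrier G" and e: "e \<in> carrier (RS (conj_subgroup G u H))" "e \<otimes>\<^bsub>R\<^esub> e = e"
    and eR: "e \<in> carrier R" and x: "x \<in> NS H" "Poly_Mapping.keys x \<subseteq> FD"
  shows "frag_eval (component_dim G e) x = 0"
proof -
  interpret H: finite_group_algebra "G\<lparr>carrier := H\<rparr>" k by (rule subgroup_algebra[OF H])
  let ?u = "Poly_Mapping.single u 1 :: 'g \<Rightarrow>\<^sub>0 'k" and ?v = "Poly_Mapping.single (inv u) 1 :: 'g \<Rightarrow>\<^sub>0 'k"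
  define e' where "e' = ?v \<otimes>\<^bsub>R\<^esub> e \<otimes>\<^bsub>R\<^esub> ?u"
  have uv: "?u \<in> carrier R" "?v \<in> carrier R" using u by (auto intro!: R_single)
  have "?u \<otimes>\<^bsub>R\<^esub> ?v = \<one>\<^bsub>R\<^esub>" using u by (simp add: R_mult_single R_simps)
  then have uvx: "?u \<otimes>\<^bsub>R\<^esub> (?v \<otimes>\<^bsub>R\<^esub> y) = y" if "y \<in> carrier R" for y
    using uv that by (simp flip: R.m_assoc)
  have ex: "e \<otimes>\<^bsub>R\<^esub> (e \<otimes>\<^bsub>R\<^esub> y) = e \<otimes>\<^bsub>R\<^esub> y" if "y \<in> carrier R" for y
    using eR that e(2) by (simp flip: R.m_assoc)
  have "e' \<otimes>\<^bsub>R\<^esub> e' = e'" using uv eR by (simp add: e'_def R.m_assoc uvx ex)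
  then have ee: "e' \<otimes>\<^bsub>H.R\<^esub> e' = e'" by (simp add: group_ring_subgroup)
  have eH: "e' \<in> carrier H.R"
    using conj_ring[OF u familyD(1)[OF H], of e] e(1) by (simp add: e'_def group_ring_subgroup)
  have "component_dim G e M = component_dim G e' M" if "M \<in> FD" for M
    using component_dim_conj[of M "inv u" e] that u eR by (simp add: e'_def findim_modules_iff)
  then have "frag_eval (component_dim G e) x = frag_eval (component_dim G e') x"
    using x(2) by (intro frag_eval_cong) blast
  also have "\<dots> = 0"
    using H.FQ.frag_eval_N[of x "component_dim G e'"] x(1) H.component_dim_groth[OF eH ee]
    by (simp add: H.groth_subgroup_eq component_dim_subgroup)
  finally show ?thesis .
qed

text \<open>The finite index set consists of the pairs (H, e) with H a representative subgroup and e
  in a separating set of idempotents over H. Such a pair provides both the class of K[\<Gamma>]e in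
  K_0 and the functional a \<mapsto> dim e a_H on the image of j.\<close>

theorem rat_dim_im_j_le:
  assumes conj: "\<And>H u. H \<in> \<F> \<Longrightarrow> u \<in> carrier G \<Longrightarrow> conj_subgroup G u H \<in> \<F>"
    and fin: "finitely_many_finite_subgroups_up_to_conj G"
  shows "rat_dim (tensor_rat J) \<le>o rat_dim (tensor_rat (K0_group R))"
proof -
  define orb where "orb H = {conj_subgroup G u H | u. u \<in> carrier G}" for H
  have "finite (orb ` \<F>)"
    using fin family unfolding finitely_many_finite_subgroups_up_to_conj_def orb_def
    by (meson finite_subset image_mono)
  \<comment> \<open>Finiteness is inherited from the conjugacy classes of all finite subgroups; the
    representatives are taken inside \<F>.\<close>
  then obtain \<F>0 where F0: "\<F>0 \<subseteq> \<F>" "finite \<F>0" "orb ` \<F> = orb ` \<F>0"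
    using finite_subset_image[of "orb ` \<F>" orb \<F>] by blast
  have rep: "\<exists>H\<in>\<F>0. \<exists>u\<in>carrier G. H' = conj_subgroup G u H" if H': "H' \<in> \<F>" for H'
  proof -
    obtain H where H: "H \<in> \<F>0" "orb H' = orb H" using H' F0(3) by blast
    have "conj_subgroup G \<one> H' = H'"
      using subgroup.mem_carrier[OF familyD(1)[OF H']] by (simp add: conj_subgroup_def)
    then have "H' \<in> orb H'" unfolding orb_def using one_closed by (metis (mono_tags, lifting) mem_Collect_eq)
    then show ?thesis using H unfolding orb_def by auto
  qed
  define separates where "separates H E \<longleftrightarrow> finite E \<and> (\<forall>e\<in>E. e \<in> carrier (RS H) \<and> e \<otimes>\<^bsub>R\<^esub> e = e) \<and>
    (\<forall>x. Poly_Mapping.keys x \<subseteq> FD \<longrightarrow> (\<forall>e\<in>E. frag_eval (component_dim G e) x = 0) \<longrightarrow> x \<in> NS H)"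
    for H E
  have "\<exists>E. separates H E" if H: "H \<in> \<F>" for H
  proof -
    interpret H: finite_group_algebra "G\<lparr>carrier := H\<rparr>" k by (rule subgroup_algebra[OF H])
    have mult: "e \<otimes>\<^bsub>H.R\<^esub> e = e \<otimes>\<^bsub>R\<^esub> e" for e by (simp add: group_ring_subgroup)
    obtain E where E: "finite E" "\<forall>e\<in>E. e \<in> carrier (RS H) \<and> e \<otimes>\<^bsub>R\<^esub> e = e"
      "\<And>x. Poly_Mapping.keys x \<subseteq> fg_modules (RS H) \<Longrightarrow> \<forall>e\<in>E. frag_eval (component_dim G e) x = 0 \<Longrightarrow> x \<in> NS H"
      using H.finite_separating_idempotents
      unfolding component_dim_subgroup H.groth_subgroup_eq mult by blast
    have "separates H E" unfolding separates_def using E FD_keys[OF H] by blast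
    then show ?thesis by blast
  qed
  then obtain E where "\<forall>H\<in>\<F>. separates H (E H)" using bchoice[of \<F> separates] by blast
  then have E: "\<And>H. H \<in> \<F> \<Longrightarrow> finite (E H)"
    "\<And>H e. H \<in> \<F> \<Longrightarrow> e \<in> E H \<Longrightarrow> e \<in> carrier (RS H)" "\<And>H e. H \<in> \<F> \<Longrightarrow> e \<in> E H \<Longrightarrow> e \<otimes>\<^bsub>R\<^esub> e = e"
    "\<And>H x. H \<in> \<F> \<Longrightarrow> Poly_Mapping.keys x \<subseteq> FD \<Longrightarrow> \<forall>e\<in>E H. frag_eval (component_dim G e) x = 0 \<Longrightarrow> x \<in> NS H"
    unfolding separates_def by blast+
  have ER: "e \<in> carrier R" if "H \<in> \<F>" "e \<in> E H" for H e
    using E(2)[OF that] subgroup_ring_carrier[OF familyD(1)[OF that(1)]] by blast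
  have K0_eq: "K0_group R = K0.Q" by (simp add: K0_group_def groth_group_def groth_subgroup_def)
  show ?thesis unfolding K0_eq
  proof (rule rat_dim_tensor_le[where I = "Sigma \<F>0 E" and \<phi> = "\<lambda>(H, e). \<phi> H e"
        and b = "\<lambda>(H, e). frag_coset K0.N (frag_of (R.Pm e))"])
    show "comm_group J" by (rule J_comm_group)
    show "comm_group K0.Q" by (rule K0.Q_comm_group)
    show "finite (Sigma \<F>0 E)" using F0 E(1) by (intro finite_SigmaI) auto
    fix i assume i: "i \<in> Sigma \<F>0 E"
    then obtain H e where He: "i = (H, e)" "H \<in> \<F>" "e \<in> E H" using F0 by auto
    show "(case i of (H, e) \<Rightarrow> frag_coset K0.N (frag_of (R.Pm e))) \<in> carrier K0.Q"
      using R.Pm_fg_projective[OF ER[OF He(2,3)] E(3)[OF He(2,3)]]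
      by (auto simp: He(1) K0.carrier_Q keys_frag_of)
    show "int_hom J (case i of (H, e) \<Rightarrow> \<phi> H e)"
      unfolding int_hom_def He(1)
      by (auto simp: J_carrier J_mult \<phi>_\<rho>[OF He(2) E(2)[OF He(2,3)] E(3)[OF He(2,3)]] frag_eval_add)
  next
    fix a assume "a \<in> carrier J"
    then obtain x where x: "a = \<rho> x" "Poly_Mapping.keys x \<subseteq> FD" by (auto simp: J_carrier)
    have \<phi>x: "\<phi> H e a = frag_eval (component_dim G e) x" if "H \<in> \<F>" "e \<in> E H" for H e
      using \<phi>_\<rho>[OF that(1) E(2)[OF that] E(3)[OF that]] x(1) by simp
    show "a = \<one>\<^bsub>J\<^esub>" if 0: "\<forall>i\<in>Sigma \<F>0 E. (case i of (H, e) \<Rightarrow> \<phi> H e) a = 0"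
    proof -
      \<comment> \<open>The separating idempotents give triviality over the representatives;
        \<open>component_dim_conj_vanishes\<close> then transports it to every other member of
        \<F>.\<close>
      have xN: "x \<in> NS H" if H: "H \<in> \<F>0" for H
        using E(4)[of H x] \<phi>x[of H] 0 H F0(1) x(2) by fastforce
      have "x \<in> NS H'" if H': "H' \<in> \<F>" for H'
      proof -
        obtain H u where Hu: "H \<in> \<F>0" "u \<in> carrier G" "H' = conj_subgroup G u H" using rep[OF H'] by blast
        show ?thesis
        proof (rule E(4)[OF H' x(2)], intro ballI)
          fix e assume e: "e \<in> E H'"
          show "frag_eval (component_dim G e) x = 0"
            using component_dim_conj_vanishes[of H u e x] Hu F0(1) E(2)[OF H' e] E(3)[OF H' e]
              ER[OF H' e] xN[OF Hu(1)] x(2) by auto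
        qed
      qed
      then have "frag_coset (NS H) x = frag_coset (NS H) 0" if "H \<in> \<F>" for H
      proof -
        interpret H: finite_group_algebra "G\<lparr>carrier := H\<rparr>" k by (rule subgroup_algebra[OF that])
        have "x - 0 \<in> H.FQ.N" using \<open>\<And>H'. H' \<in> \<F> \<Longrightarrow> x \<in> NS H'\<close>[OF that] by (simp add: H.groth_subgroup_eq)
        then show ?thesis unfolding H.groth_subgroup_eq by (simp only: H.FQ.coset_eq_iff)
      qed
      then show ?thesis unfolding J_one x(1) \<rho>_def by (intro restrict_ext)
    qed
    \<comment> \<open>The pairing with a fixed virtual module \<open>x\<close> representing
      \<open>a\<close>. It may depend on the choice of \<open>x\<close>, which
      \<open>rat_dim_tensor_le\<close> permits, while its values at the classes of K[\<Gamma>]e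
      depend on \<open>a\<close> only.\<close>
    let ?f = "\<lambda>P. frag_eval (hom_dim G P) x"
    have f0: "frag_eval ?f r = 0" if r: "r \<in> groth_relators R (fg_projectives R)" for r
    proof -
      obtain P' P P'' where P: "r = frag_of P - (frag_of P' + frag_of P'')" "P' \<in> fg_projectives R"
        "P \<in> fg_projectives R" "P'' \<in> fg_projectives R" "short_exact R P' P P''"
        using r unfolding groth_relators_def by blast
      have "?f P = frag_eval (\<lambda>M. hom_dim G P' M + hom_dim G P'' M) x"
        using x(2) hom_dim_exact[OF P(2-5)] by (intro frag_eval_cong) (auto simp: findim_modules_iff subset_iff)
      then show ?thesis by (simp add: P(1) frag_eval_diff frag_eval_add frag_eval_fun_add)
    qed
    show "\<exists>\<psi>. int_hom K0.Q \<psi> \<and> (\<forall>i\<in>Sigma \<F>0 E. \<psi> (case i of (H, e) \<Rightarrow>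
        frag_coset K0.N (frag_of (R.Pm e))) = (case i of (H, e) \<Rightarrow> \<phi> H e) a)"
    proof (intro exI conjI ballI)
      show "int_hom K0.Q (coset_eval (frag_eval ?f))" by (rule K0.int_hom_coset_eval[OF f0])
      fix i assume "i \<in> Sigma \<F>0 E"
      then obtain H e where He: "i = (H, e)" "H \<in> \<F>" "e \<in> E H" using F0 by auto
      have "?f (R.Pm e) = frag_eval (component_dim G e) x"
        using x(2) hom_dim_principal[OF ER[OF He(2,3)] E(3)[OF He(2,3)]]
        by (intro frag_eval_cong) (auto simp: findim_modules_iff subset_iff)
      then show "coset_eval (frag_eval ?f) (case i of (H, e) \<Rightarrow> frag_coset K0.N (frag_of (R.Pm e))) =
        (case i of (H, e) \<Rightarrow> \<phi> H e) a"
        using K0.coset_eval_eq[OF f0] \<phi>x[OF He(2,3)] by (simp add: He(1))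
    qed
  qed
qed

end

theorem proposition4p1:
  fixes \<Gamma> :: "('g, 'a) monoid_scheme" and \<F> :: "'g set set"
  assumes "group \<Gamma>"
    and "finitely_many_finite_subgroups_up_to_conj \<Gamma>"
    and "family_of_finite_subgroups \<Gamma> \<F>"
    and "virtually_torsion_free \<Gamma>"
  shows "rat_dim (tensor_rat (im_j TYPE('k::field_char_0) \<Gamma> \<F>))
           \<le>o rat_dim (tensor_rat (K0_group (group_ring TYPE('k) \<Gamma>)))"
proof -
  interpret finite_subgroup_family \<Gamma> "TYPE('k)" \<F>
    using assms(1,3)
    by (simp add: finite_subgroup_family_def group_algebra_def finite_subgroup_family_axioms_def
        family_of_finite_subgroups_def)
  show ?thesis
    using assms(2,3) by (intro rat_dim_im_j_le) (auto simp: family_of_finite_subgroups_def)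
qed

end
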